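(* Let $m\in\mathbb N^+$, $0<\alpha<1$, $T>0$, let $\tilde f:=f+\Delta u_0$, and let $v$ be the solution of $$\partial_t^\alpha v(x,t)-\Delta v(x,t)=I_t^{m\alpha}\Delta^m\tilde f(x,t),\quad (x,t)\in\Omega\times(0,T],$$ with $v(x,t)=0$ for $(x,t)\in\partial\Omega\times[0,T]$ and $v(x,0)=0$ for $x\in\Omega$. Suppose that $f+\Delta u_0\in C([0,T];\dot H^{2m}(\Omega))$, that $\|\Delta^{m+2}u_0\|$ is bounded, and that $\|\Delta^{m+1}\partial_t f(\cdot,t)\|\le Q\,t^{-\sigma}$ for $t>0$ and some $0<\sigma<1$. Then $$\|\partial_t v(\cdot,t)\|_{\dot H^2}\le Q\,t^{(m+1)\alpha-1},\qquad t\in(0,T].$$ If, in addition, $\|\Delta^{m+1}\partial_t^2 f(\cdot,t)\|\le Q\,t^{-\sigma}$ for $t>0$, then $$\|\partial_t^2 v(\cdot,t)\|_{\dot H^2}\le Q\,t^{(m+1)\alpha-2},\qquad t\in(0,T].$$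
   Context: $\Omega\subset\mathbb R^d$ ($1\le d\le3$) is an open bounded domain with smooth boundary, and $u_0=u_0(x)$, $f=f(x,t)$ are given functions. $\|\cdot\|$ is the $L^2(\Omega)$ norm. For $\nu>0$, $\beta_\nu(t):=t^{\nu-1}/\Gamma(\nu)$; the Riemann–Liouville integral is $I_t^\nu g(t):=(\beta_\nu*g)(t)=\int_0^t\beta_\nu(t-s)g(s)\,ds$; the Caputo derivative of order $\alpha\in(0,1)$ is $\partial_t^\alpha g:=\beta_{1-\alpha}*\partial_t g$. Let $\{\lambda_i\}$, $\{\phi_i\}$ be the eigenvalues (positive, increasing to $+\infty$) and $L^2(\Omega)$-orthonormal eigenfunctions of $-\Delta:H^2(\Omega)\cap H_0^1(\Omega)\to L^2(\Omega)$. For $q\ge0$, $\dot H^q(\Omega):=\{w\in L^2(\Omega):|w|_{\dot H^q}^2:=\sum_i\lambda_i^q(w,\phi_i)^2<\infty\}$ with norm $\|w\|_{\dot H^q}:=(\|w\|^2+|w|_{\dot H^q}^2)^{1/2}$. $Q$ denotes a generic positive constant, independent of $t$, which may take different values at different occurrences. The solution $v$ is given by $v(t)=\int_0^tE(t-s)\,I_s^{m\alpha}\Delta^m\tilde f(\cdot,s)\,ds$, where $E(t)q:=\sum_{j\ge1}t^{\alpha-1}E_{\alpha,\alpha}(-\lambda_jt^\alpha)(q,\phi_j)\phi_j$ and $E_{p,q}(\cdot)$ is the two-parameter Mittag-Leffler function.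
   Formalization: Also assumed: f(·,t) ∈ Ḣ^{2m+2}(Ω) for t ∈ (0,T] (otherwise u_0=0 and time-independent f in Ḣ^{2m} but not Ḣ^{2m+2} violates the first bound); "‖Δ^{m+2}u_0‖ is bounded" is taken to include u_0 ∈ Ḣ^{2m+4}(Ω). *)

theory Defs
  imports "HOL-Analysis.Analysis"
begin

section \<open>Smooth functions and smooth bounded domains\<close>

primrec Ck_on :: "nat \<Rightarrow> ('a::real_normed_vector) set \<Rightarrow> ('a \<Rightarrow> real) \<Rightarrow> bool" where
  "Ck_on 0 S f \<longleftrightarrow> continuous_on S f"
| "Ck_on (Suc k) S f \<longleftrightarrow> (\<forall>x\<in>S. f differentiable (at x)) \<and>
     (\<forall>h. Ck_on k S (\<lambda>x. frechet_derivative f (at x) h))"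

definition smooth_on :: "('a::real_normed_vector) set \<Rightarrow> ('a \<Rightarrow> real) \<Rightarrow> bool" where
  "smooth_on S f \<longleftrightarrow> (\<forall>k. Ck_on k S f)"

text \<open>Smoothness of the boundary is expressed by local defining functions: near each boundary
  point the set is the sublevel set of a smooth function without critical points.\<close>

definition smooth_boundary :: "(real^'d) set \<Rightarrow> bool" where
  "smooth_boundary \<Omega> \<longleftrightarrow> (\<forall>p\<in>frontier \<Omega>. \<exists>U \<rho>. open U \<and> p \<in> U \<and> smooth_on U \<rho> \<and>
     (\<forall>y\<in>U. frechet_derivative \<rho> (at y) \<noteq> (\<lambda>_. 0)) \<and> \<Omega> \<inter> U = {y\<in>U. \<rho> y < 0})"

definition smooth_bounded_domain :: "(real^'d) set \<Rightarrow> bool" where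
  "smooth_bounded_domain \<Omega> \<longleftrightarrow>
     open \<Omega> \<and> connected \<Omega> \<and> \<Omega> \<noteq> {} \<and> bounded \<Omega> \<and> smooth_boundary \<Omega>"


section \<open>The space L2 and calculus of L2-valued functions of time\<close>

text \<open>Elements of L2 are represented by functions on the whole space, of which only the
  almost-everywhere class on \<open>\<Omega>\<close> matters. Operators that return an L2 element pick an arbitrary
  representative with \<open>SOME\<close>.\<close>

definition L2 :: "(real^'d) set \<Rightarrow> (real^'d \<Rightarrow> real) set" where
  "L2 \<Omega> = {w. w \<in> borel_measurable (lebesgue_on \<Omega>) \<and>
              integrable (lebesgue_on \<Omega>) (\<lambda>x. (w x)\<^sup>2)}"

definition L2_inner :: "(real^'d) set \<Rightarrow> (real^'d \<Rightarrow> real) \<Rightarrow> (real^'d \<Rightarrow> real) \<Rightarrow> real" where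
  "L2_inner \<Omega> u w = (\<integral>x. u x * w x \<partial>lebesgue_on \<Omega>)"

definition L2_norm :: "(real^'d) set \<Rightarrow> (real^'d \<Rightarrow> real) \<Rightarrow> real" where
  "L2_norm \<Omega> w = sqrt (L2_inner \<Omega> w w)"

text \<open>Strong derivative at time \<open>t\<close> relative to \<open>[0,T]\<close> (so it is one-sided at \<open>t = T\<close>). The
  membership conditions are needed because \<^const>\<open>L2_norm\<close> is meaningless outside
  \<^const>\<open>L2\<close>.\<close>

definition has_L2_derivative ::
  "(real^'d) set \<Rightarrow> real \<Rightarrow> (real \<Rightarrow> real^'d \<Rightarrow> real) \<Rightarrow> (real^'d \<Rightarrow> real) \<Rightarrow> real \<Rightarrow> bool" where
  "has_L2_derivative \<Omega> T w g t \<longleftrightarrow> g \<in> L2 \<Omega> \<and> w t \<in> L2 \<Omega> \<and>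
     (\<forall>\<^sub>F s in at t within {0..T}. w s \<in> L2 \<Omega>) \<and>
     ((\<lambda>s. L2_norm \<Omega> (\<lambda>x. (w s x - w t x) / (s - t) - g x)) \<longlongrightarrow> 0) (at t within {0..T})"

text \<open>The integral over \<open>(a,b)\<close> of an L2-valued function, taken in the weak (Pettis) sense; it
  agrees with the Bochner integral whenever the latter exists.\<close>

definition has_L2_integral ::
  "(real^'d) set \<Rightarrow> (real \<Rightarrow> real^'d \<Rightarrow> real) \<Rightarrow> real \<Rightarrow> real \<Rightarrow> (real^'d \<Rightarrow> real) \<Rightarrow> bool" where
  "has_L2_integral \<Omega> G a b u \<longleftrightarrow> u \<in> L2 \<Omega> \<and> (\<forall>s\<in>{a<..<b}. G s \<in> L2 \<Omega>) \<and>
     (\<forall>w\<in>L2 \<Omega>. set_integrable lborel {a<..<b} (\<lambda>s. L2_inner \<Omega> (G s) w) \<and>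
        L2_inner \<Omega> u w = (LINT s:{a<..<b}|lborel. L2_inner \<Omega> (G s) w))"


section \<open>Sobolev spaces, the Laplacian and its Dirichlet eigensystem\<close>

definition test_function :: "(real^'d) set \<Rightarrow> (real^'d \<Rightarrow> real) \<Rightarrow> bool" where
  "test_function \<Omega> \<psi> \<longleftrightarrow> smooth_on UNIV \<psi> \<and>
     compact (closure {x. \<psi> x \<noteq> 0}) \<and> closure {x. \<psi> x \<noteq> 0} \<subseteq> \<Omega>"

definition pdiff :: "'d \<Rightarrow> (real^'d \<Rightarrow> real) \<Rightarrow> real^'d \<Rightarrow> real" where
  "pdiff i \<psi> x = frechet_derivative \<psi> (at x) (axis i 1)"

definition has_weak_pdiff ::
  "(real^'d) set \<Rightarrow> 'd \<Rightarrow> (real^'d \<Rightarrow> real) \<Rightarrow> (real^'d \<Rightarrow> real) \<Rightarrow> bool" where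
  "has_weak_pdiff \<Omega> i w g \<longleftrightarrow> w \<in> L2 \<Omega> \<and> g \<in> L2 \<Omega> \<and>
     (\<forall>\<psi>. test_function \<Omega> \<psi> \<longrightarrow> L2_inner \<Omega> w (pdiff i \<psi>) = - L2_inner \<Omega> g \<psi>)"

definition H1 :: "(real^'d) set \<Rightarrow> (real^'d \<Rightarrow> real) set" where
  "H1 \<Omega> = {w \<in> L2 \<Omega>. \<forall>i. \<exists>g. has_weak_pdiff \<Omega> i w g}"

definition H2 :: "(real^'d) set \<Rightarrow> (real^'d \<Rightarrow> real) set" where
  "H2 \<Omega> = {w \<in> L2 \<Omega>. \<forall>i. \<exists>g\<in>H1 \<Omega>. has_weak_pdiff \<Omega> i w g}"

text \<open>The closure of the test functions in the H1 norm.\<close>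

definition H10 :: "(real^'d) set \<Rightarrow> (real^'d \<Rightarrow> real) set" where
  "H10 \<Omega> = {w \<in> H1 \<Omega>. \<exists>g \<psi>. (\<forall>i. has_weak_pdiff \<Omega> i w (g i)) \<and>
     (\<forall>n::nat. test_function \<Omega> (\<psi> n)) \<and>
     (\<lambda>n. L2_norm \<Omega> (\<lambda>x. \<psi> n x - w x)) \<longlonglongrightarrow> 0 \<and>
     (\<forall>i. (\<lambda>n. L2_norm \<Omega> (\<lambda>x. pdiff i (\<psi> n) x - g i x)) \<longlonglongrightarrow> 0)}"

text \<open>The distributional Laplacian, for functions whose Laplacian lies in L2. The Dirichlet
  condition is not part of it; it enters through the spaces \<open>Hdot\<close> below, on which
  \<open>laplacian\<close> is used.\<close>

definition has_laplacian :: "(real^'d) set \<Rightarrow> (real^'d \<Rightarrow> real) \<Rightarrow> (real^'d \<Rightarrow> real) \<Rightarrow> bool" where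
  "has_laplacian \<Omega> w g \<longleftrightarrow> w \<in> L2 \<Omega> \<and> g \<in> L2 \<Omega> \<and>
     (\<forall>\<psi>. test_function \<Omega> \<psi> \<longrightarrow>
        L2_inner \<Omega> w (\<lambda>x. \<Sum>i\<in>UNIV. pdiff i (pdiff i \<psi>) x) = L2_inner \<Omega> g \<psi>)"

definition laplacian :: "(real^'d) set \<Rightarrow> (real^'d \<Rightarrow> real) \<Rightarrow> real^'d \<Rightarrow> real" where
  "laplacian \<Omega> w = (SOME g. has_laplacian \<Omega> w g)"

text \<open>The eigenpairs are listed with multiplicity and indexed from \<open>0\<close>. That the list is
  exhaustive is expressed by completeness of the eigenfunctions in L2 (last clause).\<close>

definition dirichlet_eigensystem ::
  "(real^'d) set \<Rightarrow> (nat \<Rightarrow> real) \<Rightarrow> (nat \<Rightarrow> real^'d \<Rightarrow> real) \<Rightarrow> bool" where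
  "dirichlet_eigensystem \<Omega> lam \<phi> \<longleftrightarrow>
     (\<forall>j. 0 < lam j) \<and> incseq lam \<and> filterlim lam at_top sequentially \<and>
     (\<forall>j. \<phi> j \<in> H2 \<Omega> \<inter> H10 \<Omega> \<and> has_laplacian \<Omega> (\<phi> j) (\<lambda>x. - lam j * \<phi> j x)) \<and>
     (\<forall>i j. L2_inner \<Omega> (\<phi> i) (\<phi> j) = (if i = j then 1 else 0)) \<and>
     (\<forall>w\<in>L2 \<Omega>. (\<forall>j. L2_inner \<Omega> w (\<phi> j) = 0) \<longrightarrow> L2_norm \<Omega> w = 0)"

definition Hdot ::
  "(real^'d) set \<Rightarrow> (nat \<Rightarrow> real) \<Rightarrow> (nat \<Rightarrow> real^'d \<Rightarrow> real) \<Rightarrow> real \<Rightarrow> (real^'d \<Rightarrow> real) set" where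
  "Hdot \<Omega> lam \<phi> q = {w \<in> L2 \<Omega>. summable (\<lambda>i. lam i powr q * (L2_inner \<Omega> w (\<phi> i))\<^sup>2)}"

definition Hdot_norm ::
  "(real^'d) set \<Rightarrow> (nat \<Rightarrow> real) \<Rightarrow> (nat \<Rightarrow> real^'d \<Rightarrow> real) \<Rightarrow> real \<Rightarrow> (real^'d \<Rightarrow> real) \<Rightarrow> real" where
  "Hdot_norm \<Omega> lam \<phi> q w =
     sqrt ((L2_norm \<Omega> w)\<^sup>2 + (\<Sum>i. lam i powr q * (L2_inner \<Omega> w (\<phi> i))\<^sup>2))"

text \<open>Membership of \<open>w\<close> in \<open>C([0,T]; Hdot q)\<close>.\<close>

definition continuous_Hdot ::
  "(real^'d) set \<Rightarrow> (nat \<Rightarrow> real) \<Rightarrow> (nat \<Rightarrow> real^'d \<Rightarrow> real) \<Rightarrow> real \<Rightarrow> real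
    \<Rightarrow> (real \<Rightarrow> real^'d \<Rightarrow> real) \<Rightarrow> bool" where
  "continuous_Hdot \<Omega> lam \<phi> q T w \<longleftrightarrow> (\<forall>t\<in>{0..T}. w t \<in> Hdot \<Omega> lam \<phi> q \<and>
     ((\<lambda>s. Hdot_norm \<Omega> lam \<phi> q (\<lambda>x. w s x - w t x)) \<longlongrightarrow> 0) (at t within {0..T}))"

text \<open>The estimate that the L2 norm of the \<open>k\<close>-th power of the Laplacian of \<open>w\<close> is at most \<open>c\<close>.
  The powers are those of the Laplacian with Dirichlet conditions, so \<open>w\<close> has to lie in the
  domain \<open>Hdot (2 k)\<close> of the \<open>k\<close>-th power.\<close>

definition laplacian_power_le ::
  "(real^'d) set \<Rightarrow> (nat \<Rightarrow> real) \<Rightarrow> (nat \<Rightarrow> real^'d \<Rightarrow> real) \<Rightarrow> nat \<Rightarrow> (real^'d \<Rightarrow> real)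
    \<Rightarrow> real \<Rightarrow> bool" where
  "laplacian_power_le \<Omega> lam \<phi> k w c \<longleftrightarrow> w \<in> Hdot \<Omega> lam \<phi> (2 * real k) \<and>
     L2_norm \<Omega> ((laplacian \<Omega> ^^ k) w) \<le> c"


section \<open>Fractional calculus and the subdiffusion problem\<close>

definition rl_kernel :: "real \<Rightarrow> real \<Rightarrow> real" where
  "rl_kernel \<nu> t = t powr (\<nu> - 1) / Gamma \<nu>"

definition rl_integral ::
  "(real^'d) set \<Rightarrow> real \<Rightarrow> (real \<Rightarrow> real^'d \<Rightarrow> real) \<Rightarrow> real \<Rightarrow> real^'d \<Rightarrow> real" where
  "rl_integral \<Omega> \<nu> g t =
     (SOME u. has_L2_integral \<Omega> (\<lambda>s x. rl_kernel \<nu> (t - s) * g s x) 0 t u)"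

text \<open>The time derivative \<open>g'\<close> inside the convolution is that of an absolutely continuous
  function, so pointwise differentiability of \<open>g\<close> is not presupposed.\<close>

definition has_caputo_derivative ::
  "(real^'d) set \<Rightarrow> real \<Rightarrow> (real \<Rightarrow> real^'d \<Rightarrow> real) \<Rightarrow> (real^'d \<Rightarrow> real) \<Rightarrow> real \<Rightarrow> bool" where
  "has_caputo_derivative \<Omega> \<alpha> g D t \<longleftrightarrow> (\<exists>g'.
     (\<forall>s\<in>{0..t}. has_L2_integral \<Omega> g' 0 s (\<lambda>x. g s x - g 0 x)) \<and>
     has_L2_integral \<Omega> (\<lambda>s x. rl_kernel (1 - \<alpha>) (t - s) * g' s x) 0 t D)"

definition subdiffusion_solution ::
  "(real^'d) set \<Rightarrow> real \<Rightarrow> real \<Rightarrow> (real \<Rightarrow> real^'d \<Rightarrow> real) \<Rightarrow> (real \<Rightarrow> real^'d \<Rightarrow> real) \<Rightarrow> bool" where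
  "subdiffusion_solution \<Omega> \<alpha> T F v \<longleftrightarrow>
     (\<forall>t\<in>{0<..T}. \<exists>D g. has_caputo_derivative \<Omega> \<alpha> v D t \<and> has_laplacian \<Omega> (v t) g \<and>
        (AE x in lebesgue_on \<Omega>. D x - g x = F t x)) \<and>
     (\<forall>t\<in>{0..T}. v t \<in> H10 \<Omega>) \<and>
     (AE x in lebesgue_on \<Omega>. v 0 x = 0)"

definition mittag_leffler :: "real \<Rightarrow> real \<Rightarrow> real \<Rightarrow> real" where
  "mittag_leffler p q z = (\<Sum>k. z ^ k / Gamma (p * real k + q))"

text \<open>The operator \<open>E(t)\<close>; the series converges in L2.\<close>

definition solution_operator ::
  "(real^'d) set \<Rightarrow> (nat \<Rightarrow> real) \<Rightarrow> (nat \<Rightarrow> real^'d \<Rightarrow> real) \<Rightarrow> real \<Rightarrow> real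
    \<Rightarrow> (real^'d \<Rightarrow> real) \<Rightarrow> real^'d \<Rightarrow> real" where
  "solution_operator \<Omega> lam \<phi> \<alpha> t q = (SOME u. u \<in> L2 \<Omega> \<and>
     (\<lambda>n. L2_norm \<Omega> (\<lambda>x. (\<Sum>j<n. t powr (\<alpha> - 1) * mittag_leffler \<alpha> \<alpha> (- lam j * t powr \<alpha>)
          * L2_inner \<Omega> q (\<phi> j) * \<phi> j x) - u x)) \<longlonglongrightarrow> 0)"

definition duhamel_formula ::
  "(real^'d) set \<Rightarrow> (nat \<Rightarrow> real) \<Rightarrow> (nat \<Rightarrow> real^'d \<Rightarrow> real) \<Rightarrow> real \<Rightarrow> real
    \<Rightarrow> (real \<Rightarrow> real^'d \<Rightarrow> real) \<Rightarrow> (real \<Rightarrow> real^'d \<Rightarrow> real) \<Rightarrow> bool" where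
  "duhamel_formula \<Omega> lam \<phi> \<alpha> T F v \<longleftrightarrow>
     (\<forall>t\<in>{0..T}. has_L2_integral \<Omega>
        (\<lambda>s. solution_operator \<Omega> lam \<phi> \<alpha> (t - s) (F s)) 0 t (v t))"

end

theory Submission
  imports Defs
begin

text \<open>
  In Fourier coefficients, Duhamel's formula says that \<open>v j\<close> is the convolution of
  \<open>(- lam j)^m * c j\<close> with the kernel \<open>K j t = t powr (\<nu> - 1) * E\<^sub>\<alpha>\<^sub>,\<^sub>\<nu> (- lam j * t powr \<alpha>)\<close>, where
  \<open>\<nu> = (m + 1) * \<alpha>\<close> and \<open>c j\<close> are the coefficients of \<open>f + \<Delta> u0\<close>. Everything rests on bounds
  for \<open>K j\<close> that are uniform in \<open>j\<close>. The kernel with \<open>\<nu> = \<alpha>\<close> is the resolvent \<open>e\<close> of \<open>\<mu> * \<beta>\<^sub>\<alpha>\<close>,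
  and it is positive because \<open>\<beta>\<^sub>\<alpha>\<close> is log-convex; the Volterra equation then gives \<open>0 \<le> K \<le> \<beta>\<^sub>\<nu>\<close>,
  and \<open>t * K' = (\<nu> - 1) * K - \<alpha> * \<mu> * (e * K)\<close> (a convolution in the last term) bounds \<open>t * K'\<close> by a multiple of
  \<open>\<beta>\<^sub>\<nu>\<close>. Differentiating \<open>K * c = c 0 * (1 * K) + 1 * (K * c')\<close> moves the derivatives onto the data,
  and Minkowski's inequality sums over \<open>j\<close>. The weight \<open>lam j\<close> in the resulting bounds makes the L2 tails
  uniformly small, so that coefficientwise derivatives are strong derivatives.
\<close>

text \<open>Two obstacles shape the argument. The series for \<open>K j\<close> only gives bounds
  that depend on \<open>lam j\<close>; sign information is what yields one constant for all
  eigenvalues, so positivity precedes every uniform estimate. Moreover, the weighted data are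
  controlled on (0,T] only: neither \<open>f 0\<close> nor \<open>f1 0\<close> is assumed to lie in
  the weighted space, and derivatives may blow up like \<open>t powr (- \<sigma>)\<close>. Since
  this is integrable, each coefficient has a limit at 0. It is computed backwards, as the value at
  \<open>T\<close> minus the integral of the derivative, and in this form it inherits the weighted
  bound. The derivative of \<open>K j\<close> is of order \<open>t powr (\<nu> - 2)\<close>, which
  need not be integrable, so it never enters a convolution: in the second time derivative it only
  multiplies an initial value, while the convolution of \<open>K j\<close> with the differentiated
  data is differentiated once more on the side of the data. The weight \<open>lam j\<close> that the
  tails use up is the one that the \<open>Hdot\<close> norm of order 2 asks for anyway.\<close>

lemma rl_kernel_nonneg [simp]: "0 < a \<Longrightarrow> 0 \<le> rl_kernel a t"
  by (simp add: rl_kernel_def Gamma_real_pos less_imp_le)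

lemma rl_kernel_pos: "0 < a \<Longrightarrow> 0 < t \<Longrightarrow> 0 < rl_kernel a t"
  by (simp add: rl_kernel_def Gamma_real_pos)

lemma rl_kernel_measurable [measurable]: "rl_kernel a \<in> borel_measurable borel"
  unfolding rl_kernel_def by measurable

lemma rl_kernel_1 [simp]: "0 < t \<Longrightarrow> rl_kernel 1 t = 1"
  by (simp add: rl_kernel_def)

lemma powr_conv_rl_kernel: "0 < a \<Longrightarrow> t powr (a - 1) = Gamma a * rl_kernel a t"
  using Gamma_real_pos[of a] by (simp add: rl_kernel_def less_imp_neq[symmetric])

text \<open>The substitution \<open>s = t * x\<close> turns the convolution into a Beta integral.
  This is the semigroup property of fractional integration; in the form of a nonnegative integral it
  serves as an integrability criterion as well.\<close>

lemma nn_integral_rl_kernel_conv: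
  assumes a: "0 < a" and b: "0 < b" and t: "0 < t"
  shows "(\<integral>\<^sup>+s. ennreal (indicator {0<..<t} s * (rl_kernel a (t - s) * rl_kernel b s)) \<partial>lborel)
    = ennreal (rl_kernel (a + b) t)"
proof -
  have "((\<lambda>x. x powr (b - 1) * (1 - x) powr (a - 1)) has_integral Beta b a) {0<..<1}"
    using has_integral_Beta_real[OF b a] by (simp add: has_integral_Icc_iff_Ioo)
  then have "(\<integral>\<^sup>+x. ennreal (indicator {0<..<1} x * (x powr (b - 1) * (1 - x) powr (a - 1))) \<partial>lborel)
      = ennreal (Beta b a)"
    using nn_integral_has_integral_lebesgue[of "{0<..<1}" "\<lambda>x. x powr (b - 1) * (1 - x) powr (a - 1)" "Beta b a"]
    by simp
  note B = this
  have G: "Gamma a > 0" "Gamma b > 0" "Gamma (a + b) > 0"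
    using a b by (auto intro: Gamma_real_pos)
  have "(\<integral>\<^sup>+s. ennreal (indicator {0<..<t} s * (rl_kernel a (t - s) * rl_kernel b s)) \<partial>lborel)
      = \<bar>t\<bar> * (\<integral>\<^sup>+x. ennreal (indicator {0<..<t} (0 + t * x) * (rl_kernel a (t - (0 + t * x)) * rl_kernel b (0 + t * x))) \<partial>lborel)"
    by (rule nn_integral_real_affine) (use t in auto)
  also have "\<dots> = \<bar>t\<bar> * (\<integral>\<^sup>+x. ennreal (t powr (a + b - 2) / (Gamma a * Gamma b)) *
        ennreal (indicator {0<..<1} x * (x powr (b - 1) * (1 - x) powr (a - 1))) \<partial>lborel)"
  proof (intro arg_cong2[where f="(*)"] refl nn_integral_cong)
    fix x :: real
    have i: "indicator {0<..<t} (0 + t * x) = (indicator {0<..<1} x :: real)"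
      using t by (auto simp: indicator_def zero_less_mult_iff)
    show "ennreal (indicator {0<..<t} (0 + t * x) * (rl_kernel a (t - (0 + t * x)) * rl_kernel b (0 + t * x)))
       = ennreal (t powr (a + b - 2) / (Gamma a * Gamma b)) *
        ennreal (indicator {0<..<1} x * (x powr (b - 1) * (1 - x) powr (a - 1)))"
    proof (cases "x \<in> {0<..<1}")
      case True
      have "t - (0 + t * x) = t * (1 - x)" by (simp add: algebra_simps)
      then have "rl_kernel a (t - (0 + t * x)) * rl_kernel b (0 + t * x)
        = (t powr (a - 1) * t powr (b - 1)) / (Gamma a * Gamma b) * (x powr (b - 1) * (1 - x) powr (a - 1))"
        using True t by (simp only: rl_kernel_def powr_mult) (simp add: powr_mult ac_simps)
      also have "t powr (a - 1) * t powr (b - 1) = t powr (a + b - 2)"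
        by (simp add: powr_add[symmetric] algebra_simps)
      finally show ?thesis
        unfolding i using G by (simp add: ennreal_mult'[symmetric] del: ennreal_mult' )
    qed (use i in simp)
  qed
  also have "\<dots> = \<bar>t\<bar> * (ennreal (t powr (a + b - 2) / (Gamma a * Gamma b)) * ennreal (Beta b a))"
    by (subst nn_integral_cmult) (auto simp: B)
  also have "\<dots> = ennreal (t * (t powr (a + b - 2) / (Gamma a * Gamma b) * Beta b a))"
    using t G a b by (simp add: ennreal_mult[symmetric] Beta_def)
  also have "t * (t powr (a + b - 2) / (Gamma a * Gamma b) * Beta b a) = rl_kernel (a + b) t"
  proof -
    have "t * t powr (a + b - 2) = t powr (a + b - 1)"
      using t powr_mult_base[of t "a + b - 2"] by (simp add: algebra_simps)
    then show ?thesis using G by (simp add: rl_kernel_def Beta_def field_simps add.commute)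
  qed
  finally show ?thesis .
qed

section \<open>Convolution on the half line\<close>

text \<open>The interval is open, so values of the factors at 0 or outside (0,t) do not matter, and
  the convolution vanishes for \<open>t \<le> 0\<close>. Factors can therefore be cut off or
  redefined at 0 without changing it.\<close>

definition conv :: "(real \<Rightarrow> real) \<Rightarrow> (real \<Rightarrow> real) \<Rightarrow> real \<Rightarrow> real" where
  "conv f g t = (LINT s:{0<..<t}|lborel. f (t - s) * g s)"

text \<open>Restriction to positive times (not the positive part of the values). It makes
  \<open>conv\<close> an integral over the whole line, where affine substitutions and Fubini apply
  directly.\<close>

abbreviation pos_part_fun :: "(real \<Rightarrow> real) \<Rightarrow> real \<Rightarrow> real" where
  "pos_part_fun f t \<equiv> indicator {0<..} t * f t"

text \<open>Domination by a fractional kernel on (0,T]. The class is closed under convolution, with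
  constants multiplying and exponents adding, so integrability and size of iterated convolutions are
  tracked by \<open>C\<close> and \<open>a\<close> alone.\<close>

definition kernel_le :: "real \<Rightarrow> real \<Rightarrow> real \<Rightarrow> (real \<Rightarrow> real) \<Rightarrow> bool" where
  "kernel_le T C a f \<longleftrightarrow> 0 < a \<and> 0 \<le> C \<and> f \<in> borel_measurable borel \<and>
     (\<forall>t\<in>{0<..T}. \<bar>f t\<bar> \<le> C * rl_kernel a t)"

lemma kernel_leD:
  assumes "kernel_le T C a f"
  shows "0 < a" "0 \<le> C" "f \<in> borel_measurable borel" "0 < t \<Longrightarrow> t \<le> T \<Longrightarrow> \<bar>f t\<bar> \<le> C * rl_kernel a t"
  using assms by (auto simp: kernel_le_def)

lemma kernel_le_rl_kernel: "0 < a \<Longrightarrow> kernel_le T 1 a (rl_kernel a)"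
  by (auto simp: kernel_le_def)

lemma conv_eq:
  "conv f g t = (LINT s|lborel. pos_part_fun f (t - s) * pos_part_fun g s)"
  unfolding conv_def set_lebesgue_integral_def
  by (intro Bochner_Integration.integral_cong) (auto simp: indicator_def)

lemma conv_cong:
  assumes "\<And>s. 0 < s \<Longrightarrow> s < t \<Longrightarrow> f s = f' s" "\<And>s. 0 < s \<Longrightarrow> s < t \<Longrightarrow> g s = g' s"
  shows "conv f g t = conv f' g' t"
  unfolding conv_def by (intro set_lebesgue_integral_cong) (auto simp: assms)

lemma conv_commute: "conv f g t = conv g f t"
proof -
  have "conv f g t = (LINT s|lborel. pos_part_fun f (t - s) * pos_part_fun g s)" by (rule conv_eq)
  also have "\<dots> = \<bar>-1\<bar> *\<^sub>R (LINT s|lborel. pos_part_fun f (t - (t + (-1) * s)) * pos_part_fun g (t + (-1) * s))"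
    by (rule lborel_integral_real_affine) simp
  also have "\<dots> = conv g f t" unfolding conv_eq by (simp add: mult.commute)
  finally show ?thesis .
qed

lemma borel_measurable_conv [measurable]:
  assumes [measurable]: "f \<in> borel_measurable borel" "g \<in> borel_measurable borel"
  shows "conv f g \<in> borel_measurable borel"
  unfolding conv_eq[abs_def] by measurable

text \<open>Each factor is dominated by a fractional kernel, and the convolution of two of these is
  known. The bound on the integral of the absolute value is what Fubini asks for in the proof of
  associativity.\<close>

lemma conv_integrable:
  assumes f: "kernel_le T C a f" and g: "kernel_le T D b g" and t: "t \<le> T"
  shows "set_integrable lborel {0<..<t} (\<lambda>s. f (t - s) * g s)"
    and "(LINT s:{0<..<t}|lborel. \<bar>f (t - s) * g s\<bar>) \<le> C * D * rl_kernel (a + b) t"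
proof -
  note F = kernel_leD[OF f] and G = kernel_leD[OF g]
  have [measurable]: "f \<in> borel_measurable borel" "g \<in> borel_measurable borel"
    using F G by auto
  have le: "ennreal (norm (indicator {0<..<t} s *\<^sub>R (f (t - s) * g s)))
      \<le> ennreal (C * D) * ennreal (indicator {0<..<t} s * (rl_kernel a (t - s) * rl_kernel b s))" for s
  proof (cases "s \<in> {0<..<t}")
    case True
    then have "\<bar>f (t - s)\<bar> * \<bar>g s\<bar> \<le> (C * rl_kernel a (t - s)) * (D * rl_kernel b s)"
      using F G t by (intro mult_mono) auto
    then show ?thesis using True F G
      by (simp add: ennreal_mult[symmetric] abs_mult ac_simps)
  qed simp
  have main: "(\<integral>\<^sup>+s. ennreal (norm (indicator {0<..<t} s *\<^sub>R (f (t - s) * g s))) \<partial>lborel)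
      \<le> ennreal (C * D * rl_kernel (a + b) t)"
  proof (cases "t > 0")
    case True
    have "(\<integral>\<^sup>+s. ennreal (norm (indicator {0<..<t} s *\<^sub>R (f (t - s) * g s))) \<partial>lborel)
      \<le> (\<integral>\<^sup>+s. ennreal (C * D) * ennreal (indicator {0<..<t} s * (rl_kernel a (t - s) * rl_kernel b s)) \<partial>lborel)"
      by (intro nn_integral_mono le)
    also have "\<dots> = ennreal (C * D) * ennreal (rl_kernel (a + b) t)"
      by (subst nn_integral_cmult) (auto simp: nn_integral_rl_kernel_conv F G True)
    also have "\<dots> = ennreal (C * D * rl_kernel (a + b) t)"
      using F G by (simp add: ennreal_mult[symmetric])
    finally show ?thesis .
  qed simp
  show int: "set_integrable lborel {0<..<t} (\<lambda>s. f (t - s) * g s)"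
    unfolding set_integrable_def
  proof (rule integrableI_bounded)
    show "(\<lambda>s. indicator {0<..<t} s *\<^sub>R (f (t - s) * g s)) \<in> borel_measurable lborel" by measurable
    show "(\<integral>\<^sup>+s. ennreal (norm (indicator {0<..<t} s *\<^sub>R (f (t - s) * g s))) \<partial>lborel) < \<infinity>"
      using main by (rule le_less_trans) simp
  qed
  have "ennreal (LINT s:{0<..<t}|lborel. \<bar>f (t - s) * g s\<bar>)
      = (\<integral>\<^sup>+s. ennreal (norm (indicator {0<..<t} s *\<^sub>R (f (t - s) * g s))) \<partial>lborel)"
    unfolding set_lebesgue_integral_def
    by (subst nn_integral_eq_integral) (use integrable_norm[OF int[unfolded set_integrable_def]] in \<open>auto simp: abs_mult\<close>)
  with main have "ennreal (LINT s:{0<..<t}|lborel. \<bar>f (t - s) * g s\<bar>) \<le> ennreal (C * D * rl_kernel (a + b) t)"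
    by simp
  then show "(LINT s:{0<..<t}|lborel. \<bar>f (t - s) * g s\<bar>) \<le> C * D * rl_kernel (a + b) t"
    using F G by (simp add: ennreal_le_iff)
qed

lemma abs_conv_le:
  assumes f: "kernel_le T C a f" and g: "kernel_le T D b g" and t: "t \<le> T"
  shows "\<bar>conv f g t\<bar> \<le> C * D * rl_kernel (a + b) t"
  using conv_integrable[OF assms] set_integral_norm_bound[OF conv_integrable(1)[OF assms]]
  unfolding conv_def by simp

lemma kernel_le_conv:
  assumes f: "kernel_le T C a f" and g: "kernel_le T D b g"
  shows "kernel_le T (C * D) (a + b) (conv f g)"
  using kernel_leD[OF f] kernel_leD[OF g] abs_conv_le[OF f g] by (auto simp: kernel_le_def)

lemma conv_rl_kernel:
  assumes "0 < a" "0 < b" "0 < t"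
  shows "conv (rl_kernel a) (rl_kernel b) t = rl_kernel (a + b) t"
proof -
  have "ennreal (rl_kernel (a + b) t) = ennreal (conv (rl_kernel a) (rl_kernel b) t)"
    unfolding conv_def set_lebesgue_integral_def nn_integral_rl_kernel_conv[OF assms, symmetric]
    using conv_integrable(1)[OF kernel_le_rl_kernel kernel_le_rl_kernel, of a b t t] assms
    by (subst nn_integral_eq_integral) (auto simp: set_integrable_def)
  moreover have "conv (rl_kernel a) (rl_kernel b) t \<ge> 0"
    unfolding conv_def set_lebesgue_integral_def
    by (intro Bochner_Integration.integral_nonneg) (use assms in auto)
  ultimately show ?thesis using assms by simp
qed

lemma conv_mono:
  assumes f: "kernel_le T C a f" and f': "kernel_le T C' a' f'"
    and g: "kernel_le T D b g" and t: "t \<le> T"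
    and le: "\<And>s. 0 < s \<Longrightarrow> s < t \<Longrightarrow> f s \<le> f' s" and nn: "\<And>s. 0 < s \<Longrightarrow> s < t \<Longrightarrow> 0 \<le> g s"
  shows "conv f g t \<le> conv f' g t"
  unfolding conv_def
  by (intro set_integral_mono conv_integrable(1)[OF f g t] conv_integrable(1)[OF f' g t] mult_right_mono)
     (use le nn in auto)

lemma conv_nonneg:
  assumes "\<And>s. 0 < s \<Longrightarrow> s < t \<Longrightarrow> 0 \<le> f s" "\<And>s. 0 < s \<Longrightarrow> s < t \<Longrightarrow> 0 \<le> g s"
  shows "0 \<le> conv f g t"
  unfolding conv_def set_lebesgue_integral_def
  by (intro Bochner_Integration.integral_nonneg) (use assms in \<open>auto simp: indicator_def\<close>)

lemma conv_add_right:
  assumes "kernel_le T C a f" "kernel_le T D b g" "kernel_le T D' b' h" "t \<le> T"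
  shows "conv f (\<lambda>s. g s + h s) t = conv f g t + conv f h t"
  unfolding conv_def distrib_left
  by (rule set_integral_add(2)) (use conv_integrable(1) assms in blast)+

lemma conv_cmult_right: "conv f (\<lambda>s. c * g s) t = c * conv f g t"
  unfolding conv_def by (simp add: mult.left_commute[of _ c])

text \<open>Fubini for the triangle 0 < r < s < t, which the cut-offs to positive times extend to
  the whole plane. The inner integral of the absolute value is at most a multiple of
  \<open>rl_kernel (b + c)\<close>, so the semigroup property bounds the double integral.\<close>

lemma conv_assoc:
  assumes f: "kernel_le T C1 a f" and g: "kernel_le T C2 b g" and h: "kernel_le T C3 c h" and t: "t \<le> T"
  shows "conv f (conv g h) t = conv (conv f g) h t"
proof -
  let ?k = "\<lambda>s. indicator {0<..<t} s * (rl_kernel a (t - s) * rl_kernel (b + c) s)"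
  note F = kernel_leD[OF f] and G = kernel_leD[OF g] and H = kernel_leD[OF h]
  have [measurable]: "f \<in> borel_measurable borel" "g \<in> borel_measurable borel" "h \<in> borel_measurable borel"
    using F G H by auto
  define J where "J = (\<lambda>s r. pos_part_fun f (t - s) * (pos_part_fun g (s - r) * pos_part_fun h r))"
  have J_meas [measurable]: "case_prod J \<in> borel_measurable (lborel \<Otimes>\<^sub>M lborel)"
    unfolding J_def by measurable
  have abs_le: "(\<integral>\<^sup>+r. ennreal (norm (J s r)) \<partial>lborel)
     \<le> ennreal (C1 * C2 * C3) * ennreal (?k s)" for s
  proof (cases "s \<in> {0<..<t}")
    case True
    have "(\<integral>\<^sup>+r. ennreal (norm (J s r)) \<partial>lborel)
       = (\<integral>\<^sup>+r. ennreal \<bar>f (t - s)\<bar> * ennreal (indicator {0<..<s} r *\<^sub>R \<bar>g (s - r) * h r\<bar>) \<partial>lborel)"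
      by (intro nn_integral_cong)
         (use True in \<open>auto simp: J_def ennreal_mult[symmetric] abs_mult indicator_def\<close>)
    also have "\<dots> = ennreal \<bar>f (t - s)\<bar> * (\<integral>\<^sup>+r. ennreal (indicator {0<..<s} r *\<^sub>R \<bar>g (s - r) * h r\<bar>) \<partial>lborel)"
      by (subst nn_integral_cmult) auto
    also have "(\<integral>\<^sup>+r. ennreal (indicator {0<..<s} r *\<^sub>R \<bar>g (s - r) * h r\<bar>) \<partial>lborel)
        = ennreal (LINT r:{0<..<s}|lborel. \<bar>g (s - r) * h r\<bar>)"
      unfolding set_lebesgue_integral_def
      by (subst nn_integral_eq_integral)
         (use conv_integrable(1)[OF g h, of s, THEN set_integrable_abs] True t in \<open>auto simp: set_integrable_def\<close>)
    also have "ennreal \<bar>f (t - s)\<bar> * ennreal (LINT r:{0<..<s}|lborel. \<bar>g (s - r) * h r\<bar>)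
      \<le> ennreal (C1 * rl_kernel a (t - s)) * ennreal (C2 * C3 * rl_kernel (b + c) s)"
      using conv_integrable(2)[OF g h, of s] F True t by (intro mult_mono ennreal_leI) auto
    also have "\<dots> = ennreal (C1 * C2 * C3) * ennreal (?k s)"
      using True F G H by (simp add: ennreal_mult[symmetric] ac_simps)
    finally show ?thesis .
  next
    case False
    have "J s r = 0" for r using False by (auto simp: J_def indicator_def)
    then show ?thesis by simp
  qed
  have J_int: "integrable (lborel \<Otimes>\<^sub>M lborel) (case_prod J)"
  proof (rule integrableI_bounded)
    have "(\<integral>\<^sup>+p. ennreal (norm (case_prod J p)) \<partial>(lborel \<Otimes>\<^sub>M lborel))
      = (\<integral>\<^sup>+s. (\<integral>\<^sup>+r. ennreal (norm (J s r)) \<partial>lborel) \<partial>lborel)"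
      by (subst lborel.nn_integral_fst[symmetric]) auto
    also have "\<dots> \<le> (\<integral>\<^sup>+s. ennreal (C1 * C2 * C3) * ennreal (?k s) \<partial>lborel)"
      by (intro nn_integral_mono abs_le)
    also have "\<dots> = ennreal (C1 * C2 * C3) * (\<integral>\<^sup>+s. ennreal (?k s) \<partial>lborel)"
      by (subst nn_integral_cmult) auto
    also have "\<dots> < \<infinity>"
    proof (cases "t > 0")
      case True
      then show ?thesis using nn_integral_rl_kernel_conv[of a "b + c" t] F G H
        by (auto simp: ennreal_mult_less_top)
    qed simp
    finally show "(\<integral>\<^sup>+p. ennreal (norm (case_prod J p)) \<partial>(lborel \<Otimes>\<^sub>M lborel)) < \<infinity>" .
  qed measurable
  have "conv f (conv g h) t = (LINT s|lborel. LINT r|lborel. J s r)"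
  proof -
    have "pos_part_fun (conv g h) s = (LINT r|lborel. pos_part_fun g (s - r) * pos_part_fun h r)" for s
      unfolding conv_eq[symmetric] by (cases "s > 0") (auto simp: conv_def set_lebesgue_integral_def)
    then show ?thesis unfolding conv_eq[of f] J_def by simp
  qed
  also have "\<dots> = (LINT r|lborel. LINT s|lborel. J s r)"
    by (rule lborel_pair.Fubini_integral[symmetric, OF J_int])
  also have "\<dots> = (LINT r|lborel. pos_part_fun (conv f g) (t - r) * pos_part_fun h r)"
  proof (intro Bochner_Integration.integral_cong refl)
    fix r :: real
    have "(LINT s|lborel. J s r) = \<bar>1\<bar> *\<^sub>R (LINT s|lborel. J (r + 1 * s) r)"
      by (rule lborel_integral_real_affine) simp
    also have "\<dots> = (LINT s|lborel. (pos_part_fun f (t - r - s) * pos_part_fun g s) * pos_part_fun h r)"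
      by (simp add: J_def algebra_simps)
    also have "\<dots> = conv f g (t - r) * pos_part_fun h r"
      unfolding conv_eq by (rule integral_mult_left_zero)
    also have "conv f g (t - r) = pos_part_fun (conv f g) (t - r)"
      by (cases "t - r > 0") (auto simp: conv_def set_lebesgue_integral_def)
    finally show "(LINT s|lborel. J s r) = pos_part_fun (conv f g) (t - r) * pos_part_fun h r" .
  qed
  also have "\<dots> = conv (conv f g) h t" by (rule conv_eq[symmetric])
  finally show ?thesis .
qed

section \<open>Mittag-Leffler kernels\<close>

text \<open>Only the part of the Gamma integral over [M, M + 1] is kept. As \<open>M\<close> is
  free, Gamma is seen to outgrow every geometric sequence, which is all that convergence of the
  Mittag-Leffler series needs.\<close>

lemma Gamma_real_ge:
  assumes M: "0 < M" and x: "1 \<le> x"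
  shows "M powr (x - 1) * exp (- (M + 1)) \<le> Gamma (x::real)"
proof -
  have "ennreal (M powr (x - 1) * exp (- (M + 1)))
     = (\<integral>\<^sup>+t. ennreal (M powr (x - 1) * exp (- (M + 1))) * indicator {M..M+1} t \<partial>lborel)"
    by (subst nn_integral_cmult_indicator) auto
  also have "\<dots> \<le> (\<integral>\<^sup>+t. ennreal (indicator {0..} t * t powr (x - 1) / exp t) \<partial>lborel)"
  proof (intro nn_integral_mono)
    fix t :: real
    show "ennreal (M powr (x - 1) * exp (- (M + 1))) * indicator {M..M+1} t
       \<le> ennreal (indicator {0..} t * t powr (x - 1) / exp t)"
    proof (cases "t \<in> {M..M+1}")
      case True
      then have "M powr (x - 1) * exp (- (M + 1)) \<le> t powr (x - 1) * exp (- t)"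
        using M x by (intro mult_mono powr_mono2) auto
      then show ?thesis using True M by (simp add: exp_minus field_simps)
    qed simp
  qed
  also have "\<dots> = ennreal (Gamma x)"
    using x by (subst Gamma_conv_nn_integral_real) auto
  finally show ?thesis using x by (simp add: Gamma_real_pos less_imp_le)
qed

lemma summable_mittag_leffler:
  fixes z :: real
  assumes p: "0 < p" and q: "0 < q"
  shows "summable (\<lambda>k. norm (z ^ k / Gamma (p * real k + q)))"
proof -
  \<comment> \<open>Chosen so that \<open>M powr (p * real k)\<close> is the \<open>k\<close>-th
    power of \<open>2 * (\<bar>z\<bar> + 1)\<close>: the quotient of consecutive majorants becomes
    1/2. The summand 1 keeps \<open>M\<close> positive when \<open>z = 0\<close>.\<close>
  define M where "M = (2 * (\<bar>z\<bar> + 1)) powr (1 / p)"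
  define C where "C = exp (M + 1) * M powr (1 - q)"
  have M: "M > 0" and Mp: "M powr (p * real k) = (2 * (\<bar>z\<bar> + 1)) ^ k" for k
    using p by (auto simp: M_def powr_powr powr_realpow)
  obtain N where N: "real N * p \<ge> 1"
    using p reals_Archimedean3[of p] by (metis less_imp_le)
  show ?thesis
  proof (rule summable_comparison_test')
    show "summable (\<lambda>k. C * (1/2) ^ k)" by (intro summable_mult summable_geometric) auto
    fix k assume "k \<ge> N"
    then have "real N * p \<le> real k * p" using p by (intro mult_right_mono) auto
    with N q have k: "p * real k + q \<ge> 1" by (simp add: mult.commute)
    have "M powr (p * real k + q - 1) * exp (- (M + 1)) \<le> Gamma (p * real k + q)"
      using Gamma_real_ge[OF M k] .
    moreover have "M powr (p * real k + q - 1) = (2 * (\<bar>z\<bar> + 1)) ^ k * M powr (q - 1)"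
      using powr_add[of M "p * real k" "q - 1"] by (simp add: Mp algebra_simps)
    ultimately have G: "(2 * (\<bar>z\<bar> + 1)) ^ k * M powr (q - 1) * exp (- (M + 1)) \<le> Gamma (p * real k + q)"
      by simp
    have "norm (z ^ k / Gamma (p * real k + q)) = \<bar>z\<bar> ^ k / Gamma (p * real k + q)"
      using k Gamma_real_pos[of "p * real k + q"] by (simp add: power_abs)
    also have "\<dots> \<le> (\<bar>z\<bar> + 1) ^ k / ((2 * (\<bar>z\<bar> + 1)) ^ k * M powr (q - 1) * exp (- (M + 1)))"
      using G M by (intro frac_le power_mono) auto
    also have "\<dots> = (\<bar>z\<bar> + 1) ^ k / (2 * (\<bar>z\<bar> + 1)) ^ k * (exp (M + 1) * (1 / M powr (q - 1)))"
      unfolding exp_minus[of "M + 1"] by (simp add: divide_inverse mult_ac)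
    also have "1 / M powr (q - 1) = M powr (1 - q)"
      using powr_minus_divide[of M "q - 1"] by simp
    also have "(\<bar>z\<bar> + 1) ^ k / (2 * (\<bar>z\<bar> + 1)) ^ k = (1/2) ^ k"
      unfolding power_mult_distrib by (simp add: power_one_over)
    finally show "norm (norm (z ^ k / Gamma (p * real k + q))) \<le> C * (1/2) ^ k"
      by (simp add: C_def mult.commute)
  qed
qed

text \<open>The function with Laplace transform
  \<open>s powr (\<alpha> - \<nu>) / (s powr \<alpha> + \<mu>)\<close>, that is, the Neumann series
  in powers of \<open>- \<mu>\<close> times fractional integration of order \<open>\<alpha>\<close>,
  applied to \<open>rl_kernel \<nu>\<close>. For \<open>\<nu> = \<alpha>\<close> and
  \<open>\<mu> = lam j\<close> it is the factor with which the solution operator acts on the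
  \<open>j\<close>-th coefficient.\<close>

definition ml_kernel :: "real \<Rightarrow> real \<Rightarrow> real \<Rightarrow> real \<Rightarrow> real" where
  "ml_kernel \<alpha> \<mu> \<nu> t = t powr (\<nu> - 1) * mittag_leffler \<alpha> \<nu> (- \<mu> * t powr \<alpha>)"

locale relaxation =
  fixes \<alpha> \<mu> :: real
  assumes \<alpha>_pos: "0 < \<alpha>" and \<mu>_pos: "0 < \<mu>"
begin

lemma rl_kernel_shift:
  assumes "0 < t"
  shows "(-\<mu>) ^ k * rl_kernel (\<nu> + real k * \<alpha>) t
    = t powr (\<nu> - 1) * ((- \<mu> * t powr \<alpha>) ^ k / Gamma (\<alpha> * real k + \<nu>))"
proof -
  have "t powr (\<nu> + real k * \<alpha> - 1) = t powr (\<nu> - 1) * (t powr \<alpha>) ^ k"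
    using assms powr_add[of t "\<nu> - 1" "real k * \<alpha>"]
    by (simp add: powr_power algebra_simps)
  moreover have "\<alpha> * real k + \<nu> = \<nu> + real k * \<alpha>" by simp
  ultimately show ?thesis
    by (simp only: rl_kernel_def power_mult_distrib) simp
qed

lemma ml_kernel_sums:
  assumes "0 < \<nu>" "0 < t"
  shows "(\<lambda>k. (-\<mu>) ^ k * rl_kernel (\<nu> + real k * \<alpha>) t) sums ml_kernel \<alpha> \<mu> \<nu> t"
  unfolding rl_kernel_shift[OF assms(2)] ml_kernel_def mittag_leffler_def
  by (intro sums_mult summable_sums summable_norm_cancel[OF summable_mittag_leffler] \<alpha>_pos assms)

text \<open>The term \<open>k = 0\<close> of the series is split off. Iterated, this gives an exact
  formula for the remainder after \<open>N\<close> terms, again a kernel of the same kind with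
  \<open>\<nu>\<close> raised by \<open>real N * \<alpha>\<close>.\<close>

lemma ml_kernel_step:
  assumes "0 < \<nu>" "0 < t"
  shows "ml_kernel \<alpha> \<mu> \<nu> t = rl_kernel \<nu> t - \<mu> * ml_kernel \<alpha> \<mu> (\<nu> + \<alpha>) t"
proof -
  have "(\<lambda>k. (-\<mu>) ^ Suc k * rl_kernel (\<nu> + real (Suc k) * \<alpha>) t) sums (ml_kernel \<alpha> \<mu> \<nu> t - rl_kernel \<nu> t)"
    using ml_kernel_sums[OF assms] by (subst sums_Suc_iff) auto
  moreover have "(\<lambda>k. (-\<mu>) * ((-\<mu>) ^ k * rl_kernel (\<nu> + \<alpha> + real k * \<alpha>) t)) sums (- \<mu> * ml_kernel \<alpha> \<mu> (\<nu> + \<alpha>) t)"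
    using assms \<alpha>_pos by (intro sums_mult ml_kernel_sums) auto
  moreover have "(-\<mu>) ^ Suc k * rl_kernel (\<nu> + real (Suc k) * \<alpha>) t
      = (-\<mu>) * ((-\<mu>) ^ k * rl_kernel (\<nu> + \<alpha> + real k * \<alpha>) t)" for k
    by (simp add: distrib_right add.assoc)
  ultimately have "ml_kernel \<alpha> \<mu> \<nu> t - rl_kernel \<nu> t = - \<mu> * ml_kernel \<alpha> \<mu> (\<nu> + \<alpha>) t"
    by (metis (no_types, lifting) sums_unique2 sums_cong)
  then show ?thesis by simp
qed

lemma ml_kernel_measurable [measurable]: "ml_kernel \<alpha> \<mu> \<nu> \<in> borel_measurable borel"
  unfolding ml_kernel_def[abs_def] mittag_leffler_def by measurable

text \<open>The remainder is compared with the tail of the absolutely convergent series at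
  \<open>T\<close>, which is uniform in \<open>t\<close> relative to \<open>rl_kernel \<nu>\<close>.
  The numbers \<open>\<epsilon> N\<close> depend on \<open>\<mu>\<close>: this gives convergence,
  not the bound uniform in the eigenvalue.\<close>

lemma ml_kernel_remainder:
  assumes \<nu>: "0 < \<nu>" and T: "0 < T"
  obtains \<epsilon> :: "nat \<Rightarrow> real" where "\<epsilon> \<longlonglongrightarrow> 0" "\<And>N. 0 \<le> \<epsilon> N"
    "\<And>N t. 0 < t \<Longrightarrow> t \<le> T \<Longrightarrow> \<bar>(-\<mu>) ^ N * ml_kernel \<alpha> \<mu> (\<nu> + real N * \<alpha>) t\<bar> \<le> \<epsilon> N * rl_kernel \<nu> t"
proof -
  define A where "A = (\<lambda>k. norm ((\<mu> * T powr \<alpha>) ^ k / Gamma (\<alpha> * real k + \<nu>)))"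
  define \<epsilon> where "\<epsilon> = (\<lambda>N. Gamma \<nu> * (\<Sum>k. A (k + N)))"
  have A: "summable A" unfolding A_def by (intro summable_mittag_leffler \<alpha>_pos \<nu>)
  have AN: "summable (\<lambda>k. A (k + N))" for N using A by (rule summable_ignore_initial_segment)
  have G: "Gamma \<nu> > 0" using \<nu> by (rule Gamma_real_pos)
  show ?thesis
  proof
    have "(\<lambda>N. \<Sum>k. A (k + N)) \<longlonglongrightarrow> 0" by (rule suminf_exist_split2[OF A])
    then show "\<epsilon> \<longlonglongrightarrow> 0" unfolding \<epsilon>_def by (rule tendsto_mult_right_zero)
    have "A k \<ge> 0" for k by (simp add: A_def)
    then show "0 \<le> \<epsilon> N" for N unfolding \<epsilon>_def using G AN by (simp add: suminf_nonneg)
    fix N :: nat and t :: real assume t: "0 < t" "t \<le> T"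
    have pos: "0 < \<nu> + real k * \<alpha>" for k using \<nu> \<alpha>_pos by (simp add: add_pos_nonneg)
    have S: "(\<lambda>k. (-\<mu>) ^ (k + N) * rl_kernel (\<nu> + real (k + N) * \<alpha>) t) sums
       ((-\<mu>) ^ N * ml_kernel \<alpha> \<mu> (\<nu> + real N * \<alpha>) t)"
      using sums_mult[OF ml_kernel_sums[OF pos t(1), of N], of "(-\<mu>) ^ N"]
      by (simp add: power_add algebra_simps)
    have le: "norm ((-\<mu>) ^ k * rl_kernel (\<nu> + real k * \<alpha>) t) \<le> t powr (\<nu> - 1) * A k" for k
    proof -
      have "norm ((- \<mu> * t powr \<alpha>) ^ k / Gamma (\<alpha> * real k + \<nu>)) \<le> A k"
        unfolding A_def norm_divide norm_power
        using \<mu>_pos t \<alpha>_pos by (intro divide_right_mono power_mono) (auto simp: abs_mult powr_mono2)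
      then show ?thesis unfolding rl_kernel_shift[OF t(1)] norm_mult
        by (intro mult_mono) auto
    qed
    have "\<bar>(-\<mu>) ^ N * ml_kernel \<alpha> \<mu> (\<nu> + real N * \<alpha>) t\<bar> \<le> (\<Sum>k. t powr (\<nu> - 1) * A (k + N))"
      using norm_suminf_le[OF le summable_mult[OF AN], of N] sums_unique[OF S] by simp
    also have "\<dots> = \<epsilon> N * rl_kernel \<nu> t"
      using AN \<nu> unfolding \<epsilon>_def by (simp add: suminf_mult powr_conv_rl_kernel)
    finally show "\<bar>(-\<mu>) ^ N * ml_kernel \<alpha> \<mu> (\<nu> + real N * \<alpha>) t\<bar> \<le> \<epsilon> N * rl_kernel \<nu> t" .
  qed
qed

text \<open>The case \<open>N = 0\<close> of the remainder bound. The constant depends on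
  \<open>\<mu>\<close>; it provides integrability in the proof of positivity, before the constant 1
  is available.\<close>

lemma kernel_le_ml_kernel_exists:
  assumes \<nu>: "0 < \<nu>" and T: "0 < T"
  shows "\<exists>C. kernel_le T C \<nu> (ml_kernel \<alpha> \<mu> \<nu>)"
proof -
  obtain \<epsilon> where "\<And>N. 0 \<le> \<epsilon> N"
    "\<And>N t. 0 < t \<Longrightarrow> t \<le> T \<Longrightarrow> \<bar>(-\<mu>) ^ N * ml_kernel \<alpha> \<mu> (\<nu> + real N * \<alpha>) t\<bar> \<le> \<epsilon> N * rl_kernel \<nu> t"
    using ml_kernel_remainder[OF assms] by metis
  from this(1)[of 0] this(2)[of _ 0] show ?thesis using \<nu>
    by (intro exI[of _ "\<epsilon> 0"]) (auto simp: kernel_le_def)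
qed

text \<open>Termwise convolution by means of the exact remainder \<open>R N\<close>: its convolution
  with \<open>f\<close> is at most \<open>\<epsilon> N\<close> times a fixed quantity.\<close>

lemma conv_ml_kernel_sums:
  assumes f: "kernel_le T C a f" and \<nu>: "0 < \<nu>" and t: "0 < t" "t \<le> T"
  shows "(\<lambda>k. (-\<mu>) ^ k * conv f (rl_kernel (\<nu> + real k * \<alpha>)) t) sums conv f (ml_kernel \<alpha> \<mu> \<nu>) t"
proof -
  let ?M = "ml_kernel \<alpha> \<mu>"
  let ?b = "\<lambda>k. rl_kernel (\<nu> + real k * \<alpha>)"
  have T: "0 < T" using t by simp
  obtain \<epsilon> where \<epsilon>: "\<epsilon> \<longlonglongrightarrow> 0" "\<And>N. 0 \<le> \<epsilon> N"
    "\<And>N t. 0 < t \<Longrightarrow> t \<le> T \<Longrightarrow> \<bar>(-\<mu>) ^ N * ?M (\<nu> + real N * \<alpha>) t\<bar> \<le> \<epsilon> N * rl_kernel \<nu> t"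
    using ml_kernel_remainder[OF \<nu> T] by metis
  define R where "R = (\<lambda>N s. (-\<mu>) ^ N * ?M (\<nu> + real N * \<alpha>) s)"
  have pos: "0 < \<nu> + real k * \<alpha>" for k using \<nu> \<alpha>_pos by (simp add: add_pos_nonneg)
  have R: "kernel_le T (\<epsilon> N) \<nu> (R N)" for N
    using \<epsilon> \<nu> by (auto simp: kernel_le_def R_def)
  have part: "conv f (?M \<nu>) t = (\<Sum>k<N. (-\<mu>) ^ k * conv f (?b k) t)
      + conv f (R N) t" for N
  proof (induction N)
    case 0 show ?case by (simp add: R_def)
  next
    case (Suc N)
    have k1: "kernel_le T (\<mu> ^ N) (\<nu> + real N * \<alpha>) (\<lambda>s. (-\<mu>) ^ N * ?b N s)"
      using pos[of N] \<mu>_pos by (auto simp: kernel_le_def abs_mult power_abs)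
    have "conv f (R N) t = conv f (\<lambda>s. (-\<mu>) ^ N * ?b N s + R (Suc N) s) t"
    proof (intro conv_cong refl)
      fix s :: real assume "0 < s" "s < t"
      then have "?M (\<nu> + real N * \<alpha>) s
        = ?b N s - \<mu> * ?M (\<nu> + real (Suc N) * \<alpha>) s"
        using ml_kernel_step[OF pos[of N], of s] by (simp add: distrib_right add_ac)
      then show "R N s = (-\<mu>) ^ N * ?b N s + R (Suc N) s"
        by (simp add: R_def right_diff_distrib)
    qed
    also have "\<dots> = (-\<mu>) ^ N * conv f (?b N) t + conv f (R (Suc N)) t"
      using t by (subst conv_add_right[OF f k1 R]) (auto simp: conv_cmult_right)
    finally show ?case using Suc by simp
  qed
  have "(\<lambda>N. conv f (R N) t) \<longlonglongrightarrow> 0"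
  proof (rule Lim_null_comparison)
    show "\<forall>\<^sub>F N in sequentially. norm (conv f (R N) t) \<le> \<epsilon> N * (C * rl_kernel (a + \<nu>) t)"
      using abs_conv_le[OF f R] t by (intro always_eventually) (auto simp: ac_simps)
    show "(\<lambda>N. \<epsilon> N * (C * rl_kernel (a + \<nu>) t)) \<longlonglongrightarrow> 0"
      using \<epsilon>(1) by (rule tendsto_mult_left_zero)
  qed
  then have "(\<lambda>N. conv f (?M \<nu>) t - conv f (R N) t) \<longlonglongrightarrow> conv f (?M \<nu>) t - 0"
    by (intro tendsto_intros)
  moreover have "conv f (?M \<nu>) t - conv f (R N) t
     = (\<Sum>k<N. (-\<mu>) ^ k * conv f (?b k) t)" for N
    using part[of N] by linarith
  ultimately show ?thesis unfolding sums_def by simp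
qed

lemma conv_rl_ml_kernel:
  assumes a: "0 < a" and \<nu>: "0 < \<nu>" and t: "0 < t"
  shows "conv (rl_kernel a) (ml_kernel \<alpha> \<mu> \<nu>) t = ml_kernel \<alpha> \<mu> (a + \<nu>) t"
proof -
  have pos: "0 < \<nu> + real k * \<alpha>" for k using \<nu> \<alpha>_pos by (simp add: add_pos_nonneg)
  have "(\<lambda>k. (-\<mu>) ^ k * conv (rl_kernel a) (rl_kernel (\<nu> + real k * \<alpha>)) t) sums
      conv (rl_kernel a) (ml_kernel \<alpha> \<mu> \<nu>) t"
    using conv_ml_kernel_sums[OF kernel_le_rl_kernel[OF a] \<nu> t order_refl] .
  also have "(\<lambda>k. (-\<mu>) ^ k * conv (rl_kernel a) (rl_kernel (\<nu> + real k * \<alpha>)) t)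
    = (\<lambda>k. (-\<mu>) ^ k * rl_kernel (a + \<nu> + real k * \<alpha>) t)"
    using conv_rl_kernel[OF a pos t] by (simp add: add.assoc)
  finally show ?thesis
    using ml_kernel_sums[of "a + \<nu>" t] a \<nu> t sums_unique2 by fastforce
qed

text \<open>Termwise differentiation of the entire function \<open>E\<close>, composed with
  \<open>- \<mu> * t powr \<alpha>\<close>. The derivative of \<open>E\<close> contributes the
  series \<open>X\<close>, whose factor \<open>Suc n\<close> rules out a direct comparison with a
  kernel; \<open>X\<close> is kept abstract until it is recognised as a convolution.\<close>

lemma ml_kernel_has_derivative:
  assumes \<nu>: "0 < \<nu>" and t: "0 < t"
  obtains X where "(\<lambda>n. real (Suc n) * ((-\<mu>) ^ n * rl_kernel (\<nu> + real (Suc n) * \<alpha>) t)) sums X"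
    and "(ml_kernel \<alpha> \<mu> \<nu> has_real_derivative ((\<nu> - 1) * ml_kernel \<alpha> \<mu> \<nu> t - \<alpha> * \<mu> * X) / t) (at t)"
proof -
  define c where "c = (\<lambda>k. 1 / Gamma (\<alpha> * real k + \<nu>))"
  define E where "E = (\<lambda>x. \<Sum>k. c k * x ^ k)"
  define z where "z = - \<mu> * t powr \<alpha>"
  have z0: "z \<noteq> 0" using \<mu>_pos t by (simp add: z_def)
  have sm: "summable (\<lambda>k. c k * x ^ k)" for x
    using summable_norm_cancel[OF summable_mittag_leffler[OF \<alpha>_pos \<nu>], of x] by (simp add: c_def)
  have E: "(E has_field_derivative (\<Sum>n. diffs c n * x ^ n)) (at x)" for x
    unfolding E_def by (rule termdiffs_strong_converges_everywhere[OF sm])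
  have dsm: "summable (\<lambda>n. diffs c n * z ^ n)"
    by (rule termdiff_converges_all[OF sm])
  define D where "D = (\<Sum>n. diffs c n * z ^ n)"
  have mlE: "ml_kernel \<alpha> \<mu> \<nu> = (\<lambda>t. t powr (\<nu> - 1) * E (- \<mu> * t powr \<alpha>))"
    by (simp add: ml_kernel_def[abs_def] mittag_leffler_def E_def c_def)
  have "(ml_kernel \<alpha> \<mu> \<nu> has_real_derivative
     (\<nu> - 1) * t powr (\<nu> - 1 - 1) * E z + D * (- \<mu> * (\<alpha> * t powr (\<alpha> - 1))) * t powr (\<nu> - 1)) (at t)"
  proof -
    have "((\<lambda>t. E (- \<mu> * t powr \<alpha>)) has_real_derivative D * (- \<mu> * (\<alpha> * t powr (\<alpha> - 1)))) (at t)"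
      by (rule DERIV_chain2[of E]) (use E[of z] DERIV_cmult[OF has_real_derivative_powr[OF t], of "- \<mu>" \<alpha>] in \<open>simp_all add: z_def D_def\<close>)
    from DERIV_mult[OF has_real_derivative_powr[OF t, of "\<nu> - 1"] this] show ?thesis
      by (simp add: mlE z_def)
  qed
  moreover have "(\<nu> - 1) * t powr (\<nu> - 1 - 1) * E z + D * (- \<mu> * (\<alpha> * t powr (\<alpha> - 1))) * t powr (\<nu> - 1)
     = ((\<nu> - 1) * ml_kernel \<alpha> \<mu> \<nu> t - \<alpha> * \<mu> * (t powr (\<nu> + \<alpha> - 1) * D)) / t"
    (is "?l = ?r")
  proof -
    have 1: "t powr (\<nu> - 1 - 1) = t powr (\<nu> - 1) / t" "t powr (\<alpha> - 1) = t powr \<alpha> / t"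
      using t powr_diff[of t "\<nu> - 1" 1] powr_diff[of t \<alpha> 1] by simp_all
    have 2: "t powr (\<nu> + \<alpha> - 1) = t powr \<alpha> * t powr (\<nu> - 1)"
      by (simp add: powr_add[symmetric] algebra_simps)
    have 3: "ml_kernel \<alpha> \<mu> \<nu> t = t powr (\<nu> - 1) * E z" by (simp add: mlE z_def)
    show ?thesis unfolding 1 2 3 by (simp add: diff_divide_distrib mult_ac)
  qed
  moreover have "(\<lambda>n. real (Suc n) * ((-\<mu>) ^ n * rl_kernel (\<nu> + real (Suc n) * \<alpha>) t)) sums (t powr (\<nu> + \<alpha> - 1) * D)"
  proof -
    have "real (Suc n) * ((-\<mu>) ^ n * rl_kernel (\<nu> + real (Suc n) * \<alpha>) t)
      = t powr (\<nu> + \<alpha> - 1) * (diffs c n * z ^ n)" for n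
    proof -
      have e1: "\<nu> + real (Suc n) * \<alpha> = \<nu> + \<alpha> + real n * \<alpha>" by (simp add: distrib_right)
      have e2: "\<alpha> * real n + (\<nu> + \<alpha>) = \<alpha> * real (Suc n) + \<nu>" by (simp add: distrib_left)
      show ?thesis
        unfolding e1 rl_kernel_shift[OF t] diffs_def c_def z_def e2 by simp
    qed
    then show ?thesis unfolding D_def by (simp only: sums_mult[OF summable_sums[OF dsm]])
  qed
  ultimately show ?thesis using that by simp
qed

lemma ml_kernel_continuous_on: "0 < \<nu> \<Longrightarrow> continuous_on {0<..} (ml_kernel \<alpha> \<mu> \<nu>)"
  by (intro continuous_at_imp_continuous_on ballI) (metis DERIV_isCont greaterThan_iff ml_kernel_has_derivative)

text \<open>The leading term is of order \<open>t powr (\<alpha> - 1)\<close>, the rest of order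
  \<open>t powr (2 * \<alpha> - 1)\<close>, hence smaller by a factor
  \<open>t powr \<alpha>\<close>. This keeps a possible first zero away from 0.\<close>

lemma ml_kernel_pos_near_0: "\<exists>\<delta>>0. \<forall>t\<in>{0<..<\<delta>}. 0 < ml_kernel \<alpha> \<mu> \<alpha> t"
proof -
  have "\<forall>\<^sub>F t in at_right 0. \<bar>\<mu> * ml_kernel \<alpha> \<mu> (\<alpha> + \<alpha>) t\<bar> < rl_kernel \<alpha> t"
  proof -
    obtain C where C: "kernel_le 1 C (\<alpha> + \<alpha>) (ml_kernel \<alpha> \<mu> (\<alpha> + \<alpha>))"
      using kernel_le_ml_kernel_exists[of "\<alpha> + \<alpha>" 1] \<alpha>_pos by auto
    note C = kernel_leD[OF C]
    define B where "B = \<mu> * C / Gamma (\<alpha> + \<alpha>)"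
    have "((\<lambda>t. B * t powr \<alpha>) \<longlongrightarrow> B * 0 powr \<alpha>) (at_right 0)"
      using \<alpha>_pos by (intro tendsto_intros) (auto simp: eventually_at_filter)
    then have "\<forall>\<^sub>F t in at_right 0. B * t powr \<alpha> < 1 / Gamma \<alpha>"
      using \<alpha>_pos Gamma_real_pos[OF \<alpha>_pos] by (intro order_tendstoD(2)) auto
    moreover have "\<forall>\<^sub>F t::real in at_right 0. t < 1" "\<forall>\<^sub>F t::real in at_right 0. 0 < t"
      by (auto intro: eventually_at_right_less order_tendstoD)
    ultimately show ?thesis
    proof eventually_elim
      case (elim t)
      have "\<bar>\<mu> * ml_kernel \<alpha> \<mu> (\<alpha> + \<alpha>) t\<bar> \<le> \<mu> * (C * rl_kernel (\<alpha> + \<alpha>) t)"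
        unfolding abs_mult using C(4)[of t] elim \<mu>_pos by (auto intro: mult_mono)
      also have "\<dots> = t powr (\<alpha> - 1) * (B * t powr \<alpha>)"
        using powr_add[of t "\<alpha> - 1" \<alpha>] by (simp add: rl_kernel_def B_def algebra_simps)
      also have "\<dots> < t powr (\<alpha> - 1) * (1 / Gamma \<alpha>)"
        using elim by (intro mult_strict_left_mono) auto
      finally show ?case by (simp add: rl_kernel_def)
    qed
  qed
  then obtain \<delta> where "\<delta> > 0" "\<And>t. 0 < t \<Longrightarrow> t < \<delta> \<Longrightarrow> \<bar>\<mu> * ml_kernel \<alpha> \<mu> (\<alpha> + \<alpha>) t\<bar> < rl_kernel \<alpha> t"
    unfolding eventually_at_right_field by auto
  then show ?thesis using ml_kernel_step[OF \<alpha>_pos] by (intro exI[of _ \<delta>]) (auto simp: abs_less_iff)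
qed

end

section \<open>Positivity of the relaxation kernel and bounds uniform in the eigenvalue\<close>

lemma LINT_rl_kernel_Ioo:
  assumes a: "0 < a" and t: "0 \<le> t1" "t1 \<le> t"
  shows "set_integrable lborel {t1<..<t} (\<lambda>s. rl_kernel a (t - s))"
    and "(LINT s:{t1<..<t}|lborel. rl_kernel a (t - s)) = rl_kernel (a + 1) (t - t1)"
proof -
  have "((\<lambda>s. rl_kernel a (t - s)) has_integral (- rl_kernel (a + 1) (t - t) - (- rl_kernel (a + 1) (t - t1)))) {t1..t}"
  proof (rule fundamental_theorem_of_calculus_interior)
    show "continuous_on {t1..t} (\<lambda>s. - rl_kernel (a + 1) (t - s))"
      unfolding rl_kernel_def using a
      by (intro continuous_on_minus continuous_on_divide continuous_on_powr' continuous_intros) (auto simp: Gamma_eq_zero_iff)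
    fix s assume s: "s \<in> {t1<..<t}"
    have G: "Gamma (a + 1) = a * Gamma a" "Gamma a \<noteq> 0"
      using a Gamma_plus1[of a] Gamma_real_pos[OF a] by (force dest: nonpos_Ints_nonpos)+
    then show "((\<lambda>s. - rl_kernel (a + 1) (t - s)) has_vector_derivative rl_kernel a (t - s)) (at s)"
      unfolding has_real_derivative_iff_has_vector_derivative[symmetric] rl_kernel_def
      using s a by (auto intro!: derivative_eq_intros)
  qed (use t in auto)
  then have I: "((\<lambda>s. rl_kernel a (t - s)) has_integral rl_kernel (a + 1) (t - t1)) {t1<..<t}"
    by (simp add: has_integral_Icc_iff_Ioo rl_kernel_def)
  have "(\<lambda>s. rl_kernel a (t - s)) absolutely_integrable_on {t1<..<t}"
    using I a by (intro nonnegative_absolutely_integrable_1) auto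
  moreover have "set_borel_measurable lborel {t1<..<t} (\<lambda>s. rl_kernel a (t - s))"
    unfolding set_borel_measurable_def by measurable
  ultimately show si: "set_integrable lborel {t1<..<t} (\<lambda>s. rl_kernel a (t - s))"
    unfolding set_integrable_def set_borel_measurable_def by (simp add: integrable_completion)
  show "(LINT s:{t1<..<t}|lborel. rl_kernel a (t - s)) = rl_kernel (a + 1) (t - t1)"
    using set_borel_integral_eq_integral(2)[OF si] integral_unique[OF I] by simp
qed

context relaxation
begin

lemma ml_kernel_volterra:
  "0 < t \<Longrightarrow> ml_kernel \<alpha> \<mu> \<alpha> t = rl_kernel \<alpha> t - \<mu> * conv (rl_kernel \<alpha>) (ml_kernel \<alpha> \<mu> \<alpha>) t"
  using ml_kernel_step[OF \<alpha>_pos] conv_rl_ml_kernel[OF \<alpha>_pos \<alpha>_pos] by simp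

text \<open>Log-convexity of the kernel: at a first zero \<open>t0\<close>, splitting the Volterra equation at \<open>t\<close>
  gives \<open>r t0 \<ge> (t0/t) powr (\<alpha> - 1) * r t - \<mu> * (\<integral> over (t, t0) of the kernel times r)\<close>.\<close>

lemma ml_kernel_pos:
  assumes \<alpha>1: "\<alpha> < 1" and "0 < t"
  shows "0 < ml_kernel \<alpha> \<mu> \<alpha> t"
proof (rule ccontr)
  let ?k = "rl_kernel \<alpha>"
  define r where "r = ml_kernel \<alpha> \<mu> \<alpha>"
  define S where "S = {t. 0 < t \<and> r t \<le> 0}"
  define t0 where "t0 = Inf S"
  assume "\<not> 0 < ml_kernel \<alpha> \<mu> \<alpha> t"
  then have tS: "t \<in> S" using assms by (simp add: S_def r_def)
  obtain \<delta>0 where \<delta>0: "\<delta>0 > 0" "\<And>t. 0 < t \<Longrightarrow> t < \<delta>0 \<Longrightarrow> 0 < r t"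
    using ml_kernel_pos_near_0 by (auto simp: r_def)
  have lb: "\<delta>0 \<le> s" if "s \<in> S" for s using \<delta>0(2)[of s] that by (force simp: S_def)
  have bdd: "bdd_below S" using lb by (auto simp: bdd_below_def)
  have t0_pos: "0 < t0" using cInf_greatest[of S \<delta>0] tS lb \<delta>0(1) unfolding t0_def by force
  have r_pos: "0 < r s" if "0 < s" "s < t0" for s
    using cInf_lower[OF _ bdd, of s] that unfolding t0_def S_def by force
  have r_cont: "continuous_on {0<..} r" unfolding r_def by (rule ml_kernel_continuous_on[OF \<alpha>_pos])
  have r_t0: "r t0 \<le> 0"
  proof -
    have "closedin (top_of_set {\<delta>0..}) ({\<delta>0..} \<inter> r -` {..0})"
      using \<delta>0 by (intro continuous_closedin_preimage continuous_on_subset[OF r_cont]) auto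
    then have "closed ({\<delta>0..} \<inter> r -` {..0})" by (rule closedin_closed_trans) auto
    moreover have "{\<delta>0..} \<inter> r -` {..0} = S" using lb \<delta>0 by (force simp: S_def)
    ultimately have "t0 \<in> S" unfolding t0_def using closed_contains_Inf[OF _ bdd] tS by auto
    then show ?thesis by (simp add: S_def)
  qed
  have "((\<lambda>d. \<mu> * rl_kernel (\<alpha> + 1) d) \<longlongrightarrow> \<mu> * (0 powr \<alpha> / Gamma (\<alpha> + 1))) (at_right 0)"
    unfolding rl_kernel_def using \<alpha>_pos
    by (intro tendsto_intros) (auto simp: eventually_at_filter Gamma_eq_zero_iff)
  then have "\<forall>\<^sub>F d in at_right 0. \<mu> * rl_kernel (\<alpha> + 1) d < 2 powr (\<alpha> - 1)"
    by (intro order_tendstoD(2)) auto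
  then obtain \<delta>1 where \<delta>1: "\<delta>1 > 0" "\<And>d. 0 < d \<Longrightarrow> d < \<delta>1 \<Longrightarrow> \<mu> * rl_kernel (\<alpha> + 1) d < 2 powr (\<alpha> - 1)"
    unfolding eventually_at_right_field by auto
  \<comment> \<open>Two demands on the window: \<open>\<delta> \<le> t0 / 2\<close> keeps
    \<open>t0 / u\<close> below 2, hence \<open>q\<close> above
    \<open>2 powr (\<alpha> - 1)\<close>, and \<open>\<delta> < \<delta>1\<close> makes the part of
    the integral next to \<open>t0\<close> smaller than that.\<close>
  define \<delta> where "\<delta> = min (\<delta>1 / 2) (t0 / 2)"
  have \<delta>: "0 < \<delta>" "\<delta> < \<delta>1" "\<delta> \<le> t0 / 2" using \<delta>1(1) t0_pos by (auto simp: \<delta>_def)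
  have "continuous_on {t0 - \<delta>..t0} r"
    using \<delta> t0_pos by (intro continuous_on_subset[OF r_cont]) auto
  \<comment> \<open>Splitting at a maximum point of \<open>r\<close> on the window allows
    \<open>r\<close> to be replaced by the constant \<open>r u\<close> on (u,t0), so the
    contribution of that interval is again a multiple of \<open>r u\<close>.\<close>
  then obtain u where u: "u \<in> {t0 - \<delta>..t0}" "\<And>s. s \<in> {t0 - \<delta>..t0} \<Longrightarrow> r s \<le> r u"
    using continuous_attains_sup[of "{t0 - \<delta>..t0}" r] \<delta> by auto
  have ru: "0 < r u" using u(2)[of "t0 - \<delta>"] r_pos[of "t0 - \<delta>"] \<delta> by auto
  then have ut: "u < t0" "0 < u" "t0 / u \<le> 2" "t0 - u \<le> \<delta>"
    using u(1) r_t0 \<delta> t0_pos by (auto simp: field_simps) (smt (verit))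
  define q where "q = (t0 / u) powr (\<alpha> - 1)"
  obtain C where C: "kernel_le t0 C \<alpha> r"
    using kernel_le_ml_kernel_exists[OF \<alpha>_pos t0_pos] unfolding r_def by auto
  note int0 = conv_integrable(1)[OF kernel_le_rl_kernel[OF \<alpha>_pos] C order_refl]
  note intu = conv_integrable(1)[OF kernel_le_rl_kernel[OF \<alpha>_pos] C, of u]
  have sub: "{0<..u} \<subseteq> {0<..<t0}" "{u<..<t0} \<subseteq> {0<..<t0}" "{0<..<t0} = {0<..u} \<union> {u<..<t0}"
    "{0<..u} \<inter> {u<..<t0} = {}" using ut by auto
  have int1: "set_integrable lborel {0<..u} (\<lambda>s. ?k (t0 - s) * r s)"
    and int2: "set_integrable lborel {u<..<t0} (\<lambda>s. ?k (t0 - s) * r s)"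
    using set_integrable_subset[OF int0] sub by auto
  have eqN: "(LINT s:{0<..u}|lborel. ?k (t0 - s) * r s) = (LINT s:{0<..<u}|lborel. ?k (t0 - s) * r s)"
    unfolding set_lebesgue_integral_def
  proof (rule integral_cong_AE)
    have [measurable]: "r \<in> borel_measurable borel" unfolding r_def by simp
    show "(\<lambda>s. indicator {0<..u} s *\<^sub>R (?k (t0 - s) * r s)) \<in> borel_measurable lborel"
      "(\<lambda>s. indicator {0<..<u} s *\<^sub>R (?k (t0 - s) * r s)) \<in> borel_measurable lborel" by measurable
    show "AE s in lborel. indicator {0<..u} s *\<^sub>R (?k (t0 - s) * r s)
        = indicator {0<..<u} s *\<^sub>R (?k (t0 - s) * r s)"
      using AE_lborel_singleton[of u] by eventually_elim (auto simp: indicator_def)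
  qed
  have "conv ?k r t0 = (LINT s:{0<..<u}|lborel. ?k (t0 - s) * r s)
      + (LINT s:{u<..<t0}|lborel. ?k (t0 - s) * r s)"
    unfolding conv_def eqN[symmetric] sub(3) by (rule set_integral_Un[OF sub(4) int1 int2])
  also have "(LINT s:{0<..<u}|lborel. ?k (t0 - s) * r s) \<le> (LINT s:{0<..<u}|lborel. q * (?k (u - s) * r s))"
  proof (intro set_integral_mono)
    show "set_integrable lborel {0<..<u} (\<lambda>s. ?k (t0 - s) * r s)"
      by (rule set_integrable_subset[OF int0]) (use ut in auto)
    show "set_integrable lborel {0<..<u} (\<lambda>s. q * (?k (u - s) * r s))"
      using intu ut by (intro set_integrable_mult_right) auto
    fix s assume s: "s \<in> {0<..<u}"
    \<comment> \<open>With the decreasing power of exponent \<open>\<alpha> - 1\<close>, this says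
      that the kernel shrinks more between \<open>u - s\<close> and \<open>t0 - s\<close> than
      between \<open>u\<close> and \<open>t0\<close>. The positivity of \<open>r\<close> on (0,u)
      allows it to be used under the integral.\<close>
    have "t0 / u * (u - s) \<le> t0 - s" using s ut by (auto simp: field_simps)
    then have "(t0 - s) powr (\<alpha> - 1) \<le> (t0 / u * (u - s)) powr (\<alpha> - 1)"
      using s ut \<alpha>1 t0_pos by (intro powr_mono2') auto
    also have "\<dots> = q * (u - s) powr (\<alpha> - 1)"
      unfolding q_def using s ut t0_pos by (subst powr_mult) auto
    finally have "?k (t0 - s) \<le> q * ?k (u - s)"
      using \<alpha>_pos Gamma_real_pos[OF \<alpha>_pos] by (simp add: rl_kernel_def divide_right_mono)
    then show "?k (t0 - s) * r s \<le> q * (?k (u - s) * r s)"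
      using r_pos[of s] s ut by (simp add: mult.assoc[symmetric] mult_right_mono)
  qed
  also have "(LINT s:{0<..<u}|lborel. q * (?k (u - s) * r s)) = q * conv ?k r u"
    by (simp add: conv_def)
  also have "(LINT s:{u<..<t0}|lborel. ?k (t0 - s) * r s) \<le> (LINT s:{u<..<t0}|lborel. ?k (t0 - s) * r u)"
    using LINT_rl_kernel_Ioo(1)[OF \<alpha>_pos, of u t0] u ut \<alpha>_pos
    by (intro set_integral_mono int2 set_integrable_mult_left mult_left_mono u(2)) auto
  also have "\<dots> = rl_kernel (\<alpha> + 1) (t0 - u) * r u"
    using LINT_rl_kernel_Ioo(2)[OF \<alpha>_pos, of u t0] ut by simp
  finally have le: "\<mu> * conv ?k r t0 \<le> \<mu> * (q * conv ?k r u + rl_kernel (\<alpha> + 1) (t0 - u) * r u)"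
    using \<mu>_pos by simp
  have V: "r s = ?k s - \<mu> * conv ?k r s" if "0 < s" for s
    using ml_kernel_volterra[OF that] by (simp add: r_def)
  \<comment> \<open>The free term of the Volterra equation scales by exactly \<open>q\<close>. It
    cancels when \<open>q\<close> times the equation at \<open>u\<close> is subtracted from the one
    at \<open>t0\<close>, and only the contribution of (u,t0) remains.\<close>
  have "?k t0 = q * ?k u"
    unfolding rl_kernel_def q_def using ut t0_pos by (simp add: powr_divide)
  moreover have "q * r u = q * ?k u - \<mu> * (q * conv ?k r u)"
    by (subst V[OF ut(2)]) (simp add: algebra_simps)
  ultimately have "q * r u - \<mu> * rl_kernel (\<alpha> + 1) (t0 - u) * r u \<le> r t0"
    using le V[OF t0_pos] by (simp add: distrib_left mult.assoc)
  moreover have "2 powr (\<alpha> - 1) \<le> q"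
    unfolding q_def using ut t0_pos \<alpha>1 by (intro powr_mono2') auto
  moreover have "\<mu> * rl_kernel (\<alpha> + 1) (t0 - u) < 2 powr (\<alpha> - 1)"
    using \<delta>1(2)[of "t0 - u"] ut \<delta> by auto
  ultimately have "0 < r t0"
    using ru by (smt (verit) mult_less_cancel_right left_diff_distrib)
  with r_t0 show False by simp
qed

text \<open>For \<open>\<nu> > \<alpha>\<close> the kernel is a fractional integral of the positive
  one with \<open>\<nu> = \<alpha>\<close>. The upper bound is \<open>ml_kernel_step\<close>, in
  which the subtracted kernel at \<open>\<nu> + \<alpha>\<close> is nonnegative; nothing in it
  depends on \<open>\<mu>\<close>.\<close>

lemma ml_kernel_bounds:
  assumes \<alpha>1: "\<alpha> < 1" and \<nu>: "\<alpha> \<le> \<nu>" and t: "0 < t"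
  shows "0 \<le> ml_kernel \<alpha> \<mu> \<nu> t" "ml_kernel \<alpha> \<mu> \<nu> t \<le> rl_kernel \<nu> t"
proof -
  note pos = ml_kernel_pos[OF \<alpha>1, THEN less_imp_le]
  have nn: "0 \<le> ml_kernel \<alpha> \<mu> \<nu> t" if "\<alpha> \<le> \<nu>" for \<nu>
  proof (cases "\<nu> = \<alpha>")
    case False
    then have "0 < \<nu> - \<alpha>" using that by simp
    have "ml_kernel \<alpha> \<mu> \<nu> t = conv (rl_kernel (\<nu> - \<alpha>)) (ml_kernel \<alpha> \<mu> \<alpha>) t"
      using conv_rl_ml_kernel[OF \<open>0 < \<nu> - \<alpha>\<close> \<alpha>_pos t] by simp
    also have "\<dots> \<ge> 0" using \<open>0 < \<nu> - \<alpha>\<close> pos by (intro conv_nonneg) auto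
    finally show ?thesis .
  qed (use pos t in auto)
  show "0 \<le> ml_kernel \<alpha> \<mu> \<nu> t" by (rule nn[OF \<nu>])
  show "ml_kernel \<alpha> \<mu> \<nu> t \<le> rl_kernel \<nu> t"
    using ml_kernel_step[of \<nu> t] nn[of "\<nu> + \<alpha>"] \<nu> t \<alpha>_pos \<mu>_pos by (simp add: mult_nonneg_nonneg)
qed

lemma kernel_le_ml_kernel:
  assumes "\<alpha> < 1" "\<alpha> \<le> \<nu>" shows "kernel_le T 1 \<nu> (ml_kernel \<alpha> \<mu> \<nu>)"
  using assms \<alpha>_pos ml_kernel_bounds[OF assms] by (auto simp: kernel_le_def)

text \<open>Summation by parts: the tails of the series \<open>\<Sum>n. a n\<close> are again kernels, and they sum to
  \<open>\<Sum>n. (n + 1) * a n\<close>.\<close>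

lemma weighted_series_eq_conv:
  assumes \<alpha>1: "\<alpha> < 1" and \<nu>: "\<alpha> \<le> \<nu>" and t: "0 < t"
    and X: "(\<lambda>n. real (Suc n) * ((-\<mu>) ^ n * rl_kernel (\<nu> + real (Suc n) * \<alpha>) t)) sums X"
  shows "X = conv (ml_kernel \<alpha> \<mu> \<alpha>) (ml_kernel \<alpha> \<mu> \<nu>) t"
proof -
  let ?e = "ml_kernel \<alpha> \<mu> \<alpha>"
  let ?M = "ml_kernel \<alpha> \<mu>"
  have \<nu>0: "0 < \<nu>" using \<nu> \<alpha>_pos by simp
  define a where "a = (\<lambda>n. (-\<mu>) ^ n * rl_kernel (\<nu> + real (Suc n) * \<alpha>) t)"
  define R where "R = (\<lambda>n. (-\<mu>) ^ n * ?M (\<nu> + real (Suc n) * \<alpha>) t)"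
  have pos: "0 < \<nu> + real n * \<alpha>" for n using \<nu>0 \<alpha>_pos by (simp add: add_pos_nonneg)
  have "(\<lambda>k. (-\<mu>) ^ k * conv ?e (rl_kernel (\<nu> + real k * \<alpha>)) t) sums
     conv ?e (?M \<nu>) t"
    by (rule conv_ml_kernel_sums[OF kernel_le_ml_kernel[OF \<alpha>1 order_refl] \<nu>0 t order_refl])
  moreover have "conv ?e (rl_kernel (\<nu> + real k * \<alpha>)) t = ?M (\<nu> + real (Suc k) * \<alpha>) t" for k
    unfolding conv_commute[of ?e] conv_rl_ml_kernel[OF pos \<alpha>_pos t]
    by (simp add: distrib_right add_ac)
  ultimately have 1: "(\<lambda>N. \<Sum>k<N. R k) \<longlonglongrightarrow> conv ?e (?M \<nu>) t"
    by (simp add: sums_def R_def)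
  have R_step: "R n = a n + R (Suc n)" for n
  proof -
    have "\<nu> + real (Suc n) * \<alpha> + \<alpha> = \<nu> + real (Suc (Suc n)) * \<alpha>" by (simp add: distrib_right)
    with ml_kernel_step[OF pos[of "Suc n"] t] show ?thesis
      unfolding R_def a_def by (simp add: right_diff_distrib del: of_nat_Suc)
  qed
  have sum_eq: "(\<Sum>k<N. R k) - real N * R N = (\<Sum>n<N. real (Suc n) * a n)" for N
  proof (induction N)
    case (Suc N)
    then show ?case using R_step[of N] by (simp add: algebra_simps)
  qed simp
  \<comment> \<open>The boundary term of the summation by parts. Since each tail is at most its
    first term in absolute value, it is dominated by the terms of the convergent series
    \<open>X\<close>.\<close>
  have "(\<lambda>N. real N * R N) \<longlonglongrightarrow> 0"
  proof (rule Lim_null_comparison)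
    have "(\<lambda>n. real (Suc n) * a n) \<longlonglongrightarrow> 0"
      using sums_summable[OF X] summable_LIMSEQ_zero unfolding a_def by blast
    then show "(\<lambda>n. norm (real (Suc n) * a n)) \<longlonglongrightarrow> 0" by (rule tendsto_norm_zero)
    have "norm (real n * R n) \<le> norm (real (Suc n) * a n)" for n
    proof -
      have n: "\<alpha> \<le> \<nu> + real (Suc n) * \<alpha>" using \<nu> \<alpha>_pos by (simp add: add_increasing2)
      have "\<bar>R n\<bar> \<le> \<bar>a n\<bar>"
        unfolding R_def a_def abs_mult using ml_kernel_bounds[OF \<alpha>1 n t] by (intro mult_left_mono) auto
      then show ?thesis unfolding norm_mult by (intro mult_mono) auto
    qed
    then show "\<forall>\<^sub>F n in sequentially. norm (real n * R n) \<le> norm (real (Suc n) * a n)" by simp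
  qed
  from tendsto_diff[OF 1 this] have "(\<lambda>N. \<Sum>n<N. real (Suc n) * a n) \<longlonglongrightarrow> conv ?e (?M \<nu>) t"
    by (simp add: sum_eq)
  with X show ?thesis unfolding sums_def a_def using LIMSEQ_unique by blast
qed

text \<open>The factor \<open>\<mu>\<close> in front of \<open>X\<close> is harmless:
  \<open>X\<close> is at most the kernel at \<open>\<nu> + \<alpha>\<close>, and
  \<open>\<mu>\<close> times that kernel is \<open>rl_kernel \<nu> t\<close> minus a nonnegative
  term. The constant \<open>\<nu> + 2\<close> collects
  \<open>\<bar>\<nu> - 1\<bar> \<le> \<nu> + 1\<close> and \<open>\<alpha> \<le> 1\<close>.\<close>

lemma ml_kernel_derivative_bound:
  assumes \<alpha>1: "\<alpha> < 1" and \<nu>: "\<alpha> \<le> \<nu>" and t: "0 < t"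
  obtains D where "(ml_kernel \<alpha> \<mu> \<nu> has_real_derivative D) (at t)" "\<bar>D\<bar> \<le> (\<nu> + 2) * (rl_kernel \<nu> t / t)"
proof -
  have \<nu>0: "0 < \<nu>" using \<nu> \<alpha>_pos by simp
  define X where "X = conv (ml_kernel \<alpha> \<mu> \<alpha>) (ml_kernel \<alpha> \<mu> \<nu>) t"
  have D: "(ml_kernel \<alpha> \<mu> \<nu> has_real_derivative ((\<nu> - 1) * ml_kernel \<alpha> \<mu> \<nu> t - \<alpha> * \<mu> * X) / t) (at t)"
    using ml_kernel_has_derivative[OF \<nu>0 t] weighted_series_eq_conv[OF \<alpha>1 \<nu> t] unfolding X_def by metis
  have "0 \<le> X" unfolding X_def using ml_kernel_bounds[OF \<alpha>1] \<nu> by (intro conv_nonneg) auto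
  have "X \<le> conv (rl_kernel \<alpha>) (ml_kernel \<alpha> \<mu> \<nu>) t"
    unfolding X_def using ml_kernel_bounds[OF \<alpha>1] \<nu> \<alpha>_pos
    by (intro conv_mono[OF kernel_le_ml_kernel[OF \<alpha>1 order_refl] kernel_le_rl_kernel kernel_le_ml_kernel[OF \<alpha>1 \<nu>] order_refl]) auto
  then have "\<mu> * X \<le> \<mu> * ml_kernel \<alpha> \<mu> (\<nu> + \<alpha>) t"
    using conv_rl_ml_kernel[OF \<alpha>_pos \<nu>0 t] \<mu>_pos by (simp add: add.commute)
  also have "\<dots> \<le> rl_kernel \<nu> t" using ml_kernel_step[OF \<nu>0 t] ml_kernel_bounds[OF \<alpha>1 \<nu> t] by simp
  finally have X: "0 \<le> \<mu> * X" "\<mu> * X \<le> rl_kernel \<nu> t" using \<open>0 \<le> X\<close> \<mu>_pos by auto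
  have "\<bar>(\<nu> - 1) * ml_kernel \<alpha> \<mu> \<nu> t - \<alpha> * \<mu> * X\<bar> \<le> \<bar>\<nu> - 1\<bar> * \<bar>ml_kernel \<alpha> \<mu> \<nu> t\<bar> + \<alpha> * \<bar>\<mu> * X\<bar>"
    using abs_triangle_ineq4[of "(\<nu> - 1) * ml_kernel \<alpha> \<mu> \<nu> t" "\<alpha> * \<mu> * X"] \<alpha>_pos \<mu>_pos by (simp add: abs_mult)
  also have "\<dots> \<le> (\<nu> + 1) * rl_kernel \<nu> t + 1 * rl_kernel \<nu> t"
    using X ml_kernel_bounds[OF \<alpha>1 \<nu> t] \<nu>0 \<alpha>_pos \<alpha>1 by (intro add_mono mult_mono) auto
  finally have "\<bar>((\<nu> - 1) * ml_kernel \<alpha> \<mu> \<nu> t - \<alpha> * \<mu> * X) / t\<bar> \<le> (\<nu> + 2) * (rl_kernel \<nu> t / t)"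
    using t by (simp add: divide_right_mono algebra_simps abs_divide)
  with D show ?thesis using that by blast
qed

end

section \<open>Differentiation of convolutions\<close>

lemma powr_exponent_mono:
  fixes x :: real
  assumes "0 < x" "x \<le> T" "a' \<le> a"
  shows "x powr (a - 1) \<le> T powr (a - a') * x powr (a' - 1)"
proof -
  have "x powr (a - 1) = x powr (a - a') * x powr (a' - 1)"
    by (simp add: powr_add[symmetric])
  also have "\<dots> \<le> T powr (a - a') * x powr (a' - 1)"
    using assms by (intro mult_right_mono powr_mono2) auto
  finally show ?thesis .
qed

lemma rl_kernel_exponent_mono:
  assumes "0 < x" "x \<le> T" "a' \<le> a" "0 < a'"
  shows "rl_kernel a x \<le> T powr (a - a') * Gamma a' / Gamma a * rl_kernel a' x"
proof -
  have "0 < Gamma a" "0 < Gamma a'" using assms by (auto intro: Gamma_real_pos)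
  then show ?thesis
    using powr_exponent_mono[OF assms(1-3)] by (auto simp: rl_kernel_def divide_right_mono)
qed

text \<open>On a bounded interval a stronger singularity at 0 dominates a weaker one, at the price
  of a power of \<open>T\<close>.\<close>

lemma kernel_le_weaken:
  assumes f: "kernel_le T C a f" and a': "0 < a'" "a' \<le> a"
  shows "\<exists>C'. kernel_le T C' a' f"
proof -
  note F = kernel_leD[OF f]
  have "\<bar>f t\<bar> \<le> C * (T powr (a - a') * Gamma a' / Gamma a) * rl_kernel a' t" if "0 < t" "t \<le> T" for t
  proof -
    have "\<bar>f t\<bar> \<le> C * rl_kernel a t" using F that by auto
    also have "\<dots> \<le> C * (T powr (a - a') * Gamma a' / Gamma a * rl_kernel a' t)"
      using F that a' by (intro mult_left_mono rl_kernel_exponent_mono) auto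
    finally show ?thesis by (simp add: mult.assoc)
  qed
  moreover have "0 \<le> T powr (a - a') * Gamma a' / Gamma a"
    using Gamma_real_pos[of a] Gamma_real_pos[of a'] F a' by simp
  ultimately show ?thesis using F a'
    by (intro exI[of _ "C * (T powr (a - a') * Gamma a' / Gamma a)"]) (auto simp: kernel_le_def)
qed

lemma conv_bounded_continuous_on:
  assumes K: "continuous_on UNIV K" "\<And>x. 0 < x \<Longrightarrow> x \<le> T \<Longrightarrow> \<bar>K x\<bar> \<le> B" and B: "0 \<le> B"
    and g: "kernel_le T D b g"
  shows "continuous_on {0<..T} (conv K g)"
  unfolding continuous_on_sequentially o_def
proof (intro allI ballI impI)
  fix x :: "nat \<Rightarrow> real" and t assume t: "t \<in> {0<..T}" and x: "(\<forall>n. x n \<in> {0<..T}) \<and> x \<longlonglongrightarrow> t"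
  have [measurable]: "g \<in> borel_measurable borel" "K \<in> borel_measurable borel"
    using kernel_leD[OF g] borel_measurable_continuous_onI[OF K(1)] by auto
  have "set_integrable lborel {0<..<T} (\<lambda>s. rl_kernel 1 (T - s) * g s)"
    by (rule conv_integrable(1)[OF kernel_le_rl_kernel g]) auto
  also have "?this \<longleftrightarrow> set_integrable lborel {0<..<T} g"
    by (intro set_integrable_cong) auto
  finally have gi: "integrable lborel (\<lambda>s. B * \<bar>indicator {0<..<T} s * g s\<bar>)"
    unfolding set_integrable_def by (intro integrable_mult_right integrable_abs) simp
  have "(\<lambda>n. LINT s|lborel. indicator {0<..<x n} s * (K (x n - s) * g s)) \<longlonglongrightarrow>
      (LINT s|lborel. indicator {0<..<t} s * (K (t - s) * g s))"
  proof (rule integral_dominated_convergence[OF _ _ gi])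
    show "AE s in lborel. (\<lambda>n. indicator {0<..<x n} s * (K (x n - s) * g s)) \<longlonglongrightarrow>
        indicator {0<..<t} s * (K (t - s) * g s)"
      \<comment> \<open>At \<open>s = t\<close> the indicators of the intervals (0, x n) need not
        converge; this one point is removed.\<close>
      using AE_lborel_singleton[of t]
    proof eventually_elim
      case (elim s)
      have "(\<lambda>n. indicator {0<..<x n} s :: real) \<longlonglongrightarrow> indicator {0<..<t} s"
      proof (cases "s < t")
        case True
        then have "\<forall>\<^sub>F n in sequentially. s < x n" using x by (intro order_tendstoD(1)) auto
        then have "\<forall>\<^sub>F n in sequentially. indicator {0<..<x n} s = (indicator {0<..<t} s :: real)"
          by eventually_elim (use True in \<open>auto simp: indicator_def\<close>)
        then show ?thesis by (rule tendsto_eventually)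
      next
        case False
        then have "\<forall>\<^sub>F n in sequentially. x n < s" using x elim by (intro order_tendstoD(2)) auto
        then have "\<forall>\<^sub>F n in sequentially. indicator {0<..<x n} s = (indicator {0<..<t} s :: real)"
          by eventually_elim (use False in \<open>auto simp: indicator_def\<close>)
        then show ?thesis by (rule tendsto_eventually)
      qed
      moreover have "(\<lambda>n. K (x n - s)) \<longlonglongrightarrow> K (t - s)"
        by (rule continuous_on_tendsto_compose[OF K(1)]) (use x in \<open>auto intro!: tendsto_intros\<close>)
      ultimately show ?case by (intro tendsto_intros)
    qed
    show "AE s in lborel. norm (indicator {0<..<x n} s * (K (x n - s) * g s)) \<le> B * \<bar>indicator {0<..<T} s * g s\<bar>" for n
    proof (intro AE_I2)
      fix s
      have "x n \<le> T" using x by auto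
      then show "norm (indicator {0<..<x n} s * (K (x n - s) * g s)) \<le> B * \<bar>indicator {0<..<T} s * g s\<bar>"
        using K(2)[of "x n - s"] B by (auto simp: indicator_def abs_mult intro: mult_right_mono)
    qed
  qed measurable
  then show "(\<lambda>n. conv K g (x n)) \<longlonglongrightarrow> conv K g t"
    unfolding conv_def set_lebesgue_integral_def by simp
qed

lemma conv_diff_left:
  assumes "kernel_le T C a f" "kernel_le T C' a' f'" "kernel_le T D b g" "t \<le> T"
  shows "conv (\<lambda>s. f s - f' s) g t = conv f g t - conv f' g t"
  unfolding conv_def left_diff_distrib
  by (rule set_integral_diff(2)) (use conv_integrable(1) assms in blast)+

text \<open>A singular kernel is approximated by bounded ones: \<open>Kd \<delta>\<close> freezes
  \<open>K\<close> at its value at \<open>\<delta>\<close> on all arguments below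
  \<open>\<delta>\<close>. Half of the exponent \<open>a\<close> pays for the smallness
  \<open>\<delta> powr (a/2)\<close> of the error, the other half keeps the error integrable, and
  the convolutions converge uniformly away from 0.\<close>

lemma conv_continuous_on:
  assumes K0: "kernel_le T C0 a0 K" and Kc: "continuous_on {0<..} K" and g: "kernel_le T D b g"
  shows "continuous_on {0<..T} (conv K g)"
proof -
  note G = kernel_leD[OF g]
  define a where "a = min a0 1"
  obtain C where K: "kernel_le T C a K"
    using kernel_le_weaken[OF K0, of a] kernel_leD(1)[OF K0] unfolding a_def by auto
  note KD = kernel_leD[OF K]
  have a1: "a \<le> 1" by (simp add: a_def)
  have [measurable]: "K \<in> borel_measurable borel" using KD by auto
  define Kd where "Kd = (\<lambda>\<delta> x. K (max x \<delta>))"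
  define E where "E = 2 * C * Gamma (a/2) / Gamma a"
  have Gam: "0 < Gamma a" "0 < Gamma (a/2)" using KD by (auto intro: Gamma_real_pos)
  have E: "0 \<le> E" using KD Gam by (simp add: E_def)
  have cont: "continuous_on {0<..T} (conv (Kd \<delta>) g)"
    and Kd_le: "kernel_le T (E * \<delta> powr (a/2)) (a/2) (\<lambda>x. K x - Kd \<delta> x)"
    and Kd_le': "\<exists>B. kernel_le T B 1 (Kd \<delta>)" if \<delta>: "0 < \<delta>" "\<delta> < T" for \<delta>
  proof -
    have "compact (K ` {\<delta>..T})"
      by (intro compact_continuous_image continuous_on_subset[OF Kc]) (use \<delta> in auto)
    then obtain B where B: "\<And>y. y \<in> K ` {\<delta>..T} \<Longrightarrow> norm y \<le> B"
      using compact_imp_bounded bounded_iff by metis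
    have B': "\<bar>Kd \<delta> x\<bar> \<le> B" if "x \<le> T" for x using B[of "Kd \<delta> x"] that \<delta> by (auto simp: Kd_def)
    have B0: "0 \<le> B" using B'[of 0] \<delta> by auto
    have Kdc: "continuous_on UNIV (Kd \<delta>)"
      unfolding Kd_def by (intro continuous_on_compose2[OF Kc] continuous_intros) (use \<delta> in auto)
    show "continuous_on {0<..T} (conv (Kd \<delta>) g)"
      by (rule conv_bounded_continuous_on[OF Kdc _ B0 g]) (use B' in auto)
    show "\<exists>B. kernel_le T B 1 (Kd \<delta>)"
      using B' B0 borel_measurable_continuous_onI[OF Kdc] by (intro exI[of _ B]) (auto simp: kernel_le_def)
    show "kernel_le T (E * \<delta> powr (a/2)) (a/2) (\<lambda>x. K x - Kd \<delta> x)"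
      unfolding kernel_le_def
    proof (intro conjI ballI)
      show "(\<lambda>x. K x - Kd \<delta> x) \<in> borel_measurable borel" unfolding Kd_def by measurable
      fix x assume x: "x \<in> {0<..T}"
      show "\<bar>K x - Kd \<delta> x\<bar> \<le> E * \<delta> powr (a/2) * rl_kernel (a/2) x"
      proof (cases "x < \<delta>")
        case True
        have "rl_kernel a \<delta> \<le> rl_kernel a x"
          unfolding rl_kernel_def using True x a1 Gam by (intro divide_right_mono powr_mono2') auto
        then have "C * rl_kernel a \<delta> \<le> C * rl_kernel a x" using KD by (intro mult_left_mono)
        moreover have "\<bar>K x\<bar> \<le> C * rl_kernel a x" "\<bar>K \<delta>\<bar> \<le> C * rl_kernel a \<delta>" using KD x \<delta> by auto
        ultimately have "\<bar>K x - Kd \<delta> x\<bar> \<le> 2 * C * rl_kernel a x"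
          using True by (simp add: Kd_def)
        also have "\<dots> \<le> 2 * C * (\<delta> powr (a - a/2) * Gamma (a/2) / Gamma a * rl_kernel (a/2) x)"
          using KD True x by (intro mult_left_mono rl_kernel_exponent_mono) auto
        also have "\<dots> = E * \<delta> powr (a/2) * rl_kernel (a/2) x"
          by (simp add: E_def field_simps)
        finally show ?thesis .
      qed (use x E KD in \<open>auto simp: Kd_def\<close>)
    qed (use KD E in auto)
  qed
  have main: "continuous_on {c..T} (conv K g)" if c: "0 < c" "c < T" for c
  proof -
    have "compact (rl_kernel (a/2 + b) ` {c..T})"
      unfolding rl_kernel_def using c G KD
      by (intro compact_continuous_image continuous_intros) (auto simp: Gamma_eq_zero_iff)
    then obtain M where M: "\<And>y. y \<in> rl_kernel (a/2 + b) ` {c..T} \<Longrightarrow> norm y \<le> M"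
      using compact_imp_bounded bounded_iff by metis
    have lim: "((\<lambda>\<delta>. E * \<delta> powr (a/2) * D * M) \<longlongrightarrow> E * 0 powr (a/2) * D * M) (at_right 0)"
      using KD by (intro tendsto_intros) (auto simp: eventually_at_filter)
    have ev: "\<forall>\<^sub>F \<delta> in at_right 0. 0 < \<delta> \<and> \<delta> < T"
      using c by (auto simp: eventually_at_right_field intro: exI[of _ T])
    show ?thesis
    proof (rule uniform_limit_theorem)
      show "\<forall>\<^sub>F \<delta> in at_right 0. continuous_on {c..T} (conv (Kd \<delta>) g)"
        using ev by eventually_elim (rule continuous_on_subset[OF cont], use c in auto)
      show "uniform_limit {c..T} (\<lambda>\<delta>. conv (Kd \<delta>) g) (conv K g) (at_right 0)"
      proof (rule uniform_limitI)
        fix e :: real assume "0 < e"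
        then have "\<forall>\<^sub>F \<delta> in at_right 0. E * \<delta> powr (a/2) * D * M < e"
          using order_tendstoD(2)[OF lim, of e] by simp
        with ev show "\<forall>\<^sub>F \<delta> in at_right 0. \<forall>t\<in>{c..T}. dist (conv (Kd \<delta>) g t) (conv K g t) < e"
        proof eventually_elim
          case (elim \<delta>)
          show ?case
          proof
            fix t assume t: "t \<in> {c..T}"
            obtain B where "kernel_le T B 1 (Kd \<delta>)" using Kd_le' elim by auto
            then have "conv K g t - conv (Kd \<delta>) g t = conv (\<lambda>x. K x - Kd \<delta> x) g t"
              using conv_diff_left[OF K _ g] t by auto
            then have "dist (conv (Kd \<delta>) g t) (conv K g t) = \<bar>conv (\<lambda>x. K x - Kd \<delta> x) g t\<bar>"
              by (simp add: dist_real_def abs_minus_commute)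
            also have "\<dots> \<le> E * \<delta> powr (a/2) * D * rl_kernel (a/2 + b) t"
              using abs_conv_le[OF Kd_le g] elim t by auto
            also have "\<dots> \<le> E * \<delta> powr (a/2) * D * M"
              using M[of "rl_kernel (a/2 + b) t"] t E G by (intro mult_left_mono) auto
            finally show "dist (conv (Kd \<delta>) g t) (conv K g t) < e" using elim by simp
          qed
        qed
      qed
    qed simp
  qed
  show ?thesis
    unfolding continuous_on_eq_continuous_within
  proof
    fix t assume t: "t \<in> {0<..T}"
    have "continuous (at t within {t/2..T}) (conv K g)"
      using main[of "t/2"] t by (simp add: continuous_on_eq_continuous_within)
    moreover have "at t within {t/2..T} = at t within {0<..T}"
      by (rule at_within_nhd[of _ "{t/2<..}"]) (use t in auto)
    ultimately show "continuous (at t within {0<..T}) (conv K g)" by (simp only:)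
  qed
qed

section \<open>The fundamental theorem of calculus for integrands singular at 0\<close>

lemma set_integrable_kernel_le:
  assumes g: "kernel_le T D b g" and t: "t \<le> T"
  shows "set_integrable lborel {0<..<t} g"
proof -
  have "set_integrable lborel {0<..<t} (\<lambda>s. rl_kernel 1 (t - s) * g s)"
    by (rule conv_integrable(1)[OF kernel_le_rl_kernel g]) (use t in auto)
  also have "?this \<longleftrightarrow> set_integrable lborel {0<..<t} g"
    by (intro set_integrable_cong) auto
  finally show ?thesis .
qed

lemma conv_rl_kernel_1: "conv (rl_kernel 1) g t = (LINT s:{0<..<t}|lborel. g s)"
  unfolding conv_def by (intro set_lebesgue_integral_cong) auto

lemma conv_rl_kernel_1_eq_integral:
  assumes g: "kernel_le T D b g" and t: "t \<le> T"
  shows "g integrable_on {0..t}" "conv (rl_kernel 1) g t = integral {0..t} g"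
  unfolding conv_rl_kernel_1
  using set_borel_integral_eq_integral[OF set_integrable_kernel_le[OF assms]]
  by (simp_all add: integrable_on_Icc_iff_Ioo integral_open_interval_real)

text \<open>As \<open>h\<close> may be singular at 0, the integral is split at
  \<open>c = t / 2\<close>: the part below is a constant, and above it \<open>h\<close> is
  continuous.\<close>

lemma conv_rl_kernel_1_has_derivative:
  assumes h: "kernel_le T C a h" and hc: "continuous_on {0<..T} h" and t: "t \<in> {0<..T}"
  shows "(conv (rl_kernel 1) h has_real_derivative h t) (at t within {0..T})"
proof -
  define c where "c = t / 2"
  have c: "0 < c" "c < t" "t \<le> T" using t by (auto simp: c_def)
  have "((\<lambda>x. integral {c..x} h) has_real_derivative h t) (at t within {c..T})"
    by (rule integral_has_real_derivative) (use c in \<open>auto intro!: continuous_on_subset[OF hc]\<close>)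
  then have "((\<lambda>x. integral {0..c} h + integral {c..x} h) has_real_derivative h t) (at t within {c..T})"
    by (auto intro!: derivative_eq_intros)
  then have "(conv (rl_kernel 1) h has_real_derivative h t) (at t within {c..T})"
  proof (rule has_field_derivative_transform_within[where d=1])
    fix x assume x: "x \<in> {c..T}"
    have "integral {0..c} h + integral {c..x} h = integral {0..x} h"
      by (rule Henstock_Kurzweil_Integration.integral_combine)
        (use c x conv_rl_kernel_1_eq_integral(1)[OF h, of x] in auto)
    then show "integral {0..c} h + integral {c..x} h = conv (rl_kernel 1) h x"
      using conv_rl_kernel_1_eq_integral(2)[OF h, of x] x by simp
  qed (use c in auto)
  moreover have "at t within {c..T} = at t within {0..T}"
    by (rule at_within_nhd[of _ "{c<..}"]) (use c in auto)
  ultimately show ?thesis by (simp only:)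
qed

text \<open>Measurability of \<open>g\<close> is not given and has to come from its being a
  derivative. It is a limit of difference quotients of \<open>e n\<close>, the function
  \<open>c\<close> with its argument clamped to stay between 1/(n+1) and \<open>T\<close>, which is
  continuous on the whole line. The cut-off to (0,T) leaves only two-sided derivatives.\<close>

lemma derivative_kernel_le:
  assumes T: "0 < T"
    and der: "\<And>t. t \<in> {0<..T} \<Longrightarrow> (c has_real_derivative g t) (at t within {0..T})"
    and le: "\<And>t. t \<in> {0<..T} \<Longrightarrow> \<bar>g t\<bar> \<le> D * rl_kernel b t" and b: "0 < b" and D: "0 \<le> D"
  shows "kernel_le T D b (\<lambda>t. indicator {0<..<T} t * g t)"
proof -
  define e where "e = (\<lambda>n t. c (min T (max (1 / real (Suc n)) t)))"
  have c: "continuous_on {0<..T} c"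
    unfolding continuous_on_eq_continuous_within
    by (intro ballI DERIV_continuous[OF DERIV_subset[OF der]]) auto
  have "continuous_on UNIV (e n)" for n
    unfolding e_def by (rule continuous_on_compose2[OF c]) (use T in \<open>auto intro!: continuous_intros simp: less_max_iff_disj\<close>)
  then have [measurable]: "e n \<in> borel_measurable borel" for n by (rule borel_measurable_continuous_onI)
  have "(\<lambda>t. indicator {0<..<T} t * g t) \<in> borel_measurable borel"
  proof (rule borel_measurable_LIMSEQ_real)
    fix t :: real
    show "(\<lambda>n. indicator {0<..<T} t * ((e n (t + 1 / real (Suc n)) - e n t) / (1 / real (Suc n))))
        \<longlonglongrightarrow> indicator {0<..<T} t * g t"
    proof (cases "t \<in> {0<..<T}")
      case True
      have "(c has_real_derivative g t) (at t)"
        using der[of t] True at_within_Icc_at[of 0 t T] by auto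
      then have "((\<lambda>h. (c (t + h) - c t) / h) \<longlongrightarrow> g t) (at 0)" by (simp add: DERIV_def)
      moreover have small: "(\<lambda>n. 1 / real (Suc n)) \<longlonglongrightarrow> 0"
        using LIMSEQ_inverse_real_of_nat by (simp add: inverse_eq_divide)
      then have "filterlim (\<lambda>n. 1 / real (Suc n)) (at 0) sequentially"
        by (auto simp: filterlim_at)
      ultimately have "(\<lambda>n. (c (t + 1 / real (Suc n)) - c t) / (1 / real (Suc n))) \<longlonglongrightarrow> g t"
        by (rule filterlim_compose)
      moreover have "\<forall>\<^sub>F n in sequentially. 1 / real (Suc n) < min t (T - t)"
        using small True by (intro order_tendstoD(2)) auto
      then have "\<forall>\<^sub>F n in sequentially. (c (t + 1 / real (Suc n)) - c t) / (1 / real (Suc n))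
         = (e n (t + 1 / real (Suc n)) - e n t) / (1 / real (Suc n))"
      proof eventually_elim
        case (elim n)
        then have "max (1 / real (Suc n)) (t + 1 / real (Suc n)) = t + 1 / real (Suc n)"
          "max (1 / real (Suc n)) t = t" using True by auto
        with elim True show ?case unfolding e_def by (simp del: of_nat_Suc)
      qed
      ultimately have "(\<lambda>n. (e n (t + 1 / real (Suc n)) - e n t) / (1 / real (Suc n))) \<longlonglongrightarrow> g t"
        by (rule Lim_transform_eventually)
      then show ?thesis using True by simp
    qed simp
  qed measurable
  then show ?thesis using b D le by (auto simp: kernel_le_def indicator_def)
qed

lemma conv_rl_kernel_1_derivative:
  assumes c: "continuous_on {0..T} c"
    and der: "\<And>t. t \<in> {0<..T} \<Longrightarrow> (c has_real_derivative g t) (at t within {0..T})"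
    and le: "\<And>t. t \<in> {0<..T} \<Longrightarrow> \<bar>g t\<bar> \<le> D * rl_kernel b t" and b: "0 < b" and D: "0 \<le> D"
    and t: "t \<in> {0<..T}"
  shows "conv (rl_kernel 1) g t = c t - c 0"
proof -
  define g' where "g' = (\<lambda>t. indicator {0<..<T} t * g t)"
  have g': "kernel_le T D b g'"
    unfolding g'_def by (rule derivative_kernel_le[OF _ der le b D]) (use t in auto)
  have "conv (rl_kernel 1) g t = conv (rl_kernel 1) g' t"
    by (rule conv_cong) (use t in \<open>auto simp: g'_def\<close>)
  also have "\<dots> = integral {0..t} g'"
    using conv_rl_kernel_1_eq_integral(2)[OF g'] t by auto
  also have "(g' has_integral (c t - c 0)) {0..t}"
  proof (rule fundamental_theorem_of_calculus_interior)
    fix x assume x: "x \<in> {0<..<t}"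
    then show "(c has_vector_derivative g' x) (at x)"
      using der[of x] at_within_Icc_at[of 0 x T] t
      by (auto simp: g'_def has_real_derivative_iff_has_vector_derivative)
  qed (use t in \<open>auto intro: continuous_on_subset[OF c]\<close>)
  then have "integral {0..t} g' = c t - c 0" by (rule integral_unique)
  finally show ?thesis .
qed

text \<open>Commutativity and associativity bring the constant kernel \<open>rl_kernel 1\<close> to
  the outside. Both functions it is then applied to, \<open>K\<close> and its convolution with
  \<open>g'\<close>, are continuous on (0,T] with an integrable bound, so \<open>K\<close> itself is
  never differentiated.\<close>

lemma conv_has_derivative:
  assumes K: "kernel_le T C a K" and Kc: "continuous_on {0<..} K"
    and c: "continuous_on {0..T} c"
    and der: "\<And>t. t \<in> {0<..T} \<Longrightarrow> (c has_real_derivative g t) (at t within {0..T})"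
    and le: "\<And>t. t \<in> {0<..T} \<Longrightarrow> \<bar>g t\<bar> \<le> D * rl_kernel b t" and b: "0 < b" and D: "0 \<le> D"
    and t: "t \<in> {0<..T}"
  shows "(conv K c has_real_derivative c 0 * K t + conv K g t) (at t within {0..T})"
proof -
  let ?o = "rl_kernel 1"
  define g' where "g' = (\<lambda>t. indicator {0<..<T} t * g t)"
  have g': "kernel_le T D b g'"
    unfolding g'_def by (rule derivative_kernel_le[OF _ der le b D]) (use t in auto)
  have one: "kernel_le T 1 1 ?o" by (rule kernel_le_rl_kernel) simp
  have c0: "kernel_le T \<bar>c 0\<bar> 1 (\<lambda>s. c 0 * rl_kernel 1 s)" by (auto simp: kernel_le_def abs_mult)
  have conv_g: "conv K g s = conv K g' s" if "s \<le> T" for s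
    by (rule conv_cong) (use that in \<open>auto simp: g'_def\<close>)
  have eq: "conv K c s = c 0 * conv ?o K s + conv ?o (conv K g') s" if s: "s \<in> {0..T}" for s
  proof -
    have "conv K c s = conv K (\<lambda>r. c 0 * rl_kernel 1 r + conv ?o g' r) s"
    proof (intro conv_cong refl)
      fix r assume r: "0 < r" "r < s"
      have "conv ?o g r = conv ?o g' r"
        by (rule conv_cong) (use r s in \<open>auto simp: g'_def\<close>)
      then show "c r = c 0 * rl_kernel 1 r + conv ?o g' r"
        using conv_rl_kernel_1_derivative[OF c der le b D, of r] r s by auto
    qed
    also have "\<dots> = c 0 * conv K ?o s + conv K (conv ?o g') s"
      using conv_add_right[OF K c0 kernel_le_conv[OF one g'], of s] s by (simp add: conv_cmult_right)
    also have "conv K (conv ?o g') s = conv ?o (conv K g') s"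
    proof -
      have "conv K ?o = conv ?o K" by (rule ext, rule conv_commute)
      then show ?thesis using conv_assoc[OF K one g', of s] conv_assoc[OF one K g', of s] s by simp
    qed
    finally show ?thesis by (simp add: conv_commute[of K ?o])
  qed
  have d1: "(conv ?o K has_real_derivative K t) (at t within {0..T})"
    by (rule conv_rl_kernel_1_has_derivative[OF K _ t]) (auto intro: continuous_on_subset[OF Kc])
  have d2: "(conv ?o (conv K g') has_real_derivative conv K g' t) (at t within {0..T})"
    by (rule conv_rl_kernel_1_has_derivative[OF kernel_le_conv[OF K g'] conv_continuous_on[OF K Kc g'] t])
  have "((\<lambda>s. c 0 * conv ?o K s + conv ?o (conv K g') s) has_real_derivative
     c 0 * K t + conv K g' t) (at t within {0..T})"
    by (intro DERIV_add DERIV_cmult d1 d2)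
  then have "(conv K c has_real_derivative c 0 * K t + conv K g' t) (at t within {0..T})"
    by (rule has_field_derivative_transform_within[where d=1]) (use eq t in auto)
  then show ?thesis using conv_g t by simp
qed

text \<open>An integrable bound on the derivative forces a limit at 0. It is expressed from the
  endpoint \<open>T\<close>, since the value \<open>c 0\<close> may be unrelated to the values at
  positive times.\<close>

lemma derivative_extends_continuously:
  assumes T: "0 < T"
    and der: "\<And>t. t \<in> {0<..T} \<Longrightarrow> (c has_real_derivative g t) (at t within {0..T})"
    and le: "\<And>t. t \<in> {0<..T} \<Longrightarrow> \<bar>g t\<bar> \<le> D * rl_kernel b t" and b: "0 < b" and D: "0 \<le> D"
  shows "continuous_on {0..T} (\<lambda>t. if t \<le> 0 then c T - conv (rl_kernel 1) g T else c t)"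
proof -
  define g' where "g' = (\<lambda>t. indicator {0<..<T} t * g t)"
  have g': "kernel_le T D b g'"
    unfolding g'_def by (rule derivative_kernel_le[OF T der le b D])
  note int = conv_rl_kernel_1_eq_integral[OF g']
  have conv_T: "conv (rl_kernel 1) g T = integral {0..T} g'"
    unfolding int(2)[OF order_refl, symmetric] by (rule conv_cong) (auto simp: g'_def)
  have "(if t \<le> 0 then c T - conv (rl_kernel 1) g T else c t) = c T - integral {0..T} g' + integral {0..t} g'"
    if t: "t \<in> {0..T}" for t
  proof (cases "t = 0")
    case False
    then have t: "0 < t" "t \<le> T" using t by auto
    have "(g' has_integral (c T - c t)) {t..T}"
    proof (rule fundamental_theorem_of_calculus_interior)
      show "continuous_on {t..T} c"
        unfolding continuous_on_eq_continuous_within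
        by (intro ballI DERIV_continuous[OF DERIV_subset[OF der]]) (use t in auto)
      fix x assume x: "x \<in> {t<..<T}"
      then show "(c has_vector_derivative g' x) (at x)"
        using der[of x] at_within_Icc_at[of 0 x T] t
        by (auto simp: g'_def has_real_derivative_iff_has_vector_derivative)
    qed (use t in auto)
    then have "integral {t..T} g' = c T - c t" by (rule integral_unique)
    moreover have "integral {0..t} g' + integral {t..T} g' = integral {0..T} g'"
      by (rule Henstock_Kurzweil_Integration.integral_combine) (use t int(1)[of T] in auto)
    ultimately show ?thesis using t by simp
  qed (simp add: conv_T)
  moreover have "continuous_on {0..T} (\<lambda>t. c T - integral {0..T} g' + integral {0..t} g')"
    by (intro continuous_intros indefinite_integral_continuous_1 int(1)) simp
  ultimately show ?thesis by (simp cong: continuous_on_cong_simp)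
qed

section \<open>The Hilbert space L2\<close>

lemma L2D: "w \<in> L2 \<Omega> \<Longrightarrow> w \<in> borel_measurable (lebesgue_on \<Omega>)"
  by (simp add: L2_def)

lemma L2_mult_integrable:
  assumes u: "u \<in> L2 \<Omega>" and w: "w \<in> L2 \<Omega>"
  shows "integrable (lebesgue_on \<Omega>) (\<lambda>x. u x * w x)"
proof (rule Bochner_Integration.integrable_bound)
  show "integrable (lebesgue_on \<Omega>) (\<lambda>x. (u x)\<^sup>2 + (w x)\<^sup>2)"
    using u w by (simp add: L2_def)
  show "(\<lambda>x. u x * w x) \<in> borel_measurable (lebesgue_on \<Omega>)"
    by (intro borel_measurable_times L2D u w)
  have "\<bar>a * b\<bar> \<le> a\<^sup>2 + b\<^sup>2" for a b :: real
  proof -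
    have "2 * \<bar>a * b\<bar> \<le> a\<^sup>2 + b\<^sup>2"
      using sum_squares_bound[of "\<bar>a\<bar>" "\<bar>b\<bar>"] by (simp add: abs_mult)
    then show ?thesis using abs_ge_zero[of "a * b"] by linarith
  qed
  then show "AE x in lebesgue_on \<Omega>. norm (u x * w x) \<le> norm ((u x)\<^sup>2 + (w x)\<^sup>2)"
    by auto
qed

lemma L2_add [intro]:
  assumes u: "u \<in> L2 \<Omega>" and w: "w \<in> L2 \<Omega>" shows "(\<lambda>x. u x + w x) \<in> L2 \<Omega>"
proof -
  note [measurable] = L2D[OF u] L2D[OF w]
  have "integrable (lebesgue_on \<Omega>) (\<lambda>x. (u x)\<^sup>2 + (w x)\<^sup>2 + 2 * (u x * w x))"
    using u w L2_mult_integrable[OF u w] by (simp add: L2_def)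
  then show ?thesis by (simp add: L2_def power2_sum mult.assoc)
qed

lemma L2_cmult [intro]: "u \<in> L2 \<Omega> \<Longrightarrow> (\<lambda>x. c * u x) \<in> L2 \<Omega>"
  by (auto simp: L2_def power_mult_distrib intro!: borel_measurable_times borel_measurable_const)

lemma L2_diff [intro]: "u \<in> L2 \<Omega> \<Longrightarrow> w \<in> L2 \<Omega> \<Longrightarrow> (\<lambda>x. u x - w x) \<in> L2 \<Omega>"
  using L2_add[OF _ L2_cmult[of w _ "-1"], of u] by simp

lemma L2_divide [intro]: "u \<in> L2 \<Omega> \<Longrightarrow> (\<lambda>x. u x / c) \<in> L2 \<Omega>"
  using L2_cmult[of u \<Omega> "1/c"] by simp

lemma L2_zero [simp]: "(\<lambda>x. 0) \<in> L2 \<Omega>"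
  by (simp add: L2_def)

lemma L2_sum: "(\<And>j. j \<in> J \<Longrightarrow> u j \<in> L2 \<Omega>) \<Longrightarrow> (\<lambda>x. \<Sum>j\<in>J. u j x) \<in> L2 \<Omega>"
  by (induction J rule: infinite_finite_induct) auto

lemma L2_inner_commute: "L2_inner \<Omega> u w = L2_inner \<Omega> w u"
  by (simp add: L2_inner_def mult.commute)

lemma L2_inner_add_left:
  "u \<in> L2 \<Omega> \<Longrightarrow> v \<in> L2 \<Omega> \<Longrightarrow> w \<in> L2 \<Omega> \<Longrightarrow> L2_inner \<Omega> (\<lambda>x. u x + v x) w = L2_inner \<Omega> u w + L2_inner \<Omega> v w"
  by (simp add: L2_inner_def distrib_right L2_mult_integrable)

lemma L2_inner_diff_left:
  "u \<in> L2 \<Omega> \<Longrightarrow> v \<in> L2 \<Omega> \<Longrightarrow> w \<in> L2 \<Omega> \<Longrightarrow> L2_inner \<Omega> (\<lambda>x. u x - v x) w = L2_inner \<Omega> u w - L2_inner \<Omega> v w"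
  by (simp add: L2_inner_def left_diff_distrib L2_mult_integrable)

lemma L2_inner_cmult_left: "L2_inner \<Omega> (\<lambda>x. c * u x) w = c * L2_inner \<Omega> u w"
  by (simp add: L2_inner_def mult.assoc)

lemma L2_inner_divide_left: "L2_inner \<Omega> (\<lambda>x. u x / c) w = L2_inner \<Omega> u w / c"
  using L2_inner_cmult_left[of \<Omega> "1/c" u w] by simp

lemma L2_inner_sum_left:
  "(\<And>j. j \<in> J \<Longrightarrow> u j \<in> L2 \<Omega>) \<Longrightarrow> w \<in> L2 \<Omega> \<Longrightarrow>
    L2_inner \<Omega> (\<lambda>x. \<Sum>j\<in>J. u j x) w = (\<Sum>j\<in>J. L2_inner \<Omega> (u j) w)"
  by (induction J rule: infinite_finite_induct) (auto simp: L2_inner_add_left L2_sum, auto simp: L2_inner_def)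

lemma L2_inner_self_nonneg [simp]: "0 \<le> L2_inner \<Omega> w w"
  unfolding L2_inner_def by (intro Bochner_Integration.integral_nonneg) auto

lemma L2_norm_nonneg [simp]: "0 \<le> L2_norm \<Omega> w"
  by (simp add: L2_norm_def)

lemma L2_norm_power2: "(L2_norm \<Omega> w)\<^sup>2 = L2_inner \<Omega> w w"
  by (simp add: L2_norm_def)

lemma L2_norm_minus_commute: "L2_norm \<Omega> (\<lambda>x. u x - w x) = L2_norm \<Omega> (\<lambda>x. w x - u x)"
  unfolding L2_norm_def L2_inner_def by (simp add: power2_eq_square[symmetric] power2_commute)

lemma L2_norm_diff_power2:
  assumes "u \<in> L2 \<Omega>" "w \<in> L2 \<Omega>"
  shows "(L2_norm \<Omega> (\<lambda>x. u x - c * w x))\<^sup>2 = (L2_norm \<Omega> u)\<^sup>2 - 2 * c * L2_inner \<Omega> u w + c\<^sup>2 * (L2_norm \<Omega> w)\<^sup>2"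
proof -
  have "L2_inner \<Omega> (\<lambda>x. u x - c * w x) z = L2_inner \<Omega> u z - c * L2_inner \<Omega> w z" if "z \<in> L2 \<Omega>" for z
    using L2_inner_diff_left[OF assms(1) L2_cmult[OF assms(2)] that] by (simp only: L2_inner_cmult_left)
  note expand = this
  define d where "d = (\<lambda>x. u x - c * w x)"
  have d: "d \<in> L2 \<Omega>" unfolding d_def by (intro L2_diff L2_cmult assms)
  have "L2_inner \<Omega> d d = L2_inner \<Omega> u d - c * L2_inner \<Omega> w d"
    using expand[OF d] unfolding d_def .
  moreover have "L2_inner \<Omega> u d = L2_inner \<Omega> u u - c * L2_inner \<Omega> u w"
    unfolding L2_inner_commute[of \<Omega> u d] using expand[OF assms(1)]
    unfolding d_def L2_inner_commute[of \<Omega> w u] .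
  moreover have "L2_inner \<Omega> w d = L2_inner \<Omega> u w - c * L2_inner \<Omega> w w"
    unfolding L2_inner_commute[of \<Omega> w d] using expand[OF assms(2)] unfolding d_def .
  ultimately have "L2_inner \<Omega> d d = L2_inner \<Omega> u u - 2 * c * L2_inner \<Omega> u w + c\<^sup>2 * L2_inner \<Omega> w w"
    by (simp add: right_diff_distrib power2_eq_square)
  then show ?thesis unfolding L2_norm_power2 d_def .
qed

lemma L2_Cauchy_Schwarz:
  assumes u: "u \<in> L2 \<Omega>" and w: "w \<in> L2 \<Omega>"
  shows "\<bar>L2_inner \<Omega> u w\<bar> \<le> L2_norm \<Omega> u * L2_norm \<Omega> w"
proof -
  define a b c where "a = (L2_norm \<Omega> u)\<^sup>2" and "b = L2_inner \<Omega> u w" and "c = (L2_norm \<Omega> w)\<^sup>2"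
  have q: "0 \<le> a - 2 * s * b + s\<^sup>2 * c" for s
    using L2_norm_diff_power2[OF u w, of s] zero_le_power2[of "L2_norm \<Omega> (\<lambda>x. u x - s * w x)"]
    unfolding a_def b_def c_def by simp
  have ac: "0 \<le> a" "0 \<le> c" by (auto simp: a_def c_def)
  have "b\<^sup>2 \<le> a * c"
  proof (cases "c = 0")
    case True
    have "b = 0"
    proof (rule ccontr)
      assume "b \<noteq> 0"
      \<comment> \<open>For \<open>c = 0\<close> the quadratic is affine in \<open>s\<close>, and
        this choice of \<open>s\<close> gives it the value -1.\<close>
      with q[of "(a + 1) / (2 * b)"] True show False by simp
    qed
    then show ?thesis using True by simp
  next
    case False
    have "s * c = b \<Longrightarrow> a - 2 * s * b + s\<^sup>2 * c = a - s * b" for s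
      by (simp add: power2_eq_square)
    from this[of "b / c"] q[of "b / c"] False have "0 \<le> a - b / c * b" by simp
    then show ?thesis using False ac by (simp add: field_simps power2_eq_square)
  qed
  then have "\<bar>b\<bar>\<^sup>2 \<le> (L2_norm \<Omega> u * L2_norm \<Omega> w)\<^sup>2" by (simp add: a_def c_def power_mult_distrib)
  then show ?thesis unfolding b_def by (rule power2_le_imp_le) simp
qed

lemma L2_norm_triangle:
  assumes u: "u \<in> L2 \<Omega>" and w: "w \<in> L2 \<Omega>"
  shows "L2_norm \<Omega> (\<lambda>x. u x + w x) \<le> L2_norm \<Omega> u + L2_norm \<Omega> w"
proof (rule power2_le_imp_le)
  have "(L2_norm \<Omega> (\<lambda>x. u x + w x))\<^sup>2 = (L2_norm \<Omega> u)\<^sup>2 + 2 * L2_inner \<Omega> u w + (L2_norm \<Omega> w)\<^sup>2"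
    using L2_norm_diff_power2[OF u w, of "-1"] by simp
  also have "\<dots> \<le> (L2_norm \<Omega> u + L2_norm \<Omega> w)\<^sup>2"
    using L2_Cauchy_Schwarz[OF u w] by (simp add: power2_sum)
  finally show "(L2_norm \<Omega> (\<lambda>x. u x + w x))\<^sup>2 \<le> (L2_norm \<Omega> u + L2_norm \<Omega> w)\<^sup>2" .
qed simp

lemma L2_norm_triangle_diff:
  assumes "u \<in> L2 \<Omega>" "v \<in> L2 \<Omega>" "w \<in> L2 \<Omega>"
  shows "L2_norm \<Omega> (\<lambda>x. u x - w x) \<le> L2_norm \<Omega> (\<lambda>x. u x - v x) + L2_norm \<Omega> (\<lambda>x. v x - w x)"
  using L2_norm_triangle[of "\<lambda>x. u x - v x" \<Omega> "\<lambda>x. v x - w x"] assms by (simp add: L2_diff)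

lemma L2_norm_sum_abs:
  assumes "\<And>k. k \<in> J \<Longrightarrow> u k \<in> L2 \<Omega>" and "finite J"
  shows "(\<lambda>x. \<Sum>k\<in>J. \<bar>u k x\<bar>) \<in> L2 \<Omega>" "L2_norm \<Omega> (\<lambda>x. \<Sum>k\<in>J. \<bar>u k x\<bar>) \<le> (\<Sum>k\<in>J. L2_norm \<Omega> (u k))"
proof -
  have abs: "(\<lambda>x. \<bar>w x\<bar>) \<in> L2 \<Omega>" "L2_norm \<Omega> (\<lambda>x. \<bar>w x\<bar>) = L2_norm \<Omega> w" if "w \<in> L2 \<Omega>" for w
    using that L2D[OF that] by (auto simp: L2_def L2_norm_def L2_inner_def)
  have "(\<lambda>x. \<Sum>k\<in>J. \<bar>u k x\<bar>) \<in> L2 \<Omega> \<and> L2_norm \<Omega> (\<lambda>x. \<Sum>k\<in>J. \<bar>u k x\<bar>) \<le> (\<Sum>k\<in>J. L2_norm \<Omega> (u k))"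
    using assms(2,1)
  proof (induction J)
    case empty show ?case by (simp add: L2_norm_def L2_inner_def)
  next
    case (insert k J)
    then show ?case
      using L2_norm_triangle[of "\<lambda>x. \<bar>u k x\<bar>" \<Omega> "\<lambda>x. \<Sum>k\<in>J. \<bar>u k x\<bar>"] abs[of "u k"] by auto
  qed
  then show "(\<lambda>x. \<Sum>k\<in>J. \<bar>u k x\<bar>) \<in> L2 \<Omega>" "L2_norm \<Omega> (\<lambda>x. \<Sum>k\<in>J. \<bar>u k x\<bar>) \<le> (\<Sum>k\<in>J. L2_norm \<Omega> (u k))"
    by auto
qed

lemma nn_integral_L2_norm:
  assumes "w \<in> L2 \<Omega>"
  shows "(\<integral>\<^sup>+x. ennreal ((w x)\<^sup>2) \<partial>lebesgue_on \<Omega>) = ennreal ((L2_norm \<Omega> w)\<^sup>2)"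
  using assms unfolding L2_norm_power2 L2_inner_def
  by (subst nn_integral_eq_integral) (auto simp: L2_def power2_eq_square)

lemma nn_integral_L2_le:
  assumes [measurable]: "w \<in> borel_measurable (lebesgue_on \<Omega>)" and B: "0 \<le> B"
    and le: "(\<integral>\<^sup>+x. ennreal ((w x)\<^sup>2) \<partial>lebesgue_on \<Omega>) \<le> ennreal (B\<^sup>2)"
  shows "w \<in> L2 \<Omega>" "L2_norm \<Omega> w \<le> B"
proof -
  have "integrable (lebesgue_on \<Omega>) (\<lambda>x. (w x)\<^sup>2)"
    using le by (intro integrableI_bounded) (auto intro: le_less_trans)
  then show w: "w \<in> L2 \<Omega>" by (simp add: L2_def)
  have "(L2_norm \<Omega> w)\<^sup>2 \<le> B\<^sup>2" using le unfolding nn_integral_L2_norm[OF w] by simp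
  then show "L2_norm \<Omega> w \<le> B" using B by (rule power2_le_imp_le)
qed

text \<open>The classical argument: a subsequence with geometrically small increments has an
  integrable square majorant, hence converges almost everywhere, and Fatou's lemma turns the
  pointwise limit into a limit in norm of the full sequence.\<close>

lemma L2_complete:
  fixes S :: "nat \<Rightarrow> real^'d \<Rightarrow> real"
  assumes S: "\<And>n. S n \<in> L2 \<Omega>"
    and Cauchy: "\<And>e. 0 < e \<Longrightarrow> \<exists>N. \<forall>m\<ge>N. \<forall>n\<ge>N. L2_norm \<Omega> (\<lambda>x. S m x - S n x) < e"
  obtains u where "u \<in> L2 \<Omega>" "(\<lambda>n. L2_norm \<Omega> (\<lambda>x. S n x - u x)) \<longlonglongrightarrow> 0"
proof -
  let ?M = "lebesgue_on \<Omega>"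
  have [measurable]: "S n \<in> borel_measurable ?M" for n using S L2D by auto
  have "\<exists>N. \<forall>m\<ge>N. \<forall>n\<ge>N. L2_norm \<Omega> (\<lambda>x. S m x - S n x) < (1/2) ^ k" for k
    by (rule Cauchy) simp
  then obtain N where N: "\<And>k m n. N k \<le> m \<Longrightarrow> N k \<le> n \<Longrightarrow> L2_norm \<Omega> (\<lambda>x. S m x - S n x) < (1/2) ^ k"
    by metis
  \<comment> \<open>Partial sums of \<open>N\<close> instead of \<open>N\<close> itself, so that
    \<open>r l\<close> is beyond every threshold \<open>N k\<close> with
    \<open>k \<le> l\<close>.\<close>
  define r where "r = (\<lambda>k. \<Sum>i\<le>k. N i)"
  have r: "N k \<le> r l" if "k \<le> l" for k l
    unfolding r_def using that by (intro member_le_sum) auto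
  define D where "D = (\<lambda>k x. S (r (Suc k)) x - S (r k) x)"
  have D: "D k \<in> L2 \<Omega>" "L2_norm \<Omega> (D k) \<le> (1/2) ^ k" for k
    unfolding D_def using S N[of k "r (Suc k)" "r k"] r by (auto simp: less_imp_le)
  have [measurable]: "D k \<in> borel_measurable ?M" for k using D L2D by auto
  define G where "G = (\<lambda>n x. \<Sum>k<n. \<bar>D k x\<bar>)"
  have [measurable]: "G n \<in> borel_measurable ?M" for n unfolding G_def by measurable
  have "L2_norm \<Omega> (G n) \<le> 2" for n
  proof -
    have "L2_norm \<Omega> (G n) \<le> (\<Sum>k<n. L2_norm \<Omega> (D k))"
      unfolding G_def by (rule L2_norm_sum_abs) (use D in auto)
    also have "\<dots> \<le> (\<Sum>k<n. (1/2) ^ k)" by (intro sum_mono D)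
    also have "\<dots> \<le> 2" by (simp add: geometric_sum)
    finally show ?thesis .
  qed
  note G_le = this
  have G2: "(\<integral>\<^sup>+x. ennreal ((G n x)\<^sup>2) \<partial>?M) \<le> ennreal 4" for n
  proof -
    have "G n \<in> L2 \<Omega>" unfolding G_def by (rule L2_norm_sum_abs(1)) (use D in auto)
    then have "(\<integral>\<^sup>+x. ennreal ((G n x)\<^sup>2) \<partial>?M) = ennreal ((L2_norm \<Omega> (G n))\<^sup>2)"
      by (rule nn_integral_L2_norm)
    also have "\<dots> \<le> ennreal 4"
      by (intro ennreal_leI) (use power_mono[OF G_le, of n 2] in simp)
    finally show ?thesis .
  qed
  have "(\<integral>\<^sup>+x. (SUP n. ennreal ((G n x)\<^sup>2)) \<partial>?M) = (SUP n. \<integral>\<^sup>+x. ennreal ((G n x)\<^sup>2) \<partial>?M)"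
  proof (rule nn_integral_monotone_convergence_SUP)
    show "incseq (\<lambda>n x. ennreal ((G n x)\<^sup>2))"
      unfolding incseq_def le_fun_def G_def
      by (intro allI impI ennreal_leI power_mono sum_mono2 sum_nonneg) auto
  qed measurable
  also have "\<dots> \<le> ennreal 4" by (intro SUP_least G2)
  finally have "(\<integral>\<^sup>+x. (SUP n. ennreal ((G n x)\<^sup>2)) \<partial>?M) \<noteq> \<infinity>" by (auto simp: top_unique)
  then have "AE x in ?M. (SUP n. ennreal ((G n x)\<^sup>2)) \<noteq> \<infinity>"
    by (intro nn_integral_PInf_AE) measurable
  then have conv: "AE x in ?M. convergent (\<lambda>k. S (r k) x)"
  proof eventually_elim
    case (elim x)
    then obtain c where c: "0 \<le> c" "(SUP n. ennreal ((G n x)\<^sup>2)) = ennreal c"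
      by (metis ennreal_cases infinity_ennreal_def)
    have "ennreal ((G n x)\<^sup>2) \<le> ennreal c" for n unfolding c(2)[symmetric] by (intro SUP_upper) simp
    then have "(G n x)\<^sup>2 \<le> c" for n using c(1) by simp
    then have "G (Suc n) x \<le> sqrt c" for n by (intro real_le_rsqrt)
    then have "summable (\<lambda>k. \<bar>D k x\<bar>)"
      unfolding G_def lessThan_Suc_atMost by (intro bounded_imp_summable[of _ "sqrt c"]) auto
    then have "summable (\<lambda>k. D k x)" by (rule summable_rabs_cancel)
    then have "convergent (\<lambda>n. \<Sum>k<n. D k x)" by (simp add: summable_iff_convergent)
    moreover have "(\<Sum>k<n. D k x) = S (r n) x - S (r 0) x" for n
      unfolding D_def by (rule sum_lessThan_telescope)
    ultimately have "convergent (\<lambda>n. S (r n) x - S (r 0) x)" by simp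
    then show ?case using convergent_add_const_right_iff[of "\<lambda>n. S (r n) x" "- S (r 0) x"] by simp
  qed
  define u where "u = (\<lambda>x. lim (\<lambda>k. S (r k) x))"
  have [measurable]: "u \<in> borel_measurable ?M" unfolding u_def by measurable
  have lim: "AE x in ?M. (\<lambda>k. S (r k) x) \<longlonglongrightarrow> u x"
    using conv by eventually_elim (simp add: u_def convergent_LIMSEQ_iff)
  have close: "(\<integral>\<^sup>+x. ennreal ((S n x - u x)\<^sup>2) \<partial>?M) \<le> ennreal (((1/2) ^ K)\<^sup>2)" if n: "N K \<le> n" for n K
  proof -
    have "(\<integral>\<^sup>+x. ennreal ((S n x - u x)\<^sup>2) \<partial>?M) = (\<integral>\<^sup>+x. liminf (\<lambda>k. ennreal ((S n x - S (r k) x)\<^sup>2)) \<partial>?M)"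
    proof (intro nn_integral_cong_AE)
      show "AE x in ?M. ennreal ((S n x - u x)\<^sup>2) = liminf (\<lambda>k. ennreal ((S n x - S (r k) x)\<^sup>2))"
        using lim
      proof eventually_elim
        case (elim x)
        have "(\<lambda>k. ennreal ((S n x - S (r k) x)\<^sup>2)) \<longlonglongrightarrow> ennreal ((S n x - u x)\<^sup>2)"
          using elim by (intro tendsto_intros tendsto_ennrealI)
        then show ?case by (intro lim_imp_Liminf[symmetric]) auto
      qed
    qed
    also have "\<dots> \<le> liminf (\<lambda>k. \<integral>\<^sup>+x. ennreal ((S n x - S (r k) x)\<^sup>2) \<partial>?M)"
      by (rule nn_integral_liminf) measurable
    also have "\<dots> \<le> limsup (\<lambda>k. \<integral>\<^sup>+x. ennreal ((S n x - S (r k) x)\<^sup>2) \<partial>?M)"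
      by (rule Liminf_le_Limsup) simp
    also have "\<dots> \<le> ennreal (((1/2) ^ K)\<^sup>2)"
    proof (rule Limsup_bounded)
      show "\<forall>\<^sub>F k in sequentially. (\<integral>\<^sup>+x. ennreal ((S n x - S (r k) x)\<^sup>2) \<partial>?M) \<le> ennreal (((1/2) ^ K)\<^sup>2)"
        using eventually_ge_at_top[of K]
      proof eventually_elim
        case (elim k)
        have "L2_norm \<Omega> (\<lambda>x. S n x - S (r k) x) \<le> (1/2) ^ K"
          using N[of K n "r k"] n r[OF elim] by simp
        then have "(L2_norm \<Omega> (\<lambda>x. S n x - S (r k) x))\<^sup>2 \<le> ((1/2) ^ K)\<^sup>2" by (intro power_mono) auto
        then show ?case using nn_integral_L2_norm[OF L2_diff[OF S S], of n "r k"] by (simp add: ennreal_leI)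
      qed
    qed
    finally show ?thesis .
  qed
  have Su: "(\<lambda>x. S n x - u x) \<in> L2 \<Omega>" "L2_norm \<Omega> (\<lambda>x. S n x - u x) \<le> (1/2) ^ K" if "N K \<le> n" for n K
    using nn_integral_L2_le[OF _ _ close[OF that]] by auto
  show ?thesis
  proof
    have "(\<lambda>x. S (N 0) x - (S (N 0) x - u x)) \<in> L2 \<Omega>"
      by (rule L2_diff[OF S Su(1)[OF order_refl]])
    then show "u \<in> L2 \<Omega>" by simp
    show "(\<lambda>n. L2_norm \<Omega> (\<lambda>x. S n x - u x)) \<longlonglongrightarrow> 0"
    proof (rule LIMSEQ_I)
      fix e :: real assume "0 < e"
      then obtain K where K: "(1/2) ^ K < e" using real_arch_pow_inv[of e "1/2"] by auto
      show "\<exists>n0. \<forall>n\<ge>n0. norm (L2_norm \<Omega> (\<lambda>x. S n x - u x) - 0) < e"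
        using Su(2)[of K] K by (intro exI[of _ "N K"]) fastforce
    qed
  qed
qed

section \<open>Orthonormal bases of L2\<close>

text \<open>Since elements are representatives, totality can only yield norm zero. Uniqueness
  statements accordingly take the form
  \<open>L2_norm \<Omega> (\<lambda>x. u x - w x) = 0\<close>.\<close>

locale L2_basis =
  fixes \<Omega> :: "(real^'d) set" and \<phi> :: "nat \<Rightarrow> real^'d \<Rightarrow> real"
  assumes \<phi>_L2 [simp]: "\<phi> j \<in> L2 \<Omega>"
    and orthonormal: "L2_inner \<Omega> (\<phi> i) (\<phi> j) = (if i = j then 1 else 0)"
    and total: "w \<in> L2 \<Omega> \<Longrightarrow> (\<And>j. L2_inner \<Omega> w (\<phi> j) = 0) \<Longrightarrow> L2_norm \<Omega> w = 0"
begin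

definition coef :: "(real^'d \<Rightarrow> real) \<Rightarrow> nat \<Rightarrow> real" where
  "coef w j = L2_inner \<Omega> w (\<phi> j)"

lemma coef_diff: "u \<in> L2 \<Omega> \<Longrightarrow> w \<in> L2 \<Omega> \<Longrightarrow> coef (\<lambda>x. u x - w x) j = coef u j - coef w j"
  by (simp add: coef_def L2_inner_diff_left)

lemma coef_add: "u \<in> L2 \<Omega> \<Longrightarrow> w \<in> L2 \<Omega> \<Longrightarrow> coef (\<lambda>x. u x + w x) j = coef u j + coef w j"
  by (simp add: coef_def L2_inner_add_left)

lemma coef_divide: "coef (\<lambda>x. u x / c) j = coef u j / c"
  by (simp add: coef_def L2_inner_divide_left)

lemma L2_lincomb [simp]: "(\<lambda>x. \<Sum>j\<in>J. a j * \<phi> j x) \<in> L2 \<Omega>"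
  by (intro L2_sum L2_cmult) simp

lemma inner_lincomb: "w \<in> L2 \<Omega> \<Longrightarrow> L2_inner \<Omega> (\<lambda>x. \<Sum>j\<in>J. a j * \<phi> j x) w = (\<Sum>j\<in>J. a j * coef w j)"
  by (subst L2_inner_sum_left) (auto simp: coef_def L2_inner_cmult_left L2_inner_commute[of \<Omega> w])

lemma coef_lincomb: "finite J \<Longrightarrow> coef (\<lambda>x. \<Sum>j\<in>J. a j * \<phi> j x) i = (if i \<in> J then a i else 0)"
  unfolding coef_def by (subst inner_lincomb) (auto simp: coef_def orthonormal if_distrib cong: if_cong)

lemma norm_lincomb: "finite J \<Longrightarrow> (L2_norm \<Omega> (\<lambda>x. \<Sum>j\<in>J. a j * \<phi> j x))\<^sup>2 = (\<Sum>j\<in>J. (a j)\<^sup>2)"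
  unfolding L2_norm_power2
  by (subst inner_lincomb) (auto simp: coef_lincomb power2_eq_square)

lemma bessel:
  assumes w: "w \<in> L2 \<Omega>" and J: "finite J"
  shows "(\<Sum>j\<in>J. (coef w j)\<^sup>2) \<le> (L2_norm \<Omega> w)\<^sup>2"
proof -
  let ?p = "\<lambda>x. \<Sum>j\<in>J. coef w j * \<phi> j x"
  have "0 \<le> (L2_norm \<Omega> (\<lambda>x. w x - 1 * ?p x))\<^sup>2" by simp
  also have "\<dots> = (L2_norm \<Omega> w)\<^sup>2 - 2 * L2_inner \<Omega> ?p w + (L2_norm \<Omega> ?p)\<^sup>2"
    using L2_norm_diff_power2[OF w, of ?p 1] by (simp add: L2_inner_commute)
  also have "\<dots> = (L2_norm \<Omega> w)\<^sup>2 - (\<Sum>j\<in>J. (coef w j)\<^sup>2)"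
    using inner_lincomb[OF w, of "coef w" J] norm_lincomb[OF J, of "coef w"] by (simp add: power2_eq_square)
  finally show ?thesis by simp
qed

lemma summable_coef: "w \<in> L2 \<Omega> \<Longrightarrow> summable (\<lambda>j. (coef w j)\<^sup>2)"
  using bessel[of w "{..n}" for n] by (intro bounded_imp_summable[of _ "(L2_norm \<Omega> w)\<^sup>2"]) auto

lemma riesz_fischer:
  assumes a: "summable (\<lambda>j. (a j)\<^sup>2)"
  obtains u where "u \<in> L2 \<Omega>" "(\<lambda>n. L2_norm \<Omega> (\<lambda>x. (\<Sum>j<n. a j * \<phi> j x) - u x)) \<longlonglongrightarrow> 0"
proof (rule L2_complete)
  fix n show "(\<lambda>x. \<Sum>j<n. a j * \<phi> j x) \<in> L2 \<Omega>" by simp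
next
  fix e :: real assume e: "0 < e"
  then obtain N where N: "\<And>m n. N \<le> m \<Longrightarrow> norm (\<Sum>j=m..<n. (a j)\<^sup>2) < e\<^sup>2"
    using a[unfolded summable_Cauchy, rule_format, of "e\<^sup>2"] by auto
  have *: "L2_norm \<Omega> (\<lambda>x. (\<Sum>j<n. a j * \<phi> j x) - (\<Sum>j<m. a j * \<phi> j x)) < e" if "N \<le> m" "m \<le> n" for m n
  proof (rule power2_less_imp_less)
    have "(\<Sum>j<n. a j * \<phi> j x) - (\<Sum>j<m. a j * \<phi> j x) = (\<Sum>j=m..<n. a j * \<phi> j x)" for x
      using sum_diff_nat_ivl[of 0 m n "\<lambda>j. a j * \<phi> j x"] that by (simp add: atLeast0LessThan)
    then show "(L2_norm \<Omega> (\<lambda>x. (\<Sum>j<n. a j * \<phi> j x) - (\<Sum>j<m. a j * \<phi> j x)))\<^sup>2 < e\<^sup>2"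
      using N[OF that(1), of n] norm_lincomb[of "{m..<n}" a] by (simp add: sum_nonneg)
  qed (use e in simp)
  show "\<exists>N. \<forall>m\<ge>N. \<forall>n\<ge>N. L2_norm \<Omega> (\<lambda>x. (\<Sum>j<m. a j * \<phi> j x) - (\<Sum>j<n. a j * \<phi> j x)) < e"
  proof (intro exI[of _ N] allI impI)
    fix m n assume "N \<le> m" "N \<le> n"
    then show "L2_norm \<Omega> (\<lambda>x. (\<Sum>j<m. a j * \<phi> j x) - (\<Sum>j<n. a j * \<phi> j x)) < e"
      using *[of m n] *[of n m] L2_norm_minus_commute[of \<Omega> "\<lambda>x. \<Sum>j<m. a j * \<phi> j x" "\<lambda>x. \<Sum>j<n. a j * \<phi> j x"]
      by (cases "m \<le> n") auto
  qed
qed (use that in blast)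

lemma inner_limit:
  assumes S: "\<And>n. S n \<in> L2 \<Omega>" and u: "u \<in> L2 \<Omega>" and w: "w \<in> L2 \<Omega>"
    and lim: "(\<lambda>n. L2_norm \<Omega> (\<lambda>x. S n x - u x)) \<longlonglongrightarrow> 0"
  shows "(\<lambda>n. L2_inner \<Omega> (S n) w) \<longlonglongrightarrow> L2_inner \<Omega> u w"
proof (rule LIM_zero_cancel, rule Lim_null_comparison)
  show "\<forall>\<^sub>F n in sequentially. norm (L2_inner \<Omega> (S n) w - L2_inner \<Omega> u w) \<le> L2_norm \<Omega> (\<lambda>x. S n x - u x) * L2_norm \<Omega> w"
    using L2_Cauchy_Schwarz[OF L2_diff[OF S u] w] by (simp add: L2_inner_diff_left S u w)
  show "(\<lambda>n. L2_norm \<Omega> (\<lambda>x. S n x - u x) * L2_norm \<Omega> w) \<longlonglongrightarrow> 0"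
    using lim by (rule tendsto_mult_left_zero)
qed

lemma coef_limit:
  assumes u: "u \<in> L2 \<Omega>" and lim: "(\<lambda>n. L2_norm \<Omega> (\<lambda>x. (\<Sum>j<n. a j * \<phi> j x) - u x)) \<longlonglongrightarrow> 0"
  shows "coef u i = a i"
proof -
  have "(\<lambda>n. coef (\<lambda>x. \<Sum>j<n. a j * \<phi> j x) i) \<longlonglongrightarrow> coef u i"
    unfolding coef_def by (rule inner_limit[OF _ u _ lim]) auto
  moreover have "\<forall>\<^sub>F n in sequentially. coef (\<lambda>x. \<Sum>j<n. a j * \<phi> j x) i = a i"
    using eventually_gt_at_top[of i] by eventually_elim (simp add: coef_lincomb)
  ultimately show ?thesis by (rule LIMSEQ_unique[OF _ tendsto_eventually])
qed

lemma coef_eq_norm_diff: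
  assumes "u \<in> L2 \<Omega>" "w \<in> L2 \<Omega>" "\<And>j. coef u j = coef w j"
  shows "L2_norm \<Omega> (\<lambda>x. u x - w x) = 0"
proof (rule total)
  show "(\<lambda>x. u x - w x) \<in> L2 \<Omega>" by (intro L2_diff assms)
  show "L2_inner \<Omega> (\<lambda>x. u x - w x) (\<phi> j) = 0" for j
    using coef_diff[OF assms(1,2), of j] assms(3)[of j] by (simp only: coef_def)
qed

text \<open>The Riesz-Fischer limit \<open>u\<close> of the partial sums has the same coefficients
  as \<open>w\<close>, so totality puts it at distance zero from \<open>w\<close>.\<close>

lemma expansion:
  assumes w: "w \<in> L2 \<Omega>"
  shows "(\<lambda>n. L2_norm \<Omega> (\<lambda>x. (\<Sum>j<n. coef w j * \<phi> j x) - w x)) \<longlonglongrightarrow> 0"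
proof -
  let ?S = "\<lambda>n x. \<Sum>j<n. coef w j * \<phi> j x"
  obtain u where u: "u \<in> L2 \<Omega>" "(\<lambda>n. L2_norm \<Omega> (\<lambda>x. ?S n x - u x)) \<longlonglongrightarrow> 0"
    by (rule riesz_fischer[OF summable_coef[OF w]])
  have 0: "L2_norm \<Omega> (\<lambda>x. u x - w x) = 0"
    using coef_limit[OF u] by (intro coef_eq_norm_diff u w)
  show ?thesis
  proof (rule Lim_null_comparison[OF _ u(2)])
    show "\<forall>\<^sub>F n in sequentially. norm (L2_norm \<Omega> (\<lambda>x. ?S n x - w x))
       \<le> L2_norm \<Omega> (\<lambda>x. ?S n x - u x)"
    proof (intro always_eventually allI)
      fix n
      show "norm (L2_norm \<Omega> (\<lambda>x. ?S n x - w x))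
         \<le> L2_norm \<Omega> (\<lambda>x. ?S n x - u x)"
        using L2_norm_triangle_diff[OF L2_lincomb[of "coef w" "{..<n}"] u(1) w] 0 by simp
    qed
  qed
qed

lemma inner_sums:
  assumes u: "u \<in> L2 \<Omega>" and w: "w \<in> L2 \<Omega>"
  shows "(\<lambda>j. coef u j * coef w j) sums L2_inner \<Omega> u w"
proof -
  have "(\<lambda>n. L2_inner \<Omega> (\<lambda>x. \<Sum>j<n. coef u j * \<phi> j x) w) \<longlonglongrightarrow> L2_inner \<Omega> u w"
    by (rule inner_limit[OF L2_lincomb u w expansion[OF u]])
  then show ?thesis unfolding inner_lincomb[OF w] sums_def .
qed

lemma parseval: "w \<in> L2 \<Omega> \<Longrightarrow> (\<lambda>j. (coef w j)\<^sup>2) sums (L2_norm \<Omega> w)\<^sup>2"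
  unfolding L2_norm_power2 using inner_sums[of w w] by (simp add: power2_eq_square)

text \<open>The inverse of \<open>coef\<close>, up to null sets, on square-summable sequences;
  elsewhere the choice is arbitrary.\<close>

definition synth :: "(nat \<Rightarrow> real) \<Rightarrow> real^'d \<Rightarrow> real" where
  "synth a = (SOME u. u \<in> L2 \<Omega> \<and> (\<forall>j. coef u j = a j))"

lemma synth:
  assumes "summable (\<lambda>j. (a j)\<^sup>2)"
  shows "synth a \<in> L2 \<Omega>" "coef (synth a) j = a j"
proof -
  obtain u where "u \<in> L2 \<Omega>" "(\<lambda>n. L2_norm \<Omega> (\<lambda>x. (\<Sum>j<n. a j * \<phi> j x) - u x)) \<longlonglongrightarrow> 0"
    by (rule riesz_fischer[OF assms])
  then have "\<exists>u. u \<in> L2 \<Omega> \<and> (\<forall>j. coef u j = a j)"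
    using coef_limit[of u a] by blast
  from someI_ex[OF this, folded synth_def] show "synth a \<in> L2 \<Omega>" "coef (synth a) j = a j" by auto
qed

lemma norm_le_of_coef:
  assumes w: "w \<in> L2 \<Omega>" and B: "0 \<le> B" "\<And>n. (\<Sum>j<n. (coef w j)\<^sup>2) \<le> B\<^sup>2"
  shows "L2_norm \<Omega> w \<le> B"
proof (rule power2_le_imp_le[OF _ B(1)])
  show "(L2_norm \<Omega> w)\<^sup>2 \<le> B\<^sup>2"
    using parseval[OF w] unfolding sums_def by (rule LIMSEQ_le_const2) (use B in auto)
qed

end

section \<open>The Dirichlet Laplacian in terms of Fourier coefficients\<close>

lemma test_function_pdiff:
  assumes "test_function \<Omega> \<psi>" shows "test_function \<Omega> (pdiff i \<psi>)"
proof -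
  let ?S = "closure {x. \<psi> x \<noteq> 0}"
  have sm: "\<And>k. Ck_on k UNIV \<psi>" and S: "compact ?S" "?S \<subseteq> \<Omega>"
    using assms by (auto simp: test_function_def smooth_on_def)
  have "Ck_on k UNIV (pdiff i \<psi>)" for k
    using sm[of "Suc k"] by (simp add: pdiff_def[abs_def])
  moreover have "{x. pdiff i \<psi> x \<noteq> 0} \<subseteq> ?S"
  proof (rule ccontr)
    assume "\<not> {x. pdiff i \<psi> x \<noteq> 0} \<subseteq> ?S"
    then obtain x where x: "pdiff i \<psi> x \<noteq> 0" "x \<in> - ?S" by auto
    have "(\<psi> has_derivative (\<lambda>_. 0)) (at x)"
    proof (rule has_derivative_transform_within_open)
      show "((\<lambda>_. 0) has_derivative (\<lambda>_. 0)) (at x)" by simp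
      show "open (- ?S)" "x \<in> - ?S" using x by auto
      show "0 = \<psi> y" if "y \<in> - ?S" for y using that closure_subset[of "{x. \<psi> x \<noteq> 0}"] by auto
    qed
    then have "frechet_derivative \<psi> (at x) = (\<lambda>_. 0)" by (metis frechet_derivative_at)
    with x show False by (simp add: pdiff_def)
  qed
  then have "closure {x. pdiff i \<psi> x \<noteq> 0} \<subseteq> ?S" by (intro closure_minimal) auto
  moreover from this have "compact (closure {x. pdiff i \<psi> x \<noteq> 0})"
    using S by (meson bounded_subset closed_closure compact_eq_bounded_closed)
  ultimately show ?thesis using S by (auto simp: test_function_def smooth_on_def)
qed

lemma test_function_L2:
  assumes \<Omega>: "open \<Omega>" "bounded \<Omega>" and \<psi>: "test_function \<Omega> \<psi>"
  shows "\<psi> \<in> L2 \<Omega>"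
proof -
  let ?S = "closure {x. \<psi> x \<noteq> 0}"
  have "Ck_on 0 UNIV \<psi>" and S: "compact ?S"
    using \<psi> unfolding test_function_def smooth_on_def by blast+
  then have cont: "continuous_on UNIV \<psi>" by simp
  have "compact (\<psi> ` ?S)" by (intro compact_continuous_image continuous_on_subset[OF cont] S) auto
  then obtain B where B: "\<And>y. y \<in> \<psi> ` ?S \<Longrightarrow> norm y \<le> B"
    using compact_imp_bounded bounded_iff by metis
  have B': "\<bar>\<psi> x\<bar> \<le> \<bar>B\<bar>" for x
  proof (cases "\<psi> x = 0")
    case False
    then have "x \<in> ?S" using closure_subset[of "{x. \<psi> x \<noteq> 0}"] by auto
    then show ?thesis using B[of "\<psi> x"] by auto
  qed simp
  have lm: "\<Omega> \<in> lmeasurable" using \<Omega> by (simp add: lmeasurable_open)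
  have meas: "\<psi> \<in> borel_measurable (lebesgue_on \<Omega>)"
    by (rule continuous_imp_measurable_on_sets_lebesgue) (use cont lm in \<open>auto intro: continuous_on_subset\<close>)
  interpret finite_measure "lebesgue_on \<Omega>"
    by (rule finite_measure_lebesgue_on[OF lm])
  have "integrable (lebesgue_on \<Omega>) (\<lambda>x. (\<psi> x)\<^sup>2)"
  proof (rule integrable_const_bound)
    show "AE x in lebesgue_on \<Omega>. norm ((\<psi> x)\<^sup>2) \<le> \<bar>B\<bar>\<^sup>2"
      using power_mono[OF B', of _ 2] by (intro always_eventually allI) (simp only: real_norm_def abs_power2 power2_abs abs_ge_zero)
    show "(\<lambda>x. (\<psi> x)\<^sup>2) \<in> borel_measurable (lebesgue_on \<Omega>)" by (rule borel_measurable_power[OF meas])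
  qed
  with meas show ?thesis by (simp add: L2_def)
qed

text \<open>Only pairings with elements of \<^const>\<open>H10\<close> are compared, so density of the test functions
  in L2 is not needed.\<close>

lemma has_laplacian_unique:
  assumes g: "has_laplacian \<Omega> w g" and h: "has_laplacian \<Omega> w h" and p: "p \<in> H10 \<Omega>"
    and \<Omega>: "open \<Omega>" "bounded \<Omega>"
  shows "L2_inner \<Omega> g p = L2_inner \<Omega> h p"
proof -
  let ?d = "\<lambda>x. g x - h x"
  obtain \<psi> where \<psi>: "\<And>n::nat. test_function \<Omega> (\<psi> n)" and lim: "(\<lambda>n. L2_norm \<Omega> (\<lambda>x. \<psi> n x - p x)) \<longlonglongrightarrow> 0"
    and p2: "p \<in> L2 \<Omega>"
    using p unfolding H10_def H1_def by blast
  have gh: "g \<in> L2 \<Omega>" "h \<in> L2 \<Omega>" using g h by (auto simp: has_laplacian_def)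
  have \<psi>2: "\<psi> n \<in> L2 \<Omega>" for n by (rule test_function_L2[OF \<Omega> \<psi>])
  have d: "?d \<in> L2 \<Omega>" by (rule L2_diff[OF gh])
  have "(\<lambda>n. L2_inner \<Omega> (\<lambda>x. \<psi> n x - p x) ?d) \<longlonglongrightarrow> 0"
  proof (rule Lim_null_comparison)
    show "\<forall>\<^sub>F n in sequentially. norm (L2_inner \<Omega> (\<lambda>x. \<psi> n x - p x) ?d)
        \<le> L2_norm \<Omega> (\<lambda>x. \<psi> n x - p x) * L2_norm \<Omega> ?d"
      using L2_Cauchy_Schwarz[OF L2_diff[OF \<psi>2 p2] d] by (intro always_eventually allI) (simp only: real_norm_def)
    show "(\<lambda>n. L2_norm \<Omega> (\<lambda>x. \<psi> n x - p x) * L2_norm \<Omega> ?d) \<longlonglongrightarrow> 0"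
      using lim by (rule tendsto_mult_left_zero)
  qed
  moreover have "L2_inner \<Omega> (\<lambda>x. \<psi> n x - p x) ?d = - L2_inner \<Omega> p ?d" for n
  proof -
    have "L2_inner \<Omega> ?d (\<psi> n) = 0"
      using g h \<psi>[of n] L2_inner_diff_left[OF gh \<psi>2[of n]] by (auto simp: has_laplacian_def)
    then show ?thesis
      using L2_inner_diff_left[OF \<psi>2[of n] p2 d] L2_inner_commute[of \<Omega> "\<psi> n" ?d] by simp
  qed
  ultimately have "L2_inner \<Omega> p ?d = 0" by (simp add: LIMSEQ_const_iff)
  then show ?thesis
    using L2_inner_diff_left[OF gh p2] L2_inner_commute[of \<Omega> p ?d] by simp
qed

locale dirichlet =
  fixes \<Omega> :: "(real^'d) set" and lam :: "nat \<Rightarrow> real" and \<phi> :: "nat \<Rightarrow> real^'d \<Rightarrow> real"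
  assumes \<Omega>: "open \<Omega>" "bounded \<Omega>" and eigen: "dirichlet_eigensystem \<Omega> lam \<phi>"

sublocale dirichlet \<subseteq> L2_basis \<Omega> \<phi>
proof
  show "\<phi> j \<in> L2 \<Omega>" for j using eigen by (auto simp: dirichlet_eigensystem_def H2_def)
  show "L2_inner \<Omega> (\<phi> i) (\<phi> j) = (if i = j then 1 else 0)" for i j
    using eigen by (simp add: dirichlet_eigensystem_def)
  show "L2_norm \<Omega> w = 0" if "w \<in> L2 \<Omega>" "\<And>j. L2_inner \<Omega> w (\<phi> j) = 0" for w
    using eigen that by (simp add: dirichlet_eigensystem_def)
qed

context dirichlet
begin

lemma lam_pos: "0 < lam j" and lam_mono: "i \<le> j \<Longrightarrow> lam i \<le> lam j"
  and lam_at_top: "filterlim lam at_top sequentially"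
  using eigen by (auto simp: dirichlet_eigensystem_def incseq_def)

text \<open>The spectrum is bounded below by \<open>lam 0 > 0\<close>, so higher powers of the
  eigenvalues dominate lower ones up to a constant.\<close>

lemma lam_power_summable_mono:
  assumes "summable (\<lambda>j. (lam j ^ n * a j)\<^sup>2)" "k \<le> n"
  shows "summable (\<lambda>j. (lam j ^ k * a j)\<^sup>2)"
proof (rule summable_comparison_test)
  define c where "c = (1 / lam 0 ^ (n - k))\<^sup>2"
  show "summable (\<lambda>j. c * (lam j ^ n * a j)\<^sup>2)" using assms by (intro summable_mult)
  have "norm ((lam j ^ k * a j)\<^sup>2) \<le> c * (lam j ^ n * a j)\<^sup>2" for j
  proof -
    have "lam 0 ^ (n - k) \<le> lam j ^ (n - k)"
      using lam_pos[of 0] lam_mono[of 0 j] by (intro power_mono) auto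
    then have "1 \<le> 1 / lam 0 ^ (n - k) * lam j ^ (n - k)" using lam_pos[of 0] by (simp add: field_simps)
    then have "1\<^sup>2 \<le> (1 / lam 0 ^ (n - k) * lam j ^ (n - k))\<^sup>2" by (intro power_mono) auto
    then have "1 * (lam j ^ k * a j)\<^sup>2 \<le> (1 / lam 0 ^ (n - k) * lam j ^ (n - k))\<^sup>2 * (lam j ^ k * a j)\<^sup>2"
      by (intro mult_right_mono) auto
    also have "\<dots> = c * (lam j ^ (n - k) * lam j ^ k * a j)\<^sup>2"
      unfolding c_def by (simp only: power_mult_distrib mult_ac)
    also have "lam j ^ (n - k) * lam j ^ k = lam j ^ n"
      using assms(2) by (simp add: power_add[symmetric])
    finally show ?thesis by simp
  qed
  then show "\<exists>N. \<forall>j\<ge>N. norm ((lam j ^ k * a j)\<^sup>2) \<le> c * (lam j ^ n * a j)\<^sup>2" by blast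
qed

text \<open>The distributional equation for the eigenfunction, tested with \<open>\<psi>\<close>,
  already is Green's formula for the pair, so no integration by parts is carried out.\<close>

lemma coef_test_laplacian:
  assumes "test_function \<Omega> \<psi>"
  shows "(\<lambda>x. \<Sum>i\<in>UNIV. pdiff i (pdiff i \<psi>) x) \<in> L2 \<Omega>"
    and "coef (\<lambda>x. \<Sum>i\<in>UNIV. pdiff i (pdiff i \<psi>) x) j = - lam j * coef \<psi> j"
proof -
  show "(\<lambda>x. \<Sum>i\<in>UNIV. pdiff i (pdiff i \<psi>) x) \<in> L2 \<Omega>"
    by (intro L2_sum test_function_L2[OF \<Omega>] test_function_pdiff assms)
  have "has_laplacian \<Omega> (\<phi> j) (\<lambda>x. - lam j * \<phi> j x)"
    using eigen by (simp add: dirichlet_eigensystem_def)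
  then have "L2_inner \<Omega> (\<phi> j) (\<lambda>x. \<Sum>i\<in>UNIV. pdiff i (pdiff i \<psi>) x) = L2_inner \<Omega> (\<lambda>x. - lam j * \<phi> j x) \<psi>"
    using assms unfolding has_laplacian_def by blast
  then show "coef (\<lambda>x. \<Sum>i\<in>UNIV. pdiff i (pdiff i \<psi>) x) j = - lam j * coef \<psi> j"
    unfolding coef_def L2_inner_cmult_left L2_inner_commute[of \<Omega> _ "\<phi> j"] .
qed

lemma has_laplacian_synth:
  assumes w: "w \<in> L2 \<Omega>" and sm: "summable (\<lambda>j. (- lam j * coef w j)\<^sup>2)"
  shows "has_laplacian \<Omega> w (synth (\<lambda>j. - lam j * coef w j))"
  unfolding has_laplacian_def
proof (intro conjI allI impI)
  let ?g = "synth (\<lambda>j. - lam j * coef w j)"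
  show "w \<in> L2 \<Omega>" "?g \<in> L2 \<Omega>" using w synth(1)[OF sm] by auto
  fix \<psi> assume \<psi>: "test_function \<Omega> \<psi>"
  have "(\<lambda>j. coef w j * (- lam j * coef \<psi> j)) sums L2_inner \<Omega> w (\<lambda>x. \<Sum>i\<in>UNIV. pdiff i (pdiff i \<psi>) x)"
    using inner_sums[OF w coef_test_laplacian(1)[OF \<psi>]] unfolding coef_test_laplacian(2)[OF \<psi>] .
  moreover have "(\<lambda>j. coef w j * (- lam j * coef \<psi> j)) sums L2_inner \<Omega> ?g \<psi>"
    using inner_sums[OF synth(1)[OF sm] test_function_L2[OF \<Omega> \<psi>]] unfolding synth(2)[OF sm]
    by (simp add: mult_ac)
  ultimately show "L2_inner \<Omega> w (\<lambda>x. \<Sum>i\<in>UNIV. pdiff i (pdiff i \<psi>) x) = L2_inner \<Omega> ?g \<psi>"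
    by (rule sums_unique2)
qed

text \<open>The synthesized function shows that a Laplacian exists, so \<open>SOME\<close> picks a
  valid one. Its coefficients do not depend on the choice, because the eigenfunctions lie in
  \<open>H10\<close> and pairings with such elements are unique.\<close>

lemma laplacian_coef:
  assumes w: "w \<in> L2 \<Omega>" and sm: "summable (\<lambda>j. (lam j * coef w j)\<^sup>2)"
  shows "laplacian \<Omega> w \<in> L2 \<Omega>" "coef (laplacian \<Omega> w) j = - lam j * coef w j"
proof -
  have sm': "summable (\<lambda>j. (- lam j * coef w j)\<^sup>2)" using sm by simp
  note g = has_laplacian_synth[OF w sm']
  have l: "has_laplacian \<Omega> w (laplacian \<Omega> w)"
    unfolding laplacian_def by (rule someI[of "has_laplacian \<Omega> w", OF g])
  then show "laplacian \<Omega> w \<in> L2 \<Omega>" by (simp add: has_laplacian_def)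
  have "\<phi> j \<in> H10 \<Omega>" using eigen by (auto simp: dirichlet_eigensystem_def)
  from has_laplacian_unique[OF l g this \<Omega>] show "coef (laplacian \<Omega> w) j = - lam j * coef w j"
    using synth(2)[OF sm', of j] unfolding coef_def by simp
qed

lemma laplacian_power_coef:
  assumes w: "w \<in> L2 \<Omega>"
  shows "summable (\<lambda>j. (lam j ^ k * coef w j)\<^sup>2) \<Longrightarrow>
    (laplacian \<Omega> ^^ k) w \<in> L2 \<Omega> \<and> (\<forall>j. coef ((laplacian \<Omega> ^^ k) w) j = (- lam j) ^ k * coef w j)"
proof (induction k)
  case 0 show ?case using w by simp
next
  case (Suc k)
  have IH: "(laplacian \<Omega> ^^ k) w \<in> L2 \<Omega>" "\<And>j. coef ((laplacian \<Omega> ^^ k) w) j = (- lam j) ^ k * coef w j"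
    using Suc.IH[OF lam_power_summable_mono[OF Suc.prems]] by auto
  have "(lam j * coef ((laplacian \<Omega> ^^ k) w) j)\<^sup>2 = (lam j ^ Suc k * coef w j)\<^sup>2" for j
    unfolding IH(2) by (simp add: power_mult_distrib power_mult[symmetric] mult.commute[of 2] power_minus' flip: power_mult)
  then have sm: "summable (\<lambda>j. (lam j * coef ((laplacian \<Omega> ^^ k) w) j)\<^sup>2)"
    using Suc.prems by (simp only:)
  show ?case using laplacian_coef[OF IH(1) sm] IH(2) by simp
qed

lemma Hdot_iff: "w \<in> Hdot \<Omega> lam \<phi> (2 * real k) \<longleftrightarrow> w \<in> L2 \<Omega> \<and> summable (\<lambda>j. (lam j ^ k * coef w j)\<^sup>2)"
  and lam_powr: "lam j powr (2 * real k) * (L2_inner \<Omega> w (\<phi> j))\<^sup>2 = (lam j ^ k * coef w j)\<^sup>2"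
proof -
  have "lam j powr (2 * real k) * (L2_inner \<Omega> w (\<phi> j))\<^sup>2 = (lam j ^ k * coef w j)\<^sup>2" for j
  proof -
    have "lam j powr (2 * real k) = lam j ^ (k * 2)"
      using powr_realpow[OF lam_pos, of j "k * 2"] by (simp add: mult.commute)
    then show ?thesis unfolding power_mult_distrib power_mult coef_def by simp
  qed
  then show "lam j powr (2 * real k) * (L2_inner \<Omega> w (\<phi> j))\<^sup>2 = (lam j ^ k * coef w j)\<^sup>2"
    "w \<in> Hdot \<Omega> lam \<phi> (2 * real k) \<longleftrightarrow> w \<in> L2 \<Omega> \<and> summable (\<lambda>j. (lam j ^ k * coef w j)\<^sup>2)"
    unfolding Hdot_def by auto
qed

lemma power2_minus_lam: "((- lam j) ^ k * a)\<^sup>2 = (lam j ^ k * a)\<^sup>2"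
  by (cases "even k") auto

lemma laplacian_power_leD:
  assumes "laplacian_power_le \<Omega> lam \<phi> k w c"
  shows "w \<in> L2 \<Omega>" "0 \<le> c" "finite J \<Longrightarrow> (\<Sum>j\<in>J. (lam j ^ k * coef w j)\<^sup>2) \<le> c\<^sup>2"
    "summable (\<lambda>j. (lam j ^ k * coef w j)\<^sup>2)"
proof -
  have w: "w \<in> L2 \<Omega>" and sm: "summable (\<lambda>j. (lam j ^ k * coef w j)\<^sup>2)" and c: "L2_norm \<Omega> ((laplacian \<Omega> ^^ k) w) \<le> c"
    using assms by (auto simp: laplacian_power_le_def Hdot_iff)
  show "w \<in> L2 \<Omega>" "summable (\<lambda>j. (lam j ^ k * coef w j)\<^sup>2)" by fact+
  show "0 \<le> c" using c L2_norm_nonneg order_trans by metis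
  note L = laplacian_power_coef[OF w sm]
  show "(\<Sum>j\<in>J. (lam j ^ k * coef w j)\<^sup>2) \<le> c\<^sup>2" if J: "finite J"
  proof -
    have "(\<Sum>j\<in>J. (lam j ^ k * coef w j)\<^sup>2) = (\<Sum>j\<in>J. (coef ((laplacian \<Omega> ^^ k) w) j)\<^sup>2)"
      using L by (simp add: power2_minus_lam)
    also have "\<dots> \<le> (L2_norm \<Omega> ((laplacian \<Omega> ^^ k) w))\<^sup>2" using L J by (intro bessel) auto
    also have "\<dots> \<le> c\<^sup>2" using c by (intro power_mono) auto
    finally show ?thesis .
  qed
qed

text \<open>The weighted sum controls the seminorm by \<open>B\<close> and, since every eigenvalue
  is at least \<open>lam 0\<close>, the L2 norm by \<open>B / lam 0\<close>. This is the origin of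
  the constant.\<close>

lemma Hdot_2_bound:
  assumes w: "w \<in> L2 \<Omega>" and B: "0 \<le> B" "\<And>n. (\<Sum>j<n. (lam j * coef w j)\<^sup>2) \<le> B\<^sup>2"
  shows "w \<in> Hdot \<Omega> lam \<phi> 2" "Hdot_norm \<Omega> lam \<phi> 2 w \<le> (1 + 1 / lam 0) * B"
proof -
  have le: "(\<Sum>j\<le>n. (lam j * coef w j)\<^sup>2) \<le> B\<^sup>2" for n
    using B(2)[of "Suc n"] by (simp only: lessThan_Suc_atMost)
  have sm: "summable (\<lambda>j. (lam j * coef w j)\<^sup>2)"
    by (rule bounded_imp_summable[OF _ le]) simp
  then show "w \<in> Hdot \<Omega> lam \<phi> 2" using Hdot_iff[of w 1] w by simp
  have "L2_norm \<Omega> w \<le> B / lam 0"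
  proof (rule norm_le_of_coef[OF w])
    fix n
    have "(lam 0)\<^sup>2 * (\<Sum>j<n. (coef w j)\<^sup>2) \<le> (\<Sum>j<n. (lam j * coef w j)\<^sup>2)"
      unfolding sum_distrib_left power_mult_distrib
      using lam_pos[of 0] lam_mono[of 0] by (intro sum_mono mult_right_mono power_mono) auto
    also note B(2)
    finally show "(\<Sum>j<n. (coef w j)\<^sup>2) \<le> (B / lam 0)\<^sup>2"
      using lam_pos[of 0] by (simp add: power_divide field_simps)
  qed (use B lam_pos[of 0] in simp)
  then have "(L2_norm \<Omega> w)\<^sup>2 \<le> (B / lam 0)\<^sup>2" by (intro power_mono) auto
  moreover have "(\<Sum>j. (lam j * coef w j)\<^sup>2) \<le> B\<^sup>2"
    using B(2) by (intro suminf_le_const[OF sm]) auto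
  moreover have "(B / lam 0)\<^sup>2 + B\<^sup>2 \<le> ((1 + 1 / lam 0) * B)\<^sup>2"
    using lam_pos[of 0] B(1) by (simp add: distrib_right power2_sum)
  ultimately have "(L2_norm \<Omega> w)\<^sup>2 + (\<Sum>j. (lam j * coef w j)\<^sup>2) \<le> ((1 + 1 / lam 0) * B)\<^sup>2" by linarith
  then show "Hdot_norm \<Omega> lam \<phi> 2 w \<le> (1 + 1 / lam 0) * B"
    unfolding Hdot_norm_def using lam_powr[of _ 1 w] lam_pos[of 0] B(1)
    by (intro real_le_lsqrt) (auto intro!: add_nonneg_nonneg suminf_nonneg sm)
qed

section \<open>Coefficientwise and strong time derivatives\<close>

lemma coef_has_derivative:
  assumes "has_L2_derivative \<Omega> T w g t"
  shows "((\<lambda>s. coef (w s) j) has_real_derivative coef g j) (at t within {0..T})"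
  unfolding has_field_derivative_iff
proof (rule LIM_zero_cancel, rule Lim_null_comparison)
  have g: "g \<in> L2 \<Omega>" "w t \<in> L2 \<Omega>" and ev: "\<forall>\<^sub>F s in at t within {0..T}. w s \<in> L2 \<Omega>"
    and lim: "((\<lambda>s. L2_norm \<Omega> (\<lambda>x. (w s x - w t x) / (s - t) - g x)) \<longlongrightarrow> 0) (at t within {0..T})"
    using assms by (auto simp: has_L2_derivative_def)
  show "((\<lambda>s. L2_norm \<Omega> (\<lambda>x. (w s x - w t x) / (s - t) - g x)) \<longlongrightarrow> 0) (at t within {0..T})" by (rule lim)
  show "\<forall>\<^sub>F s in at t within {0..T}. norm ((coef (w s) j - coef (w t) j) / (s - t) - coef g j)
     \<le> L2_norm \<Omega> (\<lambda>x. (w s x - w t x) / (s - t) - g x)"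
    using ev
  proof eventually_elim
    case (elim s)
    have d: "(\<lambda>x. (w s x - w t x) / (s - t)) \<in> L2 \<Omega>" by (intro L2_divide L2_diff elim g)
    have "coef (\<lambda>x. (w s x - w t x) / (s - t) - g x) j = (coef (w s) j - coef (w t) j) / (s - t) - coef g j"
      unfolding coef_diff[OF d g(1)] coef_divide coef_diff[OF elim g(2)] ..
    moreover have "\<bar>coef (\<lambda>x. (w s x - w t x) / (s - t) - g x) j\<bar> \<le> L2_norm \<Omega> (\<lambda>x. (w s x - w t x) / (s - t) - g x) * L2_norm \<Omega> (\<phi> j)"
      unfolding coef_def by (rule L2_Cauchy_Schwarz[OF L2_diff[OF d g(1)] \<phi>_L2])
    moreover have "L2_norm \<Omega> (\<phi> j) = 1" by (simp add: L2_norm_def orthonormal)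
    ultimately show ?case by simp
  qed
qed

text \<open>The mean value theorem, applied to a linear combination of finitely many coefficients,
  carries the weighted bound over from the derivatives to the difference quotients.\<close>

lemma has_L2_derivative_of_coef:
  assumes t: "t \<in> {0<..T}"
    and w: "\<And>s. s \<in> {0<..T} \<Longrightarrow> w s \<in> L2 \<Omega>" and g: "\<And>s. s \<in> {0<..T} \<Longrightarrow> g s \<in> L2 \<Omega>"
    and der: "\<And>s j. s \<in> {0<..T} \<Longrightarrow> ((\<lambda>s. coef (w s) j) has_real_derivative coef (g s) j) (at s within {0..T})"
    and B: "0 \<le> B" "\<And>s n. s \<in> {t/2..T} \<Longrightarrow> (\<Sum>j<n. (lam j * coef (g s) j)\<^sup>2) \<le> B\<^sup>2"
  shows "has_L2_derivative \<Omega> T w (g t) t"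
proof -
  define R where "R = (\<lambda>s x. (w s x - w t x) / (s - t) - g t x)"
  define q where "q = (\<lambda>s j. (coef (w s) j - coef (w t) j) / (s - t))"
  have ev: "\<forall>\<^sub>F s in at t within {0..T}. s \<in> {t/2..T} \<and> s \<noteq> t"
    unfolding eventually_at using t by (intro exI[of _ "t/2"]) (auto simp: dist_real_def field_simps abs_real_def split: if_splits)
  have q_le: "(\<Sum>j<n. (lam j * q s j)\<^sup>2) \<le> B\<^sup>2" if s: "s \<in> {t/2..T}" "s \<noteq> t" for s n
  proof -
    \<comment> \<open>The weights contain the difference quotients \<open>q s j\<close> at the fixed
      \<open>s\<close>, so that the increment of \<open>h\<close> is \<open>s - t\<close> times the
      sum to be bounded. One intermediate point \<open>\<tau>\<close> then serves all
      \<open>j\<close> at once, and half of the sum is absorbed by the inequality between products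
      and squares.\<close>
    define h where "h = (\<lambda>\<tau>. \<Sum>j<n. (lam j)\<^sup>2 * q s j * coef (w \<tau>) j)"
    define h' where "h' = (\<lambda>\<tau>. \<Sum>j<n. (lam j)\<^sup>2 * q s j * coef (g \<tau>) j)"
    have hd: "(h has_derivative (\<lambda>x. h' \<tau> * x)) (at \<tau> within {a..b})" if "t/2 \<le> a" "b \<le> T" "\<tau> \<in> {a..b}" for \<tau> a b
    proof -
      have "(h has_real_derivative h' \<tau>) (at \<tau> within {a..b})"
        unfolding h_def h'_def
        by (intro DERIV_sum DERIV_cmult has_field_derivative_subset[OF der]) (use that t in auto)
      then show ?thesis by (simp add: has_field_derivative_def)
    qed
    obtain \<tau> where \<tau>: "\<tau> \<in> {t/2..T}" "h s - h t = h' \<tau> * (s - t)"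
    proof (cases "s < t")
      case True
      obtain \<tau> where "\<tau> \<in> {s<..<t}" "h t - h s = h' \<tau> * (t - s)"
        using mvt_simple[OF True, of h "\<lambda>\<tau> x. h' \<tau> * x"] hd[of s t] s t by auto
      then show ?thesis using that[of \<tau>] s t by (auto simp: algebra_simps)
    next
      case False
      then have "t < s" using s by simp
      then obtain \<tau> where "\<tau> \<in> {t<..<s}" "h s - h t = h' \<tau> * (s - t)"
        using mvt_simple[of t s h "\<lambda>\<tau> x. h' \<tau> * x"] hd[of t s] s t by auto
      then show ?thesis using that[of \<tau>] s t by auto
    qed
    have "h s - h t = (s - t) * (\<Sum>j<n. (lam j * q s j)\<^sup>2)"
      unfolding h_def sum_subtractf[symmetric] sum_distrib_left
      using s by (intro sum.cong) (auto simp: q_def field_simps power2_eq_square)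
    with \<tau>(2) s have "(\<Sum>j<n. (lam j * q s j)\<^sup>2) = h' \<tau>" by (simp add: mult.commute)
    also have "\<dots> \<le> (\<Sum>j<n. ((lam j * q s j)\<^sup>2 + (lam j * coef (g \<tau>) j)\<^sup>2) / 2)"
      unfolding h'_def
    proof (intro sum_mono)
      fix j
      show "(lam j)\<^sup>2 * q s j * coef (g \<tau>) j \<le> ((lam j * q s j)\<^sup>2 + (lam j * coef (g \<tau>) j)\<^sup>2) / 2"
        using sum_squares_bound[of "lam j * q s j" "lam j * coef (g \<tau>) j"] by (simp add: power2_eq_square mult_ac)
    qed
    also have "\<dots> = ((\<Sum>j<n. (lam j * q s j)\<^sup>2) + (\<Sum>j<n. (lam j * coef (g \<tau>) j)\<^sup>2)) / 2"
      by (simp only: sum_divide_distrib[symmetric] sum.distrib)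
    finally have "(\<Sum>j<n. (lam j * q s j)\<^sup>2) \<le> (\<Sum>j<n. (lam j * coef (g \<tau>) j)\<^sup>2)"
      by (simp only: field_simps)
    also note B(2)[OF \<tau>(1)]
    finally show ?thesis .
  qed
  have R: "R s \<in> L2 \<Omega>" "coef (R s) j = q s j - coef (g t) j" if s: "s \<in> {t/2..T}" for s j
  proof -
    have s': "s \<in> {0<..T}" using s t by auto
    have d: "(\<lambda>x. (w s x - w t x) / (s - t)) \<in> L2 \<Omega>" by (intro L2_divide L2_diff w s' t)
    show "R s \<in> L2 \<Omega>" unfolding R_def by (rule L2_diff[OF d g[OF t]])
    show "coef (R s) j = q s j - coef (g t) j"
      unfolding R_def q_def coef_diff[OF d g[OF t]] coef_divide coef_diff[OF w[OF s'] w[OF t]] ..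
  qed
  have R_le: "(\<Sum>j<n. (lam j * coef (R s) j)\<^sup>2) \<le> 4 * B\<^sup>2" if s: "s \<in> {t/2..T}" "s \<noteq> t" for s n
  proof -
    have "(\<Sum>j<n. (lam j * coef (R s) j)\<^sup>2) \<le> (\<Sum>j<n. 2 * (lam j * q s j)\<^sup>2 + 2 * (lam j * coef (g t) j)\<^sup>2)"
    proof (intro sum_mono)
      fix j
      show "(lam j * coef (R s) j)\<^sup>2 \<le> 2 * (lam j * q s j)\<^sup>2 + 2 * (lam j * coef (g t) j)\<^sup>2"
        unfolding R(2)[OF s(1)] right_diff_distrib
        using zero_le_power2[of "lam j * q s j + lam j * coef (g t) j"] by (simp add: power2_sum power2_diff)
    qed
    also have "\<dots> = 2 * (\<Sum>j<n. (lam j * q s j)\<^sup>2) + 2 * (\<Sum>j<n. (lam j * coef (g t) j)\<^sup>2)"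
      by (simp only: sum.distrib sum_distrib_left)
    also have "\<dots> \<le> 4 * B\<^sup>2" using q_le[OF s, of n] B(2)[of t n] t by simp
    finally show ?thesis .
  qed
  have "((\<lambda>s. L2_norm \<Omega> (R s)) \<longlongrightarrow> 0) (at t within {0..T})"
  proof (rule tendstoI)
    fix e :: real assume e: "0 < e"
    have "\<forall>\<^sub>F N in sequentially. 4 * (B + 1) / e \<le> lam N"
      using lam_at_top unfolding filterlim_at_top by blast
    \<comment> \<open>With this choice the tail, at most
      \<open>4 * B\<^sup>2 / (lam N)\<^sup>2\<close>, is below \<open>e\<^sup>2 / 4\<close>; the
      finitely many coefficients before \<open>N\<close> converge individually.\<close>
    then obtain N where N: "4 * (B + 1) / e \<le> lam N" by (auto simp: eventually_sequentially)
    have "((\<lambda>s. \<Sum>j<N. (q s j - coef (g t) j)\<^sup>2) \<longlongrightarrow> (\<Sum>j<N. (coef (g t) j - coef (g t) j)\<^sup>2)) (at t within {0..T})"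
      using der[OF t, unfolded has_field_derivative_iff] unfolding q_def by (intro tendsto_intros)
    then have "\<forall>\<^sub>F s in at t within {0..T}. (\<Sum>j<N. (q s j - coef (g t) j)\<^sup>2) < e\<^sup>2 / 2"
      by (rule order_tendstoD(2)) (use e in simp)
    with ev show "\<forall>\<^sub>F s in at t within {0..T}. dist (L2_norm \<Omega> (R s)) 0 < e"
    proof eventually_elim
      case (elim s)
      then have s: "s \<in> {t/2..T}" "s \<noteq> t" by auto
      have tail: "(\<Sum>j<n. (coef (R s) j)\<^sup>2) \<le> (\<Sum>j<N. (coef (R s) j)\<^sup>2) + e\<^sup>2 / 4" for n
      proof -
        have "(\<Sum>j<n. (coef (R s) j)\<^sup>2) \<le> (\<Sum>j<N. (coef (R s) j)\<^sup>2) + (\<Sum>j<n. (lam j * coef (R s) j)\<^sup>2 / (lam N)\<^sup>2)"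
        proof -
          have "(\<Sum>j<n. (coef (R s) j)\<^sup>2) \<le> (\<Sum>j<n. (if j < N then (coef (R s) j)\<^sup>2 else 0) + (lam j * coef (R s) j)\<^sup>2 / (lam N)\<^sup>2)"
          proof (intro sum_mono)
            fix j
            show "(coef (R s) j)\<^sup>2 \<le> (if j < N then (coef (R s) j)\<^sup>2 else 0) + (lam j * coef (R s) j)\<^sup>2 / (lam N)\<^sup>2"
            proof (cases "j < N")
              case False
              then have "(lam N * coef (R s) j)\<^sup>2 \<le> (lam j * coef (R s) j)\<^sup>2"
                unfolding power_mult_distrib using lam_mono[of N j] lam_pos[of N] by (intro mult_right_mono power_mono) auto
              then show ?thesis using False lam_pos[of N] by (simp add: power_mult_distrib field_simps)
            qed simp
          qed
          moreover have "(\<Sum>j<n. if j < N then (coef (R s) j)\<^sup>2 else 0) \<le> (\<Sum>j<N. (coef (R s) j)\<^sup>2)"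
            using sum.inter_restrict[of "{..<n}" "\<lambda>j. (coef (R s) j)\<^sup>2" "{..<N}"]
              sum_mono2[of "{..<N}" "{..<n} \<inter> {..<N}" "\<lambda>j. (coef (R s) j)\<^sup>2"] by simp
          ultimately show ?thesis unfolding sum.distrib by linarith
        qed
        also have "(\<Sum>j<n. (lam j * coef (R s) j)\<^sup>2 / (lam N)\<^sup>2) \<le> 4 * B\<^sup>2 / (lam N)\<^sup>2"
          using R_le[OF s, of n] by (simp only: sum_divide_distrib[symmetric] divide_right_mono zero_le_power2)
        also have "4 * B\<^sup>2 / (lam N)\<^sup>2 \<le> e\<^sup>2 / 4"
        proof -
          have "4 * B \<le> lam N * e" using N e B(1) by (simp add: field_simps)
          then have "(4 * B)\<^sup>2 \<le> (lam N * e)\<^sup>2" using B(1) by (intro power_mono) auto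
          then show ?thesis using lam_pos[of N] by (simp add: field_simps power_mult_distrib)
        qed
        finally show ?thesis by simp
      qed
      have "(L2_norm \<Omega> (R s))\<^sup>2 \<le> (\<Sum>j<N. (coef (R s) j)\<^sup>2) + e\<^sup>2 / 4"
        using parseval[OF R(1)[OF s(1)]] unfolding sums_def by (rule LIMSEQ_le_const2) (use tail in auto)
      also have "\<dots> < e\<^sup>2 / 2 + e\<^sup>2 / 4" using elim unfolding R(2)[OF s(1)] by simp
      also have "\<dots> \<le> e\<^sup>2" by simp
      finally have "L2_norm \<Omega> (R s) < e" by (rule power2_less_imp_less) (use e in simp)
      then show ?case by (simp add: dist_real_def)
    qed
  qed
  moreover have "\<forall>\<^sub>F s in at t within {0..T}. w s \<in> L2 \<Omega>"
    using ev by eventually_elim (use t in \<open>auto intro: w\<close>)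
  ultimately show ?thesis
    using w[OF t] g[OF t] unfolding has_L2_derivative_def R_def by blast
qed

end

section \<open>Square-summable families\<close>

text \<open>A bound on all finite sections, which expresses square summability and the size of the
  norm in one predicate.\<close>

definition l2le :: "(nat \<Rightarrow> real) \<Rightarrow> real \<Rightarrow> bool" where
  "l2le a C \<longleftrightarrow> 0 \<le> C \<and> (\<forall>n. L2_set a {..<n} \<le> C)"

lemma l2leI:
  assumes "0 \<le> C" "\<And>n. (\<Sum>j<n. (a j)\<^sup>2) \<le> C\<^sup>2" shows "l2le a C"
  unfolding l2le_def L2_set_def
proof (intro conjI allI real_le_lsqrt)
  show "(\<Sum>j<n. (a j)\<^sup>2) \<le> C\<^sup>2" for n by (rule assms(2))
qed (auto simp: assms(1))

lemma l2leD:
  assumes "l2le a C" shows "0 \<le> C" "(\<Sum>j<n. (a j)\<^sup>2) \<le> C\<^sup>2"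
proof -
  show C: "0 \<le> C" using assms by (simp add: l2le_def)
  have "sqrt (\<Sum>j<n. (a j)\<^sup>2) \<le> C" using assms by (simp add: l2le_def L2_set_def)
  then show "(\<Sum>j<n. (a j)\<^sup>2) \<le> C\<^sup>2" by (rule sqrt_le_D)
qed

lemma l2le_add:
  assumes "l2le a A" "l2le b B" shows "l2le (\<lambda>j. a j + b j) (A + B)"
  unfolding l2le_def
proof (intro conjI allI)
  show "0 \<le> A + B" using assms by (simp add: l2le_def)
  fix n
  have "L2_set (\<lambda>j. a j + b j) {..<n} \<le> L2_set a {..<n} + L2_set b {..<n}" by (rule L2_set_triangle_ineq)
  also have "\<dots> \<le> A + B" using assms by (intro add_mono) (auto simp: l2le_def)
  finally show "L2_set (\<lambda>j. a j + b j) {..<n} \<le> A + B" .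
qed

lemma l2le_mult:
  assumes k: "\<And>j. \<bar>k j\<bar> \<le> M" and a: "l2le a A"
  shows "l2le (\<lambda>j. k j * a j) (M * A)"
proof -
  have M: "0 \<le> M" using k[of 0] by linarith
  have "L2_set (\<lambda>j. k j * a j) {..<n} \<le> M * A" for n
  proof -
    have "L2_set (\<lambda>j. k j * a j) {..<n} = L2_set (\<lambda>j. \<bar>k j * a j\<bar>) {..<n}"
      by (simp add: L2_set_def)
    also have "\<dots> \<le> L2_set (\<lambda>j. M * \<bar>a j\<bar>) {..<n}"
      using k by (intro L2_set_mono) (auto simp: abs_mult intro: mult_right_mono)
    also have "\<dots> = M * L2_set (\<lambda>j. \<bar>a j\<bar>) {..<n}"
      using M by (simp add: L2_set_right_distrib)
    also have "L2_set (\<lambda>j. \<bar>a j\<bar>) {..<n} = L2_set a {..<n}" by (simp add: L2_set_def)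
    also have "M * L2_set a {..<n} \<le> M * A" using a M by (intro mult_left_mono) (auto simp: l2le_def)
    finally show ?thesis .
  qed
  then show ?thesis using M a by (simp add: l2le_def)
qed

lemma l2le_diff:
  assumes "l2le a A" "l2le b B" shows "l2le (\<lambda>j. a j - b j) (A + B)"
proof -
  have "l2le (\<lambda>j. (-1) * b j) (1 * B)" by (rule l2le_mult[OF _ assms(2)]) simp
  from l2le_add[OF assms(1) this] show ?thesis by simp
qed

lemma l2le_mono: "l2le a A \<Longrightarrow> A \<le> B \<Longrightarrow> l2le a B"
  by (auto simp: l2le_def intro: order_trans)

lemma l2le_abs_le:
  assumes "l2le a A" shows "\<bar>a j\<bar> \<le> A"
proof (rule power2_le_imp_le)
  have "(\<bar>a j\<bar>)\<^sup>2 \<le> (\<Sum>j<Suc j. (a j)\<^sup>2)" by (simp add: sum_nonneg)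
  also have "\<dots> \<le> A\<^sup>2" by (rule l2leD(2)[OF assms])
  finally show "(\<bar>a j\<bar>)\<^sup>2 \<le> A\<^sup>2" .
qed (rule l2leD(1)[OF assms])

lemma l2le_of_summable:
  assumes "summable (\<lambda>j. (a j)\<^sup>2)" shows "\<exists>A. l2le a A"
proof
  have nn: "0 \<le> (\<Sum>j. (a j)\<^sup>2)" using assms by (intro suminf_nonneg) auto
  show "l2le a (sqrt (\<Sum>j. (a j)\<^sup>2))"
  proof (rule l2leI)
    show "(\<Sum>j<n. (a j)\<^sup>2) \<le> (sqrt (\<Sum>j. (a j)\<^sup>2))\<^sup>2" for n
      using sum_le_suminf[OF assms, of "{..<n}"] nn by simp
  qed (use nn in simp)
qed

text \<open>Minkowski's integral inequality by duality: the square of the norm \<open>X\<close> of a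
  finite section is written as a pairing of the section with itself, Cauchy-Schwarz is applied under
  the integral, and one factor \<open>X\<close> is cancelled. It is here that \<open>C\<close> and
  \<open>a\<close> must be the same for all \<open>j\<close>.\<close>

lemma l2le_conv:
  assumes K: "\<And>j. kernel_le T C a (K j)"
    and g: "\<And>j. kernel_le T D b (g j)"
    and le: "\<And>s. 0 < s \<Longrightarrow> s < T \<Longrightarrow> l2le (\<lambda>j. g j s) (D * rl_kernel b s)" and t: "0 < t" "t \<le> T"
  shows "l2le (\<lambda>j. conv (K j) (g j) t) (C * D * rl_kernel (a + b) t)"
  unfolding l2le_def
proof (intro conjI allI)
  note KD = kernel_leD[OF K] and GD = kernel_leD[OF g]
  show nn: "0 \<le> C * D * rl_kernel (a + b) t" using KD GD by simp
  fix n
  define x where "x = (\<lambda>j. conv (K j) (g j) t)"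
  define X where "X = L2_set x {..<n}"
  have int: "set_integrable lborel {0<..<t} (\<lambda>s. x j * (K j (t - s) * g j s))" for j
    using conv_integrable(1)[OF K g t(2)] by (rule set_integrable_mult_right)
  have one: "kernel_le T 1 a (rl_kernel a)" "kernel_le T 1 b (rl_kernel b)"
    using KD GD by (auto intro: kernel_le_rl_kernel)
  have "X\<^sup>2 = (\<Sum>j<n. x j * x j)"
    unfolding X_def L2_set_def by (simp add: sum_nonneg power2_eq_square)
  also have "\<dots> = (\<Sum>j<n. LINT s:{0<..<t}|lborel. x j * (K j (t - s) * g j s))"
    by (intro sum.cong refl) (simp add: x_def conv_def)
  also have "\<dots> = (LINT s:{0<..<t}|lborel. \<Sum>j<n. x j * (K j (t - s) * g j s))"
    unfolding set_lebesgue_integral_def scaleR_sum_right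
    by (rule Bochner_Integration.integral_sum[symmetric]) (use int in \<open>simp add: set_integrable_def\<close>)
  also have "\<dots> \<le> (LINT s:{0<..<t}|lborel. X * C * D * (rl_kernel a (t - s) * rl_kernel b s))"
  proof (rule set_integral_mono)
    show "set_integrable lborel {0<..<t} (\<lambda>s. \<Sum>j<n. x j * (K j (t - s) * g j s))"
      using int unfolding set_integrable_def scaleR_sum_right by (intro Bochner_Integration.integrable_sum)
    show "set_integrable lborel {0<..<t} (\<lambda>s. X * C * D * (rl_kernel a (t - s) * rl_kernel b s))"
      by (intro set_integrable_mult_right conv_integrable(1)[OF one t(2)])
    fix s assume s: "s \<in> {0<..<t}"
    have "(\<Sum>j<n. x j * (K j (t - s) * g j s)) \<le> (\<Sum>j<n. (C * rl_kernel a (t - s)) * (\<bar>x j\<bar> * \<bar>g j s\<bar>))"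
    proof (intro sum_mono)
      fix j
      have "x j * (K j (t - s) * g j s) \<le> \<bar>K j (t - s)\<bar> * (\<bar>x j\<bar> * \<bar>g j s\<bar>)"
        using abs_ge_self[of "x j * (K j (t - s) * g j s)"] by (simp add: abs_mult mult_ac)
      also have "\<dots> \<le> (C * rl_kernel a (t - s)) * (\<bar>x j\<bar> * \<bar>g j s\<bar>)"
        using KD(4)[of "t - s" j] s t by (intro mult_right_mono) auto
      finally show "x j * (K j (t - s) * g j s) \<le> (C * rl_kernel a (t - s)) * (\<bar>x j\<bar> * \<bar>g j s\<bar>)" .
    qed
    also have "\<dots> = (C * rl_kernel a (t - s)) * (\<Sum>j<n. \<bar>x j\<bar> * \<bar>g j s\<bar>)"
      by (simp add: sum_distrib_left)
    also have "\<dots> \<le> (C * rl_kernel a (t - s)) * (X * L2_set (\<lambda>j. g j s) {..<n})"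
      unfolding X_def using KD by (intro mult_left_mono L2_set_mult_ineq) auto
    also have "\<dots> \<le> (C * rl_kernel a (t - s)) * (X * (D * rl_kernel b s))"
      using KD le[of s] s t unfolding X_def l2le_def by (intro mult_left_mono) auto
    finally show "(\<Sum>j<n. x j * (K j (t - s) * g j s)) \<le> X * C * D * (rl_kernel a (t - s) * rl_kernel b s)"
      by (simp add: mult_ac)
  qed
  also have "\<dots> = X * C * D * rl_kernel (a + b) t"
    using conv_rl_kernel[of a b t] KD GD t by (simp add: conv_def)
  finally have "X * X \<le> X * (C * D * rl_kernel (a + b) t)" by (simp add: power2_eq_square mult_ac)
  then have "X \<le> C * D * rl_kernel (a + b) t"
    using nn unfolding X_def by (cases "X = 0") (auto simp: X_def mult_le_cancel_left less_le)
  then show "L2_set (\<lambda>j. conv (K j) (g j) t) {..<n} \<le> C * D * rl_kernel (a + b) t"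
    by (simp add: X_def x_def)
qed

section \<open>Kernel convolutions with weighted families of coefficients\<close>

lemma ml_kernel_deriv:
  assumes "0 < \<alpha>" "\<alpha> < 1" "0 < \<mu>" "\<alpha> \<le> \<nu>" "0 < t"
  shows "(ml_kernel \<alpha> \<mu> \<nu> has_real_derivative deriv (ml_kernel \<alpha> \<mu> \<nu>) t) (at t)"
    and "\<bar>deriv (ml_kernel \<alpha> \<mu> \<nu>) t\<bar> \<le> (\<nu> + 2) * (rl_kernel \<nu> t / t)"
proof -
  interpret relaxation \<alpha> \<mu> using assms by unfold_locales
  obtain D where "(ml_kernel \<alpha> \<mu> \<nu> has_real_derivative D) (at t)" "\<bar>D\<bar> \<le> (\<nu> + 2) * (rl_kernel \<nu> t / t)"
    using ml_kernel_derivative_bound[OF assms(2,4,5)] by blast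
  then show "(ml_kernel \<alpha> \<mu> \<nu> has_real_derivative deriv (ml_kernel \<alpha> \<mu> \<nu>) t) (at t)"
    "\<bar>deriv (ml_kernel \<alpha> \<mu> \<nu>) t\<bar> \<le> (\<nu> + 2) * (rl_kernel \<nu> t / t)"
    by (auto simp: DERIV_imp_deriv)
qed

lemma rl_kernel_bound_powr:
  assumes "0 < a" "0 < b" "0 < t" "t \<le> T"
  shows "rl_kernel (a + b) t \<le> T powr b / Gamma (a + b) * t powr (a - 1)"
  using powr_exponent_mono[of t T a "a + b"] assms Gamma_real_pos[of "a + b"]
  by (simp add: rl_kernel_def divide_right_mono)

text \<open>It is instantiated twice, with the pairs (\<open>d\<close>, \<open>g1\<close>) and
  (\<open>g1\<close>, \<open>g2\<close>) of data coefficients and their time derivatives. The weight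
  \<open>lam j\<close> belongs to the \<open>Hdot\<close> norm of order 2, the exponent is
  \<open>b = 1 - \<sigma>\<close>, and nothing is assumed about \<open>c j\<close> at 0.\<close>

locale weighted_family =
  fixes lam :: "nat \<Rightarrow> real" and T b D :: real and c g :: "nat \<Rightarrow> real \<Rightarrow> real"
  assumes lam_pos: "0 < lam j" and T: "0 < T" and b: "0 < b"
    and der: "t \<in> {0<..T} \<Longrightarrow> (c j has_real_derivative g j t) (at t within {0..T})"
    and g_l2: "t \<in> {0<..T} \<Longrightarrow> l2le (\<lambda>j. lam j * g j t) (D * rl_kernel b t)"
begin

lemma D: "0 \<le> D"
  using g_l2[of T] T b rl_kernel_pos[of b T] by (simp add: l2le_def zero_le_mult_iff)

lemma abs_g_le: "t \<in> {0<..T} \<Longrightarrow> \<bar>g j t\<bar> \<le> D / lam j * rl_kernel b t"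
  using l2le_abs_le[OF g_l2, of t j] lam_pos[of j] by (simp add: abs_mult field_simps)

lemma D_lam: "0 \<le> D / lam j" using D lam_pos[of j] by simp

text \<open>\<open>kernel_le\<close> asks for Borel measurability on the whole line, which is known
  only after this cut-off; convolutions up to time \<open>T\<close> do not see the
  difference.\<close>

abbreviation g0 :: "nat \<Rightarrow> real \<Rightarrow> real" where "g0 j \<equiv> \<lambda>t. indicator {0<..<T} t * g j t"

lemma kernel_le_g0: "kernel_le T (D / lam j) b (g0 j)"
  by (rule derivative_kernel_le[OF T der abs_g_le b D_lam])

lemma kernel_le_lam_g0: "kernel_le T D b (\<lambda>t. lam j * g0 j t)"
  using kernel_leD(3)[OF kernel_le_g0] b D l2le_abs_le[OF g_l2, of _ j]
  by (auto simp: kernel_le_def indicator_def)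

lemma conv_g0: "t \<le> T \<Longrightarrow> conv K (g0 j) t = conv K (g j) t"
  by (rule conv_cong) auto

lemma l2le_conv_g:
  assumes K: "\<And>j. kernel_le T C a (K j)" and t: "t \<in> {0<..T}"
  shows "l2le (\<lambda>j. lam j * conv (K j) (g j) t) (C * D * rl_kernel (a + b) t)"
proof -
  have "l2le (\<lambda>j. conv (K j) (\<lambda>t. lam j * g0 j t) t) (C * D * rl_kernel (a + b) t)"
  proof (rule l2le_conv[OF K kernel_le_lam_g0])
    show "l2le (\<lambda>j. lam j * g0 j s) (D * rl_kernel b s)" if "0 < s" "s < T" for s
      using g_l2[of s] that by simp
  qed (use t in auto)
  then show ?thesis using t by (simp add: conv_cmult_right conv_g0)
qed

text \<open>The limit at 0 inherits the weight: the value at \<open>T\<close> is weighted by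
  assumption, and Minkowski's inequality bounds the integral that is subtracted.\<close>

lemma initial_value_l2:
  assumes "l2le (\<lambda>j. lam j * c j T) A"
  shows "\<exists>A0. l2le (\<lambda>j. lam j * (c j T - conv (rl_kernel 1) (g j) T)) A0"
  using l2le_diff[OF assms l2le_conv_g[OF kernel_le_rl_kernel, of 1 T]] T
  by (auto simp: right_diff_distrib)

lemma extension:
  "continuous_on {0..T} (\<lambda>t. if t \<le> 0 then c j T - conv (rl_kernel 1) (g j) T else c j t)"
  by (rule derivative_extends_continuously[OF T der abs_g_le b D_lam])

lemma conv_c_has_derivative:
  assumes K: "kernel_le T C a K" "continuous_on {0<..} K" and t: "t \<in> {0<..T}"
  shows "(conv K (c j) has_real_derivative
     (c j T - conv (rl_kernel 1) (g j) T) * K t + conv K (g j) t) (at t within {0..T})"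
proof -
  \<comment> \<open>Only values at \<open>t \<le> 0\<close> are altered, to make the function
    continuous at 0. Derivatives on (0,T] and convolutions remain the same.\<close>
  define c' where "c' = (\<lambda>t. if t \<le> 0 then c j T - conv (rl_kernel 1) (g j) T else c j t)"
  have c'der: "(c' has_real_derivative g j s) (at s within {0..T})" if s: "s \<in> {0<..T}" for s
    by (rule has_field_derivative_transform_within[OF der[OF s], of s])
       (use s in \<open>auto simp: c'_def dist_real_def\<close>)
  have "(conv K c' has_real_derivative c' 0 * K t + conv K (g j) t) (at t within {0..T})"
    by (rule conv_has_derivative[OF K _ c'der abs_g_le b D_lam t]) (use extension in \<open>simp_all add: c'_def\<close>)
  moreover have "conv K c' = conv K (c j)"
    by (intro ext conv_cong) (auto simp: c'_def)
  ultimately show ?thesis by (simp add: c'_def)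
qed

text \<open>The first summand is of order \<open>t powr (\<nu> - 1)\<close> because of
  \<open>K\<close>. The convolution is of order \<open>t powr (\<nu> + b - 1)\<close>, which is no
  worse on (0,T] up to the factor \<open>T powr b\<close>.\<close>

lemma derivative_l2:
  assumes K: "\<And>j. kernel_le T 1 \<nu> (K j)" and \<nu>: "0 < \<nu>" and A: "l2le (\<lambda>j. lam j * c j T) A"
  shows "\<exists>C. \<forall>t\<in>{0<..T}. l2le (\<lambda>j. lam j *
    ((c j T - conv (rl_kernel 1) (g j) T) * K j t + conv (K j) (g j) t)) (C * t powr (\<nu> - 1))"
proof -
  obtain A0 where A0: "l2le (\<lambda>j. lam j * (c j T - conv (rl_kernel 1) (g j) T)) A0"
    using initial_value_l2[OF A] by blast
  define C where "C = A0 / Gamma \<nu> + D * (T powr b / Gamma (\<nu> + b))"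
  show ?thesis
  proof (intro exI[of _ C] ballI)
    fix t assume t: "t \<in> {0<..T}"
    have "l2le (\<lambda>j. K j t * (lam j * (c j T - conv (rl_kernel 1) (g j) T))) (rl_kernel \<nu> t * A0)"
      by (rule l2le_mult[OF _ A0]) (use kernel_leD(4)[OF K] t in auto)
    from l2le_add[OF this l2le_conv_g[OF K t]]
    have sum_l2: "l2le (\<lambda>j. lam j * ((c j T - conv (rl_kernel 1) (g j) T) * K j t + conv (K j) (g j) t))
       (rl_kernel \<nu> t * A0 + 1 * D * rl_kernel (\<nu> + b) t)"
      by (simp add: distrib_left mult_ac)
    have "D * rl_kernel (\<nu> + b) t \<le> D * (T powr b / Gamma (\<nu> + b) * t powr (\<nu> - 1))"
      using rl_kernel_bound_powr[OF \<nu> b, of t T] t D by (intro mult_left_mono) auto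
    moreover have "C * t powr (\<nu> - 1) = rl_kernel \<nu> t * A0 + D * (T powr b / Gamma (\<nu> + b) * t powr (\<nu> - 1))"
      by (simp add: C_def rl_kernel_def distrib_right) (simp add: mult_ac)
    ultimately have "rl_kernel \<nu> t * A0 + 1 * D * rl_kernel (\<nu> + b) t \<le> C * t powr (\<nu> - 1)"
      by simp
    with sum_l2 show "l2le (\<lambda>j. lam j * ((c j T - conv (rl_kernel 1) (g j) T) * K j t + conv (K j) (g j) t))
       (C * t powr (\<nu> - 1))"
      by (rule l2le_mono)
  qed
qed

end

section \<open>Fractional integral, solution operator and Duhamel formula in Fourier
  coefficients\<close>

text \<open>The source of existence for weak integrals: a bounded functional is represented by the
  sequence of its values on the basis.\<close>

lemma (in L2_basis) riesz_representation:
  assumes add: "\<And>u w. u \<in> L2 \<Omega> \<Longrightarrow> w \<in> L2 \<Omega> \<Longrightarrow> \<Lambda> (\<lambda>x. u x + w x) = \<Lambda> u + \<Lambda> w"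
    and scale: "\<And>c u. u \<in> L2 \<Omega> \<Longrightarrow> \<Lambda> (\<lambda>x. c * u x) = c * \<Lambda> u"
    and bdd: "\<And>u. u \<in> L2 \<Omega> \<Longrightarrow> \<bar>\<Lambda> u\<bar> \<le> C * L2_norm \<Omega> u" and C: "0 \<le> C"
  obtains u where "u \<in> L2 \<Omega>" "\<And>w. w \<in> L2 \<Omega> \<Longrightarrow> L2_inner \<Omega> u w = \<Lambda> w"
proof -
  let ?S = "\<lambda>w n x. \<Sum>j<n. coef w j * \<phi> j x"
  define a where "a = (\<lambda>j. \<Lambda> (\<phi> j))"
  have lin: "\<Lambda> (\<lambda>x. \<Sum>j<n. c j * \<phi> j x) = (\<Sum>j<n. c j * a j)" for c and n :: nat
  proof (induction n)
    case 0
    show ?case using scale[of "\<phi> 0" 0] by simp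
  next
    case (Suc n)
    have "\<Lambda> (\<lambda>x. (\<Sum>j<n. c j * \<phi> j x) + c n * \<phi> n x) = \<Lambda> (\<lambda>x. \<Sum>j<n. c j * \<phi> j x) + \<Lambda> (\<lambda>x. c n * \<phi> n x)"
      by (rule add[OF L2_lincomb L2_cmult[OF \<phi>_L2]])
    then show ?case using Suc scale[of "\<phi> n" "c n"] by (simp add: a_def)
  qed
  have "(\<Sum>j<n. (a j)\<^sup>2) \<le> C\<^sup>2" for n
  proof -
    \<comment> \<open>The functional is tested with the finite section of its own prospective
      representative, where its value is \<open>X\<^sup>2\<close>; boundedness then gives
      \<open>X \<le> C\<close>.\<close>
    define X where "X = L2_norm \<Omega> (\<lambda>x. \<Sum>j<n. a j * \<phi> j x)"
    have X2: "X\<^sup>2 = (\<Sum>j<n. (a j)\<^sup>2)" unfolding X_def by (rule norm_lincomb) simp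
    also have "\<dots> = \<Lambda> (\<lambda>x. \<Sum>j<n. a j * \<phi> j x)" by (simp add: lin power2_eq_square)
    also have "\<dots> \<le> C * X" using bdd[OF L2_lincomb, of a "{..<n}"] by (simp add: X_def abs_le_iff)
    finally have "X * X \<le> C * X" by (simp add: power2_eq_square)
    then have "X \<le> C" using C by (cases "X = 0") (auto simp: mult_le_cancel_right X_def less_le)
    then have "X\<^sup>2 \<le> C\<^sup>2" by (intro power_mono) (auto simp: X_def)
    then show ?thesis by (simp only: X2)
  qed
  from this[of "Suc n" for n] have "(\<Sum>j\<le>n. (a j)\<^sup>2) \<le> C\<^sup>2" for n by (simp only: lessThan_Suc_atMost)
  then have sm: "summable (\<lambda>j. (a j)\<^sup>2)" by (rule bounded_imp_summable[rotated]) simp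
  show ?thesis
  proof (rule that[OF synth(1)[OF sm]])
    fix w assume w: "w \<in> L2 \<Omega>"
    have "(\<lambda>n. \<Lambda> (?S w n) - \<Lambda> w) \<longlonglongrightarrow> 0"
    proof (rule Lim_null_comparison)
      show "(\<lambda>n. C * L2_norm \<Omega> (\<lambda>x. ?S w n x - w x)) \<longlonglongrightarrow> 0"
        by (rule tendsto_mult_right_zero[OF expansion[OF w]])
      show "\<forall>\<^sub>F n in sequentially. norm (\<Lambda> (?S w n) - \<Lambda> w)
          \<le> C * L2_norm \<Omega> (\<lambda>x. ?S w n x - w x)"
      proof (intro always_eventually allI)
        fix n :: nat
        have "\<Lambda> (\<lambda>x. ?S w n x + (-1) * w x) = \<Lambda> (?S w n) + (-1) * \<Lambda> w"
          using add[OF L2_lincomb L2_cmult[OF w, of "-1"]] scale[OF w, of "-1"] by simp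
        moreover have "(\<lambda>x. ?S w n x + (-1) * w x) = (\<lambda>x. ?S w n x - w x)"
          by simp
        ultimately have "\<Lambda> (\<lambda>x. ?S w n x - w x) = \<Lambda> (?S w n) - \<Lambda> w"
          by simp
        then show "norm (\<Lambda> (?S w n) - \<Lambda> w)
          \<le> C * L2_norm \<Omega> (\<lambda>x. ?S w n x - w x)"
          using bdd[OF L2_diff[OF L2_lincomb w], of "coef w" "{..<n}"] by simp
      qed
    qed
    then have "(\<lambda>n. \<Sum>j<n. coef w j * a j) \<longlonglongrightarrow> \<Lambda> w"
      unfolding lin by (rule LIM_zero_cancel)
    moreover have "(\<lambda>n. \<Sum>j<n. coef w j * a j) \<longlonglongrightarrow> L2_inner \<Omega> (synth a) w"
      using inner_sums[OF synth(1)[OF sm] w] unfolding sums_def synth(2)[OF sm] by (simp add: mult.commute)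
    ultimately show "L2_inner \<Omega> (synth a) w = \<Lambda> w" by (rule LIMSEQ_unique[rotated])
  qed
qed

context dirichlet
begin

text \<open>Since \<open>rl_integral\<close> is a choice, a weak integral must first be exhibited.
  It represents the functional \<open>?L\<close>, which is bounded because the norms of
  \<open>G s\<close> are; weak continuity of \<open>G\<close> supplies measurability. Pairing with
  an eigenfunction gives the coefficients.\<close>

lemma rl_integral_coef:
  assumes G: "\<And>s. s \<in> {0..T} \<Longrightarrow> G s \<in> L2 \<Omega>"
    and Gc: "\<And>w. w \<in> L2 \<Omega> \<Longrightarrow> continuous_on {0..T} (\<lambda>s. L2_inner \<Omega> (G s) w)"
    and B: "\<And>s. s \<in> {0..T} \<Longrightarrow> L2_norm \<Omega> (G s) \<le> B" and \<beta>: "0 < \<beta>" and t: "t \<in> {0..T}"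
  shows "rl_integral \<Omega> \<beta> G t \<in> L2 \<Omega>"
    and "coef (rl_integral \<Omega> \<beta> G t) j = conv (rl_kernel \<beta>) (\<lambda>s. coef (G s) j) t"
proof -
  let ?L = "\<lambda>w. conv (rl_kernel \<beta>) (\<lambda>s. L2_inner \<Omega> (G s) w) t"
  have B0: "0 \<le> B" using B[OF t] L2_norm_nonneg[of \<Omega> "G t"] by linarith
  define gw where "gw = (\<lambda>w s. indicator {0..T} s * L2_inner \<Omega> (G s) w)"
  have gw: "kernel_le T (B * L2_norm \<Omega> w) 1 (gw w)" if w: "w \<in> L2 \<Omega>" for w
    unfolding kernel_le_def
  proof (intro conjI ballI)
    show "gw w \<in> borel_measurable borel"
      using borel_measurable_continuous_on_indicator[OF _ Gc[OF w]] unfolding gw_def by simp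
    fix s assume s: "s \<in> {0<..T}"
    have "\<bar>L2_inner \<Omega> (G s) w\<bar> \<le> L2_norm \<Omega> (G s) * L2_norm \<Omega> w"
      by (rule L2_Cauchy_Schwarz[OF G w]) (use s in auto)
    also have "\<dots> \<le> B * L2_norm \<Omega> w" using s by (intro mult_right_mono B) auto
    finally show "\<bar>gw w s\<bar> \<le> B * L2_norm \<Omega> w * rl_kernel 1 s"
      using s by (simp add: gw_def)
  qed (use B0 in auto)
  have cg: "?L w = conv (rl_kernel \<beta>) (gw w) t" for w
    by (rule conv_cong) (use t in \<open>auto simp: gw_def\<close>)
  note one = kernel_le_rl_kernel[OF \<beta>, of T]
  obtain u where u: "u \<in> L2 \<Omega>" "\<And>w. w \<in> L2 \<Omega> \<Longrightarrow> L2_inner \<Omega> u w = ?L w"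
  proof (rule riesz_representation[of ?L "B * rl_kernel (\<beta> + 1) t"])
    fix u w assume uw: "u \<in> L2 \<Omega>" "w \<in> L2 \<Omega>"
    have "?L (\<lambda>x. u x + w x)
      = conv (rl_kernel \<beta>) (\<lambda>s. gw u s + gw w s) t"
    proof (intro conv_cong refl)
      fix s assume "0 < s" "s < t"
      then show "L2_inner \<Omega> (G s) (\<lambda>x. u x + w x) = gw u s + gw w s"
        using L2_inner_add_left[OF uw G, of s] t
        by (simp add: gw_def L2_inner_commute[of \<Omega> "G s"])
    qed
    then show "?L (\<lambda>x. u x + w x)
      = ?L u + ?L w"
      unfolding cg using conv_add_right[OF one gw[OF uw(1)] gw[OF uw(2)], of t] t by simp
  next
    fix c u assume "u \<in> L2 \<Omega>"
    have "(\<lambda>s. L2_inner \<Omega> (G s) (\<lambda>x. c * u x)) = (\<lambda>s. c * L2_inner \<Omega> (G s) u)"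
      unfolding L2_inner_commute[of \<Omega> "G _"] L2_inner_cmult_left ..
    then show "?L (\<lambda>x. c * u x) = c * ?L u"
      by (simp only: conv_cmult_right)
  next
    fix u assume "u \<in> L2 \<Omega>"
    from abs_conv_le[OF one gw[OF this], of t] t
    show "\<bar>?L u\<bar> \<le> B * rl_kernel (\<beta> + 1) t * L2_norm \<Omega> u"
      unfolding cg by (simp add: mult_ac)
  qed (use B0 \<beta> in auto)
  have "has_L2_integral \<Omega> (\<lambda>s x. rl_kernel \<beta> (t - s) * G s x) 0 t u"
    unfolding has_L2_integral_def L2_inner_cmult_left
  proof (intro conjI ballI u(1))
    show "(\<lambda>x. rl_kernel \<beta> (t - s) * G s x) \<in> L2 \<Omega>" if "s \<in> {0<..<t}" for s
      by (intro L2_cmult G) (use that t in auto)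
    fix w assume w: "w \<in> L2 \<Omega>"
    have "set_integrable lborel {0<..<t} (\<lambda>s. rl_kernel \<beta> (t - s) * gw w s)"
      using conv_integrable(1)[OF one gw[OF w]] t by auto
    also have "?this \<longleftrightarrow> set_integrable lborel {0<..<t} (\<lambda>s. rl_kernel \<beta> (t - s) * L2_inner \<Omega> (G s) w)"
      by (intro set_integrable_cong) (use t in \<open>auto simp: gw_def\<close>)
    finally show "set_integrable lborel {0<..<t} (\<lambda>s. rl_kernel \<beta> (t - s) * L2_inner \<Omega> (G s) w)" .
    show "L2_inner \<Omega> u w = (LINT s:{0<..<t}|lborel. rl_kernel \<beta> (t - s) * L2_inner \<Omega> (G s) w)"
      using u(2)[OF w] unfolding conv_def .
  qed
  then have I: "has_L2_integral \<Omega> (\<lambda>s x. rl_kernel \<beta> (t - s) * G s x) 0 t (rl_integral \<Omega> \<beta> G t)"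
    unfolding rl_integral_def
    by (rule someI[of "has_L2_integral \<Omega> (\<lambda>s x. rl_kernel \<beta> (t - s) * G s x) 0 t"])
  then show "rl_integral \<Omega> \<beta> G t \<in> L2 \<Omega>" by (simp add: has_L2_integral_def)
  have "L2_inner \<Omega> (rl_integral \<Omega> \<beta> G t) (\<phi> j) = (LINT s:{0<..<t}|lborel. L2_inner \<Omega> (\<lambda>x. rl_kernel \<beta> (t - s) * G s x) (\<phi> j))"
    using I \<phi>_L2 unfolding has_L2_integral_def by blast
  then show "coef (rl_integral \<Omega> \<beta> G t) j = conv (rl_kernel \<beta>) (\<lambda>s. coef (G s) j) t"
    unfolding L2_inner_cmult_left coef_def conv_def .
qed

text \<open>The uniform bound on the kernels makes the defining series converge in L2, so the choice
  in \<open>solution_operator\<close> satisfies its specification.\<close>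

lemma solution_operator_coef:
  assumes \<alpha>: "0 < \<alpha>" "\<alpha> < 1" and t: "0 < t" and q: "q \<in> L2 \<Omega>"
  shows "coef (solution_operator \<Omega> lam \<phi> \<alpha> t q) j = ml_kernel \<alpha> (lam j) \<alpha> t * coef q j"
proof -
  define a where "a = (\<lambda>j. ml_kernel \<alpha> (lam j) \<alpha> t * coef q j)"
  have ml: "\<bar>ml_kernel \<alpha> (lam j) \<alpha> t\<bar> \<le> rl_kernel \<alpha> t" for j
  proof -
    interpret relaxation \<alpha> "lam j" using \<alpha> lam_pos by unfold_locales auto
    show ?thesis using ml_kernel_bounds[OF \<alpha>(2) order_refl t] by simp
  qed
  obtain A where "l2le (coef q) A" using l2le_of_summable[OF summable_coef[OF q]] by blast
  from l2le_mult[OF ml this] have "l2le a (rl_kernel \<alpha> t * A)" by (simp add: a_def)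
  from l2leD(2)[OF this, of "Suc n" for n]
  have "summable (\<lambda>j. (a j)\<^sup>2)"
    by (intro bounded_imp_summable[of _ "(rl_kernel \<alpha> t * A)\<^sup>2"]) (simp_all only: lessThan_Suc_atMost zero_le_power2)
  then obtain u where u: "u \<in> L2 \<Omega>" "(\<lambda>n. L2_norm \<Omega> (\<lambda>x. (\<Sum>j<n. a j * \<phi> j x) - u x)) \<longlonglongrightarrow> 0"
    by (rule riesz_fischer)
  have S: "solution_operator \<Omega> lam \<phi> \<alpha> t q = (SOME u. u \<in> L2 \<Omega> \<and> (\<lambda>n. L2_norm \<Omega> (\<lambda>x. (\<Sum>j<n. a j * \<phi> j x) - u x)) \<longlonglongrightarrow> 0)"
    unfolding solution_operator_def a_def ml_kernel_def coef_def ..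
  have "solution_operator \<Omega> lam \<phi> \<alpha> t q \<in> L2 \<Omega> \<and>
    (\<lambda>n. L2_norm \<Omega> (\<lambda>x. (\<Sum>j<n. a j * \<phi> j x) - solution_operator \<Omega> lam \<phi> \<alpha> t q x)) \<longlonglongrightarrow> 0"
    unfolding S by (rule someI[of _ u]) (use u in simp)
  then show ?thesis using coef_limit[of "solution_operator \<Omega> lam \<phi> \<alpha> t q" a j] by (simp add: a_def)
qed

lemma duhamel_coef:
  assumes \<alpha>: "0 < \<alpha>" "\<alpha> < 1" and v: "duhamel_formula \<Omega> lam \<phi> \<alpha> T F v"
    and F: "\<And>s. s \<in> {0..T} \<Longrightarrow> F s \<in> L2 \<Omega>" and t: "t \<in> {0..T}"
  shows "v t \<in> L2 \<Omega>" "coef (v t) j = conv (ml_kernel \<alpha> (lam j) \<alpha>) (\<lambda>s. coef (F s) j) t"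
proof -
  have I: "has_L2_integral \<Omega> (\<lambda>s. solution_operator \<Omega> lam \<phi> \<alpha> (t - s) (F s)) 0 t (v t)"
    using v t by (simp add: duhamel_formula_def)
  then show "v t \<in> L2 \<Omega>" by (simp add: has_L2_integral_def)
  have "coef (v t) j = (LINT s:{0<..<t}|lborel. coef (solution_operator \<Omega> lam \<phi> \<alpha> (t - s) (F s)) j)"
    using I \<phi>_L2 unfolding has_L2_integral_def coef_def by blast
  also have "\<dots> = conv (ml_kernel \<alpha> (lam j) \<alpha>) (\<lambda>s. coef (F s) j) t"
    unfolding conv_def
    by (intro set_lebesgue_integral_cong) (use t F solution_operator_coef[OF \<alpha>] in auto)
  finally show "coef (v t) j = conv (ml_kernel \<alpha> (lam j) \<alpha>) (\<lambda>s. coef (F s) j) t" .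
qed

text \<open>The passage from coefficients to functions, applied first to \<open>v\<close> and then
  to its derivative: a weighted bound on the coefficient derivatives yields both the strong
  derivative and its \<open>Hdot\<close> estimate.\<close>

lemma L2_derivative_synth:
  assumes w: "\<And>s. s \<in> {0<..T} \<Longrightarrow> w s \<in> L2 \<Omega>" "\<And>s j. s \<in> {0<..T} \<Longrightarrow> coef (w s) j = y j s"
    and der: "\<And>s j. s \<in> {0<..T} \<Longrightarrow> (y j has_real_derivative y1 j s) (at s within {0..T})"
    and l2: "\<And>s. s \<in> {0<..T} \<Longrightarrow> l2le (\<lambda>j. lam j * y1 j s) (C * s powr p)"
    and t: "t \<in> {0<..T}"
  shows "synth (\<lambda>j. y1 j t) \<in> L2 \<Omega>" "coef (synth (\<lambda>j. y1 j t)) j = y1 j t"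
    and "has_L2_derivative \<Omega> T w (synth (\<lambda>j. y1 j t)) t"
    and "synth (\<lambda>j. y1 j t) \<in> Hdot \<Omega> lam \<phi> 2"
    and "Hdot_norm \<Omega> lam \<phi> 2 (synth (\<lambda>j. y1 j t)) \<le> (1 + 1 / lam 0) * (C * t powr p)"
proof -
  have synth': "synth (\<lambda>j. y1 j s) \<in> L2 \<Omega>" "coef (synth (\<lambda>j. y1 j s)) j = y1 j s"
    if s: "s \<in> {0<..T}" for s j
  proof -
    have "summable (\<lambda>j. (lam j ^ 1 * y1 j s)\<^sup>2)"
      using l2leD(2)[OF l2[OF s], of "Suc n" for n]
      by (intro bounded_imp_summable[of _ "(C * s powr p)\<^sup>2"]) (simp_all only: lessThan_Suc_atMost zero_le_power2 power_one_right)
    from lam_power_summable_mono[OF this, of 0] have "summable (\<lambda>j. (y1 j s)\<^sup>2)" by simp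
    then show "synth (\<lambda>j. y1 j s) \<in> L2 \<Omega>" "coef (synth (\<lambda>j. y1 j s)) j = y1 j s"
      by (rule synth)+
  qed
  then show "synth (\<lambda>j. y1 j t) \<in> L2 \<Omega>" "coef (synth (\<lambda>j. y1 j t)) j = y1 j t" using t by auto
  have C: "0 \<le> C" using l2leD(1)[OF l2[OF t]] t by (simp add: zero_le_mult_iff)
  show "synth (\<lambda>j. y1 j t) \<in> Hdot \<Omega> lam \<phi> 2"
    "Hdot_norm \<Omega> lam \<phi> 2 (synth (\<lambda>j. y1 j t)) \<le> (1 + 1 / lam 0) * (C * t powr p)"
    using Hdot_2_bound[OF synth'(1)[OF t], of "C * t powr p"] l2leD[OF l2[OF t]]
    unfolding synth'(2)[OF t] by auto
  \<comment> \<open>The exponent \<open>p\<close> may have either sign, so the maximum of the power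
    over [t/2, T] is bounded by the sum of its two endpoint values.\<close>
  define B where "B = C * ((t / 2) powr p + T powr p)"
  have B0: "0 \<le> B" using C by (simp add: B_def)
  show "has_L2_derivative \<Omega> T w (synth (\<lambda>j. y1 j t)) t"
  proof (rule has_L2_derivative_of_coef[where g="\<lambda>s. synth (\<lambda>j. y1 j s)", OF t w(1) synth'(1) _ B0])
    fix s j assume s: "s \<in> {0<..T}"
    show "((\<lambda>s. coef (w s) j) has_real_derivative coef (synth (\<lambda>j. y1 j s)) j) (at s within {0..T})"
      unfolding synth'(2)[OF s]
      by (rule has_field_derivative_transform_within[OF der[OF s], of s])
         (use s w(2) in \<open>auto simp: dist_real_def\<close>)
  next
    fix s n assume s: "s \<in> {t/2..T}"
    then have s': "s \<in> {0<..T}" using t by auto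
    have "s powr p \<le> (t / 2) powr p + T powr p"
    proof (cases "0 \<le> p")
      case True
      then have "s powr p \<le> T powr p" using s' by (intro powr_mono2) auto
      then show ?thesis using powr_ge_zero[of "t / 2" p] by linarith
    next
      case False
      then have "s powr p \<le> (t / 2) powr p" using s t by (intro powr_mono2') auto
      then show ?thesis using powr_ge_zero[of T p] by linarith
    qed
    then have "C * s powr p \<le> B" unfolding B_def using C by (rule mult_left_mono)
    from l2leD(2)[OF l2le_mono[OF l2[OF s'] this]]
    show "(\<Sum>j<n. (lam j * coef (synth (\<lambda>j. y1 j s)) j)\<^sup>2) \<le> B\<^sup>2"
      unfolding synth'(2)[OF s'] .
  qed
qed

text \<open>Of the \<open>m + 1\<close> Laplacians, \<open>m\<close> go with their signs into the
  coefficients of the source term; the remaining one is the weight for the norm of order 2.\<close>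

lemma laplacian_power_l2le:
  assumes "laplacian_power_le \<Omega> lam \<phi> (m + 1) w q"
  shows "l2le (\<lambda>j. lam j * ((- lam j) ^ m * coef w j)) q"
proof (rule l2leI)
  have "(lam j * ((- lam j) ^ m * coef w j))\<^sup>2 = (lam j ^ (m + 1) * coef w j)\<^sup>2" for j
    using power2_minus_lam[of j m "lam j * coef w j"] by (simp add: mult_ac)
  then show "(\<Sum>j<n. (lam j * ((- lam j) ^ m * coef w j))\<^sup>2) \<le> q\<^sup>2" for n
    using laplacian_power_leD(3)[OF assms, of "{..<n}"] by simp
qed (rule laplacian_power_leD(2)[OF assms])

text \<open>By Parseval, the \<open>m\<close>-th power of the Laplacian does not increase norms from
  \<open>Hdot\<close> of order \<open>2 * m\<close> to L2, so continuity and boundedness on [0,T]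
  carry over to \<open>G\<close>.\<close>

lemma laplacian_power_continuous:
  assumes T: "0 < T" and ft: "continuous_Hdot \<Omega> lam \<phi> (2 * real m) T ft"
  defines "G \<equiv> \<lambda>s. (laplacian \<Omega> ^^ m) (ft s)"
  shows "s \<in> {0..T} \<Longrightarrow> G s \<in> L2 \<Omega>"
    and "s \<in> {0..T} \<Longrightarrow> coef (G s) j = (- lam j) ^ m * coef (ft s) j"
    and "w \<in> L2 \<Omega> \<Longrightarrow> continuous_on {0..T} (\<lambda>s. L2_inner \<Omega> (G s) w)"
    and "\<exists>B. \<forall>s\<in>{0..T}. L2_norm \<Omega> (G s) \<le> B"
proof -
  let ?H = "Hdot_norm \<Omega> lam \<phi> (2 * real m)"
  let ?N = "\<lambda>r s. L2_norm \<Omega> (\<lambda>x. G r x - G s x)"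
  have ft2: "ft s \<in> L2 \<Omega>" and sm: "summable (\<lambda>j. (lam j ^ m * coef (ft s) j)\<^sup>2)"
    and lim: "((\<lambda>r. ?H (\<lambda>x. ft r x - ft s x)) \<longlongrightarrow> 0) (at s within {0..T})"
    if "s \<in> {0..T}" for s
    using ft that unfolding continuous_Hdot_def Hdot_iff by auto
  have GL: "G s \<in> L2 \<Omega>" and Gcoef: "\<And>j. coef (G s) j = (- lam j) ^ m * coef (ft s) j" if "s \<in> {0..T}" for s
    using laplacian_power_coef[OF ft2[OF that] sm[OF that]] by (auto simp: G_def)
  then show "s \<in> {0..T} \<Longrightarrow> G s \<in> L2 \<Omega>"
    "s \<in> {0..T} \<Longrightarrow> coef (G s) j = (- lam j) ^ m * coef (ft s) j" by auto
  have le: "?N r s \<le> ?H (\<lambda>x. ft r x - ft s x)"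
    if r: "r \<in> {0..T}" and s: "s \<in> {0..T}" for r s
  proof -
    define d where "d = (\<lambda>x. ft r x - ft s x)"
    have GD: "(\<lambda>x. G r x - G s x) \<in> L2 \<Omega>" by (intro L2_diff GL r s)
    have c: "(coef (\<lambda>x. G r x - G s x) j)\<^sup>2 = (lam j ^ m * coef d j)\<^sup>2" for j
      unfolding d_def coef_diff[OF GL[OF r] GL[OF s]] coef_diff[OF ft2[OF r] ft2[OF s]] Gcoef[OF r] Gcoef[OF s]
        right_diff_distrib[symmetric] power2_minus_lam ..
    have smd: "summable (\<lambda>j. (lam j ^ m * coef d j)\<^sup>2)"
      using summable_coef[OF GD] unfolding c .
    have H: "?H d = sqrt ((L2_norm \<Omega> d)\<^sup>2 + (\<Sum>j. (lam j ^ m * coef d j)\<^sup>2))"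
      unfolding Hdot_norm_def lam_powr ..
    have nn: "0 \<le> (\<Sum>j. (lam j ^ m * coef d j)\<^sup>2)" using smd by (intro suminf_nonneg) auto
    have "?N r s \<le> ?H d"
    proof (rule norm_le_of_coef[OF GD])
      show "0 \<le> ?H d" using nn unfolding H by simp
      fix n
      have "(\<Sum>j<n. (lam j ^ m * coef d j)\<^sup>2) \<le> (\<Sum>j. (lam j ^ m * coef d j)\<^sup>2)"
        by (rule sum_le_suminf[OF smd]) auto
      also have "\<dots> \<le> (?H d)\<^sup>2"
        using nn unfolding H by simp
      finally show "(\<Sum>j<n. (coef (\<lambda>x. G r x - G s x) j)\<^sup>2) \<le> (?H d)\<^sup>2"
        unfolding c .
    qed
    then show ?thesis unfolding d_def .
  qed
  have Glim: "((\<lambda>r. ?N r s) \<longlongrightarrow> 0) (at s within {0..T})" if s: "s \<in> {0..T}" for s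
  proof (rule Lim_null_comparison[OF _ lim[OF s]])
    show "\<forall>\<^sub>F r in at s within {0..T}. norm (?N r s)
        \<le> ?H (\<lambda>x. ft r x - ft s x)"
      unfolding eventually_at_filter using le s by (intro always_eventually) auto
  qed
  show "continuous_on {0..T} (\<lambda>s. L2_inner \<Omega> (G s) w)" if w: "w \<in> L2 \<Omega>"
    unfolding continuous_on_def
  proof
    fix s assume s: "s \<in> {0..T}"
    show "((\<lambda>r. L2_inner \<Omega> (G r) w) \<longlongrightarrow> L2_inner \<Omega> (G s) w) (at s within {0..T})"
    proof (rule LIM_zero_cancel, rule Lim_null_comparison)
      show "((\<lambda>r. ?N r s * L2_norm \<Omega> w) \<longlongrightarrow> 0) (at s within {0..T})"
        by (rule tendsto_mult_left_zero[OF Glim[OF s]])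
      have "norm (L2_inner \<Omega> (G r) w - L2_inner \<Omega> (G s) w) \<le> ?N r s * L2_norm \<Omega> w"
        if r: "r \<in> {0..T}" for r
        unfolding L2_inner_diff_left[OF GL[OF r] GL[OF s] w, symmetric] real_norm_def
        by (rule L2_Cauchy_Schwarz[OF L2_diff[OF GL[OF r] GL[OF s]] w])
      then show "\<forall>\<^sub>F r in at s within {0..T}. norm (L2_inner \<Omega> (G r) w - L2_inner \<Omega> (G s) w)
          \<le> ?N r s * L2_norm \<Omega> w"
        unfolding eventually_at_filter by (intro always_eventually) auto
    qed
  qed
  have "continuous_on {0..T} (\<lambda>s. L2_norm \<Omega> (G s))"
    unfolding continuous_on_def
  proof
    fix s assume s: "s \<in> {0..T}"
    show "((\<lambda>r. L2_norm \<Omega> (G r)) \<longlongrightarrow> L2_norm \<Omega> (G s)) (at s within {0..T})"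
    proof (rule LIM_zero_cancel, rule Lim_null_comparison[OF _ Glim[OF s]])
      have "norm (L2_norm \<Omega> (G r) - L2_norm \<Omega> (G s)) \<le> ?N r s" if r: "r \<in> {0..T}" for r
        using L2_norm_triangle[OF L2_diff[OF GL[OF r] GL[OF s]] GL[OF s]]
          L2_norm_triangle[OF L2_diff[OF GL[OF s] GL[OF r]] GL[OF r]]
          L2_norm_minus_commute[of \<Omega> "G r" "G s"] by simp
      then show "\<forall>\<^sub>F r in at s within {0..T}. norm (L2_norm \<Omega> (G r) - L2_norm \<Omega> (G s)) \<le> ?N r s"
        unfolding eventually_at_filter by (intro always_eventually) auto
    qed
  qed
  then have "compact ((\<lambda>s. L2_norm \<Omega> (G s)) ` {0..T})" by (rule compact_continuous_image) simp
  then obtain B where B: "\<And>y. y \<in> (\<lambda>s. L2_norm \<Omega> (G s)) ` {0..T} \<Longrightarrow> norm y \<le> B"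
    using compact_imp_bounded bounded_iff by metis
  have "L2_norm \<Omega> (G s) \<le> B" if "s \<in> {0..T}" for s
    using B[OF imageI[OF that]] by simp
  then show "\<exists>B. \<forall>s\<in>{0..T}. L2_norm \<Omega> (G s) \<le> B" by blast
qed

end

section \<open>Assembly of the two estimates\<close>

theorem theorem2p1:
  fixes \<Omega> :: "(real^'d) set" and lam :: "nat \<Rightarrow> real" and \<phi> :: "nat \<Rightarrow> real^'d \<Rightarrow> real"
    and u0 :: "real^'d \<Rightarrow> real" and f f1 v ft F :: "real \<Rightarrow> real^'d \<Rightarrow> real"
    and m :: nat and \<alpha> T \<sigma> Q0 Q1 :: real
  assumes "CARD('d) \<le> 3" and "smooth_bounded_domain \<Omega>" and "dirichlet_eigensystem \<Omega> lam \<phi>"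
    and "m \<ge> 1" and "0 < \<alpha>" and "\<alpha> < 1" and "T > 0" and "0 < \<sigma>" and "\<sigma> < 1"
    and ft: "ft = (\<lambda>t x. f t x + laplacian \<Omega> u0 x)"
    and F: "F = rl_integral \<Omega> (real m * \<alpha>) (\<lambda>s. (laplacian \<Omega> ^^ m) (ft s))"
    and "subdiffusion_solution \<Omega> \<alpha> T F v"
    and "duhamel_formula \<Omega> lam \<phi> \<alpha> T F v"
    and "continuous_Hdot \<Omega> lam \<phi> (2 * real m) T ft"
    and "laplacian_power_le \<Omega> lam \<phi> (m + 2) u0 Q0"
    and "\<And>t. t \<in> {0<..T} \<Longrightarrow> f t \<in> Hdot \<Omega> lam \<phi> (2 * real (m + 1))"
    and "\<And>t. t \<in> {0<..T} \<Longrightarrow> has_L2_derivative \<Omega> T f (f1 t) t"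
    and "\<And>t. t \<in> {0<..T} \<Longrightarrow> laplacian_power_le \<Omega> lam \<phi> (m + 1) (f1 t) (Q1 * t powr (- \<sigma>))"
  shows "\<exists>v1. (\<forall>t\<in>{0<..T}. has_L2_derivative \<Omega> T v (v1 t) t \<and> v1 t \<in> Hdot \<Omega> lam \<phi> 2) \<and>
     (\<exists>Q>0. \<forall>t\<in>{0<..T}. Hdot_norm \<Omega> lam \<phi> 2 (v1 t) \<le> Q * t powr (real (m + 1) * \<alpha> - 1)) \<and>
     (\<forall>f2 Q2.
        (\<forall>t\<in>{0<..T}. has_L2_derivative \<Omega> T f1 (f2 t) t \<and>
           laplacian_power_le \<Omega> lam \<phi> (m + 1) (f2 t) (Q2 * t powr (- \<sigma>))) \<longrightarrow>
        (\<exists>v2. (\<forall>t\<in>{0<..T}. has_L2_derivative \<Omega> T v1 (v2 t) t \<and> v2 t \<in> Hdot \<Omega> lam \<phi> 2) \<and>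
           (\<exists>Q>0. \<forall>t\<in>{0<..T}.
              Hdot_norm \<Omega> lam \<phi> 2 (v2 t) \<le> Q * t powr (real (m + 1) * \<alpha> - 2))))"
proof -
  note dom = assms(2) and eig = assms(3) and m1 = assms(4) and \<alpha> = assms(5,6) and T = assms(7)
    and \<sigma> = assms(8,9) and duhamel = assms(13) and cont = assms(14) and u0 = assms(15)
    and fH = assms(16) and fder = assms(17) and f1le = assms(18)
  interpret dirichlet \<Omega> lam \<phi>
    using dom eig by unfold_locales (auto simp: smooth_bounded_domain_def)
  define \<nu> where "\<nu> = real (m + 1) * \<alpha>"
  have m\<alpha>: "0 < real m * \<alpha>" using \<alpha> m1 by simp
  then have \<nu>: "\<alpha> \<le> \<nu>" "0 < \<nu>" "\<nu> = real m * \<alpha> + \<alpha>"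
    using \<alpha> by (auto simp: \<nu>_def distrib_right)
  define K where "K = (\<lambda>j. ml_kernel \<alpha> (lam j) \<nu>)"
  define e where "e = (\<lambda>j. ml_kernel \<alpha> (lam j) \<alpha>)"
  have relax: "relaxation \<alpha> (lam j)" for j using \<alpha> lam_pos by unfold_locales
  have K_le: "kernel_le T 1 \<nu> (K j)" for j
    unfolding K_def by (rule relaxation.kernel_le_ml_kernel[OF relax \<alpha>(2) \<nu>(1)])
  have e_le: "kernel_le T 1 \<alpha> (e j)" for j
    unfolding e_def by (rule relaxation.kernel_le_ml_kernel[OF relax \<alpha>(2) order_refl])
  have K_cont: "continuous_on {0<..} (K j)" for j
    unfolding K_def by (rule relaxation.ml_kernel_continuous_on[OF relax \<nu>(2)])
  \<comment> \<open>The Duhamel kernel and the fractional integral in the source merge into the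
    single kernel \<open>K j\<close>, which accounts for
    \<open>\<nu> = (m + 1) * \<alpha>\<close>.\<close>
  have e_K: "conv (e j) (rl_kernel (real m * \<alpha>)) t = K j t" if "0 < t" for j t
    using relaxation.conv_rl_ml_kernel[OF relax m\<alpha> \<alpha>(1) that, of j] \<nu>(3)
    unfolding K_def e_def by (simp add: conv_commute[of "ml_kernel \<alpha> (lam j) \<alpha>"])

  define G where "G = (\<lambda>s. (laplacian \<Omega> ^^ m) (ft s))"
  define d where "d = (\<lambda>j s. coef (G s) j)"
  note lpc = laplacian_power_continuous[OF T cont]
  have GL: "G s \<in> L2 \<Omega>" and d_eq: "\<And>j. d j s = (- lam j) ^ m * coef (ft s) j" if "s \<in> {0..T}" for s
    using lpc(1,2)[OF that] by (simp_all add: G_def d_def)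
  have Gc: "continuous_on {0..T} (\<lambda>s. L2_inner \<Omega> (G s) w)" if "w \<in> L2 \<Omega>" for w
    using lpc(3)[OF that] by (simp add: G_def)
  obtain BG where "\<forall>s\<in>{0..T}. L2_norm \<Omega> (G s) \<le> BG"
    using lpc(4) unfolding G_def by blast
  then have BG: "L2_norm \<Omega> (G s) \<le> BG" if "s \<in> {0..T}" for s using that by blast
  have F_L2: "F s \<in> L2 \<Omega>" and F_coef: "\<And>j. coef (F s) j = conv (rl_kernel (real m * \<alpha>)) (d j) s"
    if "s \<in> {0..T}" for s
    using rl_integral_coef[where G=G, OF GL Gc BG m\<alpha> that] unfolding F G_def[symmetric] d_def by auto
  have d_cont: "continuous_on {0..T} (d j)" for j
    unfolding d_def coef_def by (rule Gc) simp

  have v_L2: "v t \<in> L2 \<Omega>" and v_coef: "\<And>j. coef (v t) j = conv (K j) (d j) t" if t: "t \<in> {0..T}" for t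
  proof -
    note vd = duhamel_coef[OF \<alpha> duhamel F_L2 t]
    show "v t \<in> L2 \<Omega>" by (rule vd(1))
    fix j
    define d' where "d' = (\<lambda>s. indicator {0..T} s * d j s)"
    have "compact (d j ` {0..T})" using d_cont by (rule compact_continuous_image) simp
    then obtain B where B: "\<And>y. y \<in> d j ` {0..T} \<Longrightarrow> norm y \<le> B"
      using compact_imp_bounded bounded_iff by metis
    have d': "kernel_le T B 1 d'"
      unfolding kernel_le_def
    proof (intro conjI ballI)
      show "d' \<in> borel_measurable borel"
        using borel_measurable_continuous_on_indicator[OF _ d_cont[of j]] unfolding d'_def by simp
      show "0 \<le> B" using B[of "d j 0"] T by auto
      fix s assume "s \<in> {0<..T}"
      then show "\<bar>d' s\<bar> \<le> B * rl_kernel 1 s" using B[of "d j s"] by (simp add: d'_def)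
    qed simp
    have "coef (v t) j = conv (e j) (\<lambda>s. coef (F s) j) t" unfolding e_def by (rule vd(2))
    also have "\<dots> = conv (e j) (conv (rl_kernel (real m * \<alpha>)) d') t"
    proof (intro conv_cong refl)
      fix s assume s: "0 < s" "s < t"
      then have "coef (F s) j = conv (rl_kernel (real m * \<alpha>)) (d j) s" using F_coef t by auto
      also have "\<dots> = conv (rl_kernel (real m * \<alpha>)) d' s"
        by (rule conv_cong) (use s t in \<open>auto simp: d'_def\<close>)
      finally show "coef (F s) j = conv (rl_kernel (real m * \<alpha>)) d' s" .
    qed
    also have "\<dots> = conv (conv (e j) (rl_kernel (real m * \<alpha>))) d' t"
      by (rule conv_assoc[OF e_le kernel_le_rl_kernel[OF m\<alpha>] d']) (use t in simp)
    also have "\<dots> = conv (K j) (d j) t"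
      by (rule conv_cong) (use t e_K in \<open>auto simp: d'_def\<close>)
    finally show "coef (v t) j = conv (K j) (d j) t" .
  qed

  \<comment> \<open>With this exponent \<open>t powr (- \<sigma>)\<close> equals
    \<open>Gamma b * rl_kernel b t\<close>, and \<open>\<sigma> < 1\<close> is what makes it an
    admissible kernel.\<close>
  define b where "b = 1 - \<sigma>"
  have b: "0 < b" using \<sigma> by (simp add: b_def)
  have powr_\<sigma>: "Q * t powr (- \<sigma>) = Q * Gamma b * rl_kernel b t" for Q t
    using powr_conv_rl_kernel[OF b, of t] by (simp add: b_def)
  define g1 where "g1 = (\<lambda>j t. (- lam j) ^ m * coef (f1 t) j)"
  have Lu0: "laplacian \<Omega> u0 \<in> L2 \<Omega>" "\<And>j. coef (laplacian \<Omega> u0) j = - lam j * coef u0 j"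
    and Lu0_sm: "summable (\<lambda>j. (lam j ^ (m + 1) * coef (laplacian \<Omega> u0) j)\<^sup>2)"
  proof -
    note u = laplacian_power_leD[OF u0]
    have s1: "summable (\<lambda>j. (lam j * coef u0 j)\<^sup>2)"
      using lam_power_summable_mono[OF u(4), of 1] by simp
    show "laplacian \<Omega> u0 \<in> L2 \<Omega>" and c: "coef (laplacian \<Omega> u0) j = - lam j * coef u0 j" for j
      using laplacian_coef[OF u(1) s1] by auto
    have "(lam j ^ (m + 1) * coef (laplacian \<Omega> u0) j)\<^sup>2 = (lam j ^ (m + 2) * coef u0 j)\<^sup>2" for j
      unfolding c by (simp add: power_mult_distrib)
    then show "summable (\<lambda>j. (lam j ^ (m + 1) * coef (laplacian \<Omega> u0) j)\<^sup>2)" using u(4) by simp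
  qed
  have fL: "f t \<in> L2 \<Omega>" "summable (\<lambda>j. (lam j ^ (m + 1) * coef (f t) j)\<^sup>2)" if "t \<in> {0<..T}" for t
    using fH[OF that] unfolding Hdot_iff by auto
  have d_f: "d j t = (- lam j) ^ m * (coef (f t) j + coef (laplacian \<Omega> u0) j)" if "t \<in> {0<..T}" for j t
    using d_eq[of t j] coef_add[OF fL(1)[OF that] Lu0(1)] that unfolding ft by simp
  have d_der: "(d j has_real_derivative g1 j t) (at t within {0..T})" if t: "t \<in> {0<..T}" for j t
  proof -
    have "((\<lambda>s. (- lam j) ^ m * (coef (f s) j + coef (laplacian \<Omega> u0) j)) has_real_derivative g1 j t) (at t within {0..T})"
      unfolding g1_def using coef_has_derivative[OF fder[OF t], of j] by (auto intro!: derivative_eq_intros)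
    then show ?thesis
      by (rule has_field_derivative_transform_within[of _ _ _ _ t])
         (use t d_f in \<open>auto simp: dist_real_def\<close>)
  qed
  interpret W1: weighted_family lam T b "Q1 * Gamma b" d g1
  proof
    show "l2le (\<lambda>j. lam j * g1 j t) (Q1 * Gamma b * rl_kernel b t)" if t: "t \<in> {0<..T}" for t
      using laplacian_power_l2le[OF f1le[OF t]] unfolding g1_def powr_\<sigma> .
  qed (use lam_pos T b d_der in auto)
  have TT: "T \<in> {0<..T}" using T by simp
  \<comment> \<open>The time \<open>T\<close> is the anchor for all initial values: there
    \<open>f T\<close> lies in the space of order \<open>2 * (m + 1)\<close>, and the bound on
    \<open>u0\<close> with \<open>m + 2\<close> Laplacians gives the same for the Laplacian of
    \<open>u0\<close>.\<close>
  obtain A where A: "l2le (\<lambda>j. lam j * d j T) A"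
  proof -
    obtain A1 A2 where A12: "l2le (\<lambda>j. lam j ^ (m + 1) * coef (f T) j) A1"
      "l2le (\<lambda>j. lam j ^ (m + 1) * coef (laplacian \<Omega> u0) j) A2"
      using l2le_of_summable[OF fL(2)[OF TT]] l2le_of_summable[OF Lu0_sm] by blast
    have "l2le (\<lambda>j. (-1) ^ m * (lam j ^ (m + 1) * coef (f T) j + lam j ^ (m + 1) * coef (laplacian \<Omega> u0) j)) (1 * (A1 + A2))"
      by (rule l2le_mult[OF _ l2le_add[OF A12]]) (simp add: power_abs)
    moreover have "(-1) ^ m * (lam j ^ (m + 1) * coef (f T) j + lam j ^ (m + 1) * coef (laplacian \<Omega> u0) j) = lam j * d j T" for j
      unfolding d_f[OF TT] power_minus[of "lam j" m] by (simp add: distrib_left mult_ac)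
    ultimately show ?thesis using that by simp
  qed
  \<comment> \<open>The limit of \<open>d j\<close> at 0, equal to \<open>d j 0\<close> by
    continuity; in this form its weighted bound comes from \<open>initial_value_l2\<close>.\<close>
  define i0 where "i0 = (\<lambda>j. d j T - conv (rl_kernel 1) (g1 j) T)"
  define y1 where "y1 = (\<lambda>j t. i0 j * K j t + conv (K j) (g1 j) t)"
  obtain C1 where C1: "\<And>t. t \<in> {0<..T} \<Longrightarrow> l2le (\<lambda>j. lam j * y1 j t) (C1 * t powr (\<nu> - 1))"
    using W1.derivative_l2[where K=K, OF K_le \<nu>(2) A] unfolding y1_def i0_def by blast
  have y_der: "(conv (K j) (d j) has_real_derivative y1 j t) (at t within {0..T})" if "t \<in> {0<..T}" for j t
    unfolding y1_def i0_def by (rule W1.conv_c_has_derivative[OF K_le K_cont that])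
  have v': "v s \<in> L2 \<Omega>" "\<And>j. coef (v s) j = conv (K j) (d j) s" if "s \<in> {0<..T}" for s
    using v_L2 v_coef that by auto
  \<comment> \<open>Fixed before \<open>f2\<close> and \<open>Q2\<close> enter, so that the second
    estimate concerns the same derivative as the first.\<close>
  define v1 where "v1 = (\<lambda>t. synth (\<lambda>j. y1 j t))"
  note V1 = L2_derivative_synth[OF v' y_der C1]
  have bound_pos: "\<exists>Q>0. \<forall>t\<in>{0<..T}. Hdot_norm \<Omega> lam \<phi> 2 (w t) \<le> Q * t powr p"
    if "\<And>t. t \<in> {0<..T} \<Longrightarrow> Hdot_norm \<Omega> lam \<phi> 2 (w t) \<le> (1 + 1 / lam 0) * (C * t powr p)" for w C p
  proof (intro exI[of _ "\<bar>(1 + 1 / lam 0) * C\<bar> + 1"] conjI ballI)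
    fix t assume "t \<in> {0<..T}"
    from that[OF this] have "Hdot_norm \<Omega> lam \<phi> 2 (w t) \<le> ((1 + 1 / lam 0) * C) * t powr p" by (simp only: mult.assoc)
    also have "\<dots> \<le> (\<bar>(1 + 1 / lam 0) * C\<bar> + 1) * t powr p" by (intro mult_right_mono) auto
    finally show "Hdot_norm \<Omega> lam \<phi> 2 (w t) \<le> (\<bar>(1 + 1 / lam 0) * C\<bar> + 1) * t powr p" .
  qed simp

  let ?second = "\<exists>v2. (\<forall>t\<in>{0<..T}. has_L2_derivative \<Omega> T v1 (v2 t) t \<and> v2 t \<in> Hdot \<Omega> lam \<phi> 2) \<and>
      (\<exists>Q>0. \<forall>t\<in>{0<..T}. Hdot_norm \<Omega> lam \<phi> 2 (v2 t) \<le> Q * t powr (real (m + 1) * \<alpha> - 2))"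
  have second: ?second
    if f2: "\<And>t. t \<in> {0<..T} \<Longrightarrow> has_L2_derivative \<Omega> T f1 (f2 t) t"
      "\<And>t. t \<in> {0<..T} \<Longrightarrow> laplacian_power_le \<Omega> lam \<phi> (m + 1) (f2 t) (Q2 * t powr (- \<sigma>))" for f2 Q2
  proof -
    define g2 where "g2 = (\<lambda>j t. (- lam j) ^ m * coef (f2 t) j)"
    interpret W2: weighted_family lam T b "Q2 * Gamma b" g1 g2
    proof
      show "l2le (\<lambda>j. lam j * g2 j t) (Q2 * Gamma b * rl_kernel b t)" if t: "t \<in> {0<..T}" for t
        using laplacian_power_l2le[OF f2(2)[OF t]] unfolding g2_def powr_\<sigma> .
      show "(g1 j has_real_derivative g2 j t) (at t within {0..T})" if t: "t \<in> {0<..T}" for j t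
        unfolding g1_def g2_def by (intro DERIV_cmult coef_has_derivative f2(1) t)
    qed (use lam_pos T b in auto)
    define z where "z = (\<lambda>j t. (g1 j T - conv (rl_kernel 1) (g2 j) T) * K j t + conv (K j) (g2 j) t)"
    \<comment> \<open>The derivative of \<open>K j\<close> appears only next to the constant
      \<open>i0 j\<close>. The term \<open>z\<close> is the derivative of the convolution of
      \<open>K j\<close> with \<open>g1 j\<close>, where the limit of \<open>g1 j\<close> at 0 takes
      over the role of \<open>i0 j\<close>.\<close>
    define y2 where "y2 = (\<lambda>j t. i0 j * deriv (K j) t + z j t)"
    obtain C2 where C2: "\<And>t. t \<in> {0<..T} \<Longrightarrow> l2le (\<lambda>j. lam j * z j t) (C2 * t powr (\<nu> - 1))"
      using W2.derivative_l2[where K=K, OF K_le \<nu>(2) W1.g_l2[OF TT]] unfolding z_def by blast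
    obtain A0 where A0: "l2le (\<lambda>j. lam j * i0 j) A0"
      using W1.initial_value_l2[OF A] unfolding i0_def by blast
    have y1_der: "(y1 j has_real_derivative y2 j t) (at t within {0..T})" if t: "t \<in> {0<..T}" for j t
      unfolding y1_def y2_def
    proof (intro DERIV_add DERIV_cmult)
      show "(K j has_real_derivative deriv (K j) t) (at t within {0..T})"
        unfolding K_def
        by (rule has_field_derivative_at_within[OF ml_kernel_deriv(1)[OF \<alpha> lam_pos \<nu>(1)]]) (use t in simp)
      show "(conv (K j) (g1 j) has_real_derivative z j t) (at t within {0..T})"
        unfolding z_def by (rule W2.conv_c_has_derivative[OF K_le K_cont t])
    qed
    \<comment> \<open>The first part is the bound on the derivative of the kernel, the second uses
      \<open>t powr (\<nu> - 1) \<le> T * t powr (\<nu> - 2)\<close>. The absolute value spares a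
      separate argument for the sign of \<open>C2\<close>.\<close>
    define C where "C = (\<nu> + 2) / Gamma \<nu> * A0 + \<bar>C2\<bar> * T"
    have y2_l2: "l2le (\<lambda>j. lam j * y2 j t) (C * t powr (\<nu> - 2))" if t: "t \<in> {0<..T}" for t
    proof -
      have t0: "0 < t" "t \<le> T" using t by auto
      have tp: "t powr (\<nu> - 1) = t * t powr (\<nu> - 2)"
        using powr_mult_base[of t "\<nu> - 2"] t0 by simp
      have "(\<nu> + 2) * (rl_kernel \<nu> t / t) = (\<nu> + 2) / Gamma \<nu> * t powr (\<nu> - 2)"
        using t0 by (simp add: rl_kernel_def tp)
      then have "\<bar>deriv (K j) t\<bar> \<le> (\<nu> + 2) / Gamma \<nu> * t powr (\<nu> - 2)" for j
        using ml_kernel_deriv(2)[OF \<alpha> lam_pos \<nu>(1) t0(1), of j] unfolding K_def by simp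
      from l2le_add[OF l2le_mult[where k="\<lambda>j. deriv (K j) t", OF this A0] C2[OF t]]
      have "l2le (\<lambda>j. deriv (K j) t * (lam j * i0 j) + lam j * z j t)
          ((\<nu> + 2) / Gamma \<nu> * t powr (\<nu> - 2) * A0 + C2 * t powr (\<nu> - 1))" .
      also have "(\<lambda>j. deriv (K j) t * (lam j * i0 j) + lam j * z j t) = (\<lambda>j. lam j * y2 j t)"
        by (simp add: y2_def distrib_left mult_ac)
      finally show ?thesis
      proof (rule l2le_mono)
        have "C2 * t \<le> \<bar>C2\<bar> * T" using t0 by (intro mult_mono) auto
        then have "C2 * t * t powr (\<nu> - 2) \<le> \<bar>C2\<bar> * T * t powr (\<nu> - 2)" by (rule mult_right_mono) simp
        moreover have "C2 * t powr (\<nu> - 1) = C2 * t * t powr (\<nu> - 2)" by (simp add: tp)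
        moreover have "C * t powr (\<nu> - 2) = (\<nu> + 2) / Gamma \<nu> * t powr (\<nu> - 2) * A0 + \<bar>C2\<bar> * T * t powr (\<nu> - 2)"
          unfolding C_def distrib_right by (simp only: mult_ac)
        ultimately show "(\<nu> + 2) / Gamma \<nu> * t powr (\<nu> - 2) * A0 + C2 * t powr (\<nu> - 1) \<le> C * t powr (\<nu> - 2)"
          by linarith
      qed
    qed
    have "v1 s \<in> L2 \<Omega>" "\<And>j. coef (v1 s) j = y1 j s" if "s \<in> {0<..T}" for s
      using V1(1,2) that unfolding v1_def by auto
    note V2 = L2_derivative_synth[OF this y1_der y2_l2]
    show ?thesis
    proof (intro exI[of _ "\<lambda>t. synth (\<lambda>j. y2 j t)"] conjI ballI)
      show "has_L2_derivative \<Omega> T v1 (synth (\<lambda>j. y2 j t)) t" "synth (\<lambda>j. y2 j t) \<in> Hdot \<Omega> lam \<phi> 2"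
        if "t \<in> {0<..T}" for t using V2(3,4) that by auto
      show "\<exists>Q>0. \<forall>t\<in>{0<..T}. Hdot_norm \<Omega> lam \<phi> 2 (synth (\<lambda>j. y2 j t)) \<le> Q * t powr (real (m + 1) * \<alpha> - 2)"
        unfolding \<nu>_def[symmetric] by (rule bound_pos) (use V2(5) in auto)
    qed
  qed
  show ?thesis
  proof (rule exI[of _ v1], intro conjI)
    show "\<forall>t\<in>{0<..T}. has_L2_derivative \<Omega> T v (v1 t) t \<and> v1 t \<in> Hdot \<Omega> lam \<phi> 2"
      using V1(3,4) unfolding v1_def by auto
    show "\<exists>Q>0. \<forall>t\<in>{0<..T}. Hdot_norm \<Omega> lam \<phi> 2 (v1 t) \<le> Q * t powr (real (m + 1) * \<alpha> - 1)"
      unfolding \<nu>_def[symmetric] by (rule bound_pos) (use V1(5) in \<open>auto simp: v1_def\<close>)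
    show "\<forall>f2 Q2. (\<forall>t\<in>{0<..T}. has_L2_derivative \<Omega> T f1 (f2 t) t \<and>
        laplacian_power_le \<Omega> lam \<phi> (m + 1) (f2 t) (Q2 * t powr (- \<sigma>))) \<longrightarrow>
      ?second"
    proof (intro allI impI)
      fix f2 Q2
      assume f2: "\<forall>t\<in>{0<..T}. has_L2_derivative \<Omega> T f1 (f2 t) t \<and>
        laplacian_power_le \<Omega> lam \<phi> (m + 1) (f2 t) (Q2 * t powr (- \<sigma>))"
      show ?second
        by (rule second[of f2 Q2]) (use f2 in auto)
    qed
  qed
qed

end
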